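(* Let $\mathfrak{g}$ be a classical simple complex Lie algebra of type $A_n$ ($n\ge1$), $B_n$ ($n\ge2$), $C_n$ ($n\ge3$) or $D_n$ ($n\ge4$), let $\lambda\in\Lambda^{+}$ be dominant integral, and let $\varpi_1$ be the first fundamental weight. Let $\ell_i$ denote the $i$-th Euclidean coordinate of $\ell=\lambda+\rho$ in the embedding specified in the context, with $\ell_{-i}:=-\ell_i$ for $1\le i\le n$ in types $B_n,C_n,D_n$, and $\ell_0:=0$ in type $B_n$. Then the generating function $G_{\mathfrak{g}}^{\varpi_1}(\lambda,z)=\sum_{p\ge0}c_p^{\varpi_1}(\lambda)z^p$ is given by $$G_{\mathfrak{sl}_{n+1}}^{\varpi_{1}}(\lambda,z)=\frac{1}{z}\left(\prod_{i=1}^{n+1}\left(1+\frac{z}{1-(\ell_{i}-\frac{n}{2})z}\right)-1\right),$$ $$G_{\mathfrak{so}_{2n+1}}^{\varpi_{1}}(\lambda,z)=\frac{2}{z}\left(1-\frac{z}{4+2nz}\right)\left(\prod_{i=-n}^{n}\left(1+\frac{z}{2-(\ell_{i}-n+\frac{1}{2})z}\right)-1\right),$$ $$G_{\mathfrak{sp}_{2n}}^{\varpi_{1}}(\lambda,z)=\frac{2}{z}\left(1+\frac{z}{4+(2n+1)z}\right)\left(\prod_{\substack{i=-n\\ i\ne0}}^{n}\left(1+\frac{z}{2-(\ell_{i}-n)z}\right)-1\right),$$ $$G_{\mathfrak{so}_{2n}}^{\varpi_{1}}(\lambda,z)=\frac{2}{z}\left(1-\frac{z}{4+(2n-1)z}\right)\left(\prod_{\substack{i=-n\\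 i\ne0}}^{n}\left(1+\frac{z}{2-(\ell_{i}-n+1)z}\right)-1\right),$$ as rational functions of $z$, for types $A_n,B_n,C_n,D_n$ respectively. The product for $\mathfrak{so}_{2n+1}$ includes the index $i=0$.
   Context: Fix a Cartan subalgebra $\mathfrak{h}$ of $\mathfrak{g}$ ($\dim\mathfrak{g}=d$), positive roots $\Delta^+$ with simple roots $\alpha_1,\dots,\alpha_n$, fundamental weights $\varpi_1,\dots,\varpi_n$, and $\rho=\sum_i\varpi_i$. $\Lambda^{+}=\bigoplus_i\mathbb{Z}_{\ge0}\varpi_i$ is the set of dominant integral elements. $V(\lambda)$ is the irreducible representation of highest weight $\lambda\in\Lambda^{+}$, with representation map $\sigma_\lambda$ (extended to the universal enveloping algebra $U(\mathfrak{g})$). Euclidean embedding (with standard basis $e_i$ of $\mathbb{R}^{k}$): - $A_n$, $\mathfrak{g}=\mathfrak{sl}_{n+1}$: $k=n+1$, $\alpha_i=e_i-e_{i+1}$ ($1\le i\le n$), weights lying in the hyperplane of $\mathbb{R}^{n+1}$ orthogonal to $e_1+\cdots+e_{n+1}$; $\varpi_1=e_1-\frac{1}{n+1}(e_1+\cdots+e_{n+1})$; $\rho=\frac n2e_1+\frac{n-2}{2}e_2+\cdots-\frac n2e_{n+1}$. - $B_n$, $\mathfrak{g}=\mathfrak{so}_{2n+1}$: $k=n$, $\alpha_i=e_i-e_{i+1}$ ($1\le i\le n-1$), $\alpha_n=e_n$; $\varpi_1=e_1$; $\rho=\frac{2n-1}{2}e_1+\frac{2n-3}{2}e_2+\cdots+\frac12e_n$.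 - $C_n$, $\mathfrak{g}=\mathfrak{sp}_{2n}$: $k=n$, $\alpha_i=e_i-e_{i+1}$ ($1\le i\le n-1$), $\alpha_n=2e_n$; $\varpi_1=e_1$; $\rho=ne_1+(n-1)e_2+\cdots+e_n$. - $D_n$, $\mathfrak{g}=\mathfrak{so}_{2n}$: $k=n$, $\alpha_i=e_i-e_{i+1}$ ($1\le i\le n-1$), $\alpha_n=e_{n-1}+e_n$; $\varpi_1=e_1$; $\rho=(n-1)e_1+(n-2)e_2+\cdots+e_{n-1}$. Generalised Casimir operators: for $p\ge1$ and $0\ne\kappa\in\Lambda^{+}$ set $(Y_1,\dots,Y_p)_\kappa:=\mathrm{Tr}_{V(\kappa)}(\sigma_\kappa(Y_1)\circ\cdots\circ\sigma_\kappa(Y_p))$ for $Y_i\in\mathfrak{g}$. Let $\{X_i\}_{i=1}^d$ be a basis of $\mathfrak{g}$ and $\{\widetilde{X}_i^{\kappa}\}_{i=1}^d$ its dual basis with respect to the non-degenerate bilinear form $(\cdot,\cdot)_\kappa$. Define $K_0^{\kappa}:=\dim V(\kappa)\cdot1\in U(\mathfrak{g})$ and, for $p\ge1$, $$K_p^{\kappa}:=\sum_{i_1,\dots,i_p=1}^{d}(\widetilde{X}^{\kappa}_{i_1},\dots,\widetilde{X}^{\kappa}_{i_p})_{\kappa}\,X_{i_1}\cdots X_{i_p}\in U(\mathfrak{g}).$$ This is basis independent and central; $c_p^{\kappa}(\lambda)$ denotes the scalar by which $\sigma_\lambda(K_p^{\kappa})$ acts on $V(\lambda)$. *)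

theory Defs
  imports
    "HOL-Computational_Algebra.Formal_Laurent_Series"
    "Jordan_Normal_Form.Matrix"
begin

section \<open>Complex Lie algebras and their representations\<close>

class complex_vector = ab_group_add +
  fixes scaleC :: "complex \<Rightarrow> 'a \<Rightarrow> 'a" (infixr \<open>*\<^sub>C\<close> 75)
  assumes scaleC_add_right: "a *\<^sub>C (x + y) = a *\<^sub>C x + a *\<^sub>C y"
    and scaleC_add_left: "(a + b) *\<^sub>C x = a *\<^sub>C x + b *\<^sub>C x"
    and scaleC_scaleC: "a *\<^sub>C b *\<^sub>C x = (a * b) *\<^sub>C x"
    and scaleC_one: "1 *\<^sub>C x = x"

global_interpretation complex_vector: vector_space "scaleC :: complex \<Rightarrow> 'a \<Rightarrow> 'a::complex_vector"
  by unfold_locales (simp_all add: scaleC_add_right scaleC_add_left scaleC_scaleC scaleC_one)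

abbreviation clinear :: "('a::complex_vector \<Rightarrow> 'b::complex_vector) \<Rightarrow> bool" where
  "clinear \<equiv> Vector_Spaces.linear scaleC scaleC"

class complex_lie_algebra = complex_vector +
  fixes lie_bracket :: "'a \<Rightarrow> 'a \<Rightarrow> 'a"
  assumes lie_bracket_add_left: "lie_bracket (x + y) z = lie_bracket x z + lie_bracket y z"
    and lie_bracket_scaleC_left: "lie_bracket (c *\<^sub>C x) y = c *\<^sub>C lie_bracket x y"
    and lie_bracket_self: "lie_bracket x x = 0"
    and jacobi: "lie_bracket x (lie_bracket y z) + lie_bracket y (lie_bracket z x)
                   + lie_bracket z (lie_bracket x y) = 0"
    \<comment> \<open>Linearity in the second argument follows from linearity in the first one and alternation
      (\<^term>\<open>lie_bracket (x + y) (x + y) = 0\<close>).\<close>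

definition finite_dim :: "'v::complex_vector itself \<Rightarrow> bool" where
  "finite_dim _ \<longleftrightarrow> (\<exists>B::'v set. finite B \<and> complex_vector.span B = UNIV)"

definition lie_rep :: "('g::complex_lie_algebra \<Rightarrow> 'v::complex_vector \<Rightarrow> 'v) \<Rightarrow> bool" where
  "lie_rep \<sigma> \<longleftrightarrow>
     (\<forall>x. clinear (\<sigma> x)) \<and>
     (\<forall>x y v. \<sigma> (x + y) v = \<sigma> x v + \<sigma> y v) \<and>
     (\<forall>c x v. \<sigma> (c *\<^sub>C x) v = c *\<^sub>C \<sigma> x v) \<and>
     (\<forall>x y v. \<sigma> (lie_bracket x y) v = \<sigma> x (\<sigma> y v) - \<sigma> y (\<sigma> x v))"

definition irreducible_rep :: "('g::complex_lie_algebra \<Rightarrow> 'v::complex_vector \<Rightarrow> 'v) \<Rightarrow> bool" where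
  "irreducible_rep \<sigma> \<longleftrightarrow> lie_rep \<sigma> \<and> (\<exists>v::'v. v \<noteq> 0) \<and>
     (\<forall>W. complex_vector.subspace W \<and> (\<forall>x. \<forall>w\<in>W. \<sigma> x w \<in> W) \<longrightarrow> W = {0} \<or> W = UNIV)"

text \<open>The trace of an endomorphism of a finite-dimensional space, computed in some basis.\<close>

definition trace_end :: "('v::complex_vector \<Rightarrow> 'v) \<Rightarrow> complex" where
  "trace_end f =
     (let B = (SOME B::'v set. finite B \<and> complex_vector.independent B \<and> complex_vector.span B = UNIV)
      in \<Sum>b\<in>B. complex_vector.representation B (f b) b)"


section \<open>The universal enveloping algebra\<close>

text \<open>
  The universal enveloping algebra is the unital associative algebra generated by the elements of
  the Lie algebra subject to the relations making the inclusion of the generators linear and to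
  \<open>xy - yx = [x, y]\<close>, i.e. the quotient of the term algebra by the congruence generated by these
  relations and the axioms of a unital associative algebra.
\<close>

datatype 'g uea_term =
    Gen 'g
  | Zero
  | One
  | Add "'g uea_term" "'g uea_term"
  | Mult "'g uea_term" "'g uea_term"
  | Scale complex "'g uea_term"

inductive uea_eq :: "'g::complex_lie_algebra uea_term \<Rightarrow> 'g uea_term \<Rightarrow> bool" where
  uea_refl: "uea_eq a a"
| uea_sym: "uea_eq a b \<Longrightarrow> uea_eq b a"
| uea_trans: "uea_eq a b \<Longrightarrow> uea_eq b c \<Longrightarrow> uea_eq a c"
| uea_cong_Add: "uea_eq a a' \<Longrightarrow> uea_eq b b' \<Longrightarrow> uea_eq (Add a b) (Add a' b')"
| uea_cong_Mult: "uea_eq a a' \<Longrightarrow> uea_eq b b' \<Longrightarrow> uea_eq (Mult a b) (Mult a' b')"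
| uea_cong_Scale: "uea_eq a a' \<Longrightarrow> uea_eq (Scale c a) (Scale c a')"
| uea_Add_assoc: "uea_eq (Add (Add a b) c) (Add a (Add b c))"
| uea_Add_commute: "uea_eq (Add a b) (Add b a)"
| uea_Add_Zero: "uea_eq (Add Zero a) a"
| uea_Add_neg: "uea_eq (Add (Scale (-1) a) a) Zero"
| uea_Scale_Add_right: "uea_eq (Scale c (Add a b)) (Add (Scale c a) (Scale c b))"
| uea_Scale_Add_left: "uea_eq (Scale (c + d) a) (Add (Scale c a) (Scale d a))"
| uea_Scale_Scale: "uea_eq (Scale c (Scale d a)) (Scale (c * d) a)"
| uea_Scale_one: "uea_eq (Scale 1 a) a"
| uea_Mult_assoc: "uea_eq (Mult (Mult a b) c) (Mult a (Mult b c))"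
| uea_Mult_One_left: "uea_eq (Mult One a) a"
| uea_Mult_One_right: "uea_eq (Mult a One) a"
| uea_distrib_right: "uea_eq (Mult (Add a b) c) (Add (Mult a c) (Mult b c))"
| uea_distrib_left: "uea_eq (Mult a (Add b c)) (Add (Mult a b) (Mult a c))"
| uea_Scale_Mult_left: "uea_eq (Mult (Scale c a) b) (Scale c (Mult a b))"
| uea_Scale_Mult_right: "uea_eq (Mult a (Scale c b)) (Scale c (Mult a b))"
| uea_Gen_add: "uea_eq (Gen (x + y)) (Add (Gen x) (Gen y))"
| uea_Gen_scaleC: "uea_eq (Gen (c *\<^sub>C x)) (Scale c (Gen x))"
| uea_Gen_bracket:
    "uea_eq (Gen (lie_bracket x y))
       (Add (Mult (Gen x) (Gen y)) (Scale (-1) (Mult (Gen y) (Gen x))))"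

quotient_type (overloaded) 'g uea = "'g::complex_lie_algebra uea_term" / uea_eq
  by (intro equivpI reflpI sympI transpI) (blast intro: uea_eq.intros)+

fun augmentation :: "'g uea_term \<Rightarrow> complex" where
  "augmentation (Gen x) = 0"
| "augmentation Zero = 0"
| "augmentation One = 1"
| "augmentation (Add a b) = augmentation a + augmentation b"
| "augmentation (Mult a b) = augmentation a * augmentation b"
| "augmentation (Scale c a) = c * augmentation a"

lemma uea_eq_augmentation: "uea_eq a b \<Longrightarrow> augmentation a = augmentation b"
  by (induction rule: uea_eq.induct) (simp_all add: algebra_simps)

instantiation uea :: (complex_lie_algebra) "{ring_1, complex_vector}"
begin

lift_definition zero_uea :: "'a uea" is Zero .
lift_definition one_uea :: "'a uea" is One .
lift_definition plus_uea :: "'a uea \<Rightarrow> 'a uea \<Rightarrow> 'a uea" is Add by (rule uea_cong_Add)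
lift_definition times_uea :: "'a uea \<Rightarrow> 'a uea \<Rightarrow> 'a uea" is Mult by (rule uea_cong_Mult)
lift_definition scaleC_uea :: "complex \<Rightarrow> 'a uea \<Rightarrow> 'a uea" is Scale by (rule uea_cong_Scale)
definition uminus_uea :: "'a uea \<Rightarrow> 'a uea" where "uminus_uea a = (-1) *\<^sub>C a"
definition minus_uea :: "'a uea \<Rightarrow> 'a uea \<Rightarrow> 'a uea" where "minus_uea a b = a + (-1) *\<^sub>C b"

instance
proof
  fix a b c :: "'a uea" and k l :: complex
  show "a + b + c = a + (b + c)" by transfer (rule uea_Add_assoc)
  show "a + b = b + a" by transfer (rule uea_Add_commute)
  show "0 + a = a" by transfer (rule uea_Add_Zero)
  show "- a + a = 0" unfolding uminus_uea_def by transfer (rule uea_Add_neg)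
  show "a - b = a + - b" by (simp add: minus_uea_def uminus_uea_def)
  show "a * b * c = a * (b * c)" by transfer (rule uea_Mult_assoc)
  show "1 * a = a" by transfer (rule uea_Mult_One_left)
  show "a * 1 = a" by transfer (rule uea_Mult_One_right)
  show "(a + b) * c = a * c + b * c" by transfer (rule uea_distrib_right)
  show "a * (b + c) = a * b + a * c" by transfer (rule uea_distrib_left)
  show "(0::'a uea) \<noteq> 1" by transfer (auto dest: uea_eq_augmentation)
  show "k *\<^sub>C (a + b) = k *\<^sub>C a + k *\<^sub>C b" by transfer (rule uea_Scale_Add_right)
  show "(k + l) *\<^sub>C a = k *\<^sub>C a + l *\<^sub>C a" by transfer (rule uea_Scale_Add_left)
  show "k *\<^sub>C l *\<^sub>C a = (k * l) *\<^sub>C a" by transfer (rule uea_Scale_Scale)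
  show "1 *\<^sub>C a = a" by transfer (rule uea_Scale_one)
qed

end

lift_definition uea_of :: "'g::complex_lie_algebra \<Rightarrow> 'g uea" is Gen .

text \<open>The extension of a representation to a representation of the enveloping algebra.\<close>

definition is_uea_extension ::
    "('g::complex_lie_algebra \<Rightarrow> 'v::complex_vector \<Rightarrow> 'v) \<Rightarrow> ('g uea \<Rightarrow> 'v \<Rightarrow> 'v) \<Rightarrow> bool" where
  "is_uea_extension \<sigma> F \<longleftrightarrow>
     (\<forall>u. clinear (F u)) \<and>
     (\<forall>x. F (uea_of x) = \<sigma> x) \<and>
     F 1 = id \<and>
     (\<forall>a b. F (a * b) = F a \<circ> F b) \<and>
     (\<forall>a b v. F (a + b) v = F a v + F b v) \<and>
     (\<forall>c a v. F (c *\<^sub>C a) v = c *\<^sub>C F a v)"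

definition uea_extension ::
    "('g::complex_lie_algebra \<Rightarrow> 'v::complex_vector \<Rightarrow> 'v) \<Rightarrow> 'g uea \<Rightarrow> 'v \<Rightarrow> 'v" where
  "uea_extension \<sigma> = (THE F. is_uea_extension \<sigma> F)"

fun eval_term ::
    "('g::complex_lie_algebra \<Rightarrow> 'v::complex_vector \<Rightarrow> 'v) \<Rightarrow> 'g uea_term \<Rightarrow> 'v \<Rightarrow> 'v" where
  "eval_term \<sigma> (Gen x) v = \<sigma> x v"
| "eval_term \<sigma> Zero v = 0"
| "eval_term \<sigma> One v = v"
| "eval_term \<sigma> (Add a b) v = eval_term \<sigma> a v + eval_term \<sigma> b v"
| "eval_term \<sigma> (Mult a b) v = eval_term \<sigma> a (eval_term \<sigma> b v)"
| "eval_term \<sigma> (Scale c a) v = c *\<^sub>C eval_term \<sigma> a v"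

lemma clinear_eval_term:
  assumes "lie_rep \<sigma>" shows "clinear (eval_term \<sigma> a)"
proof (induction a)
  case (Gen x)
  have "eval_term \<sigma> (Gen x) = \<sigma> x" by (rule ext) simp
  then show ?case using assms by (simp add: lie_rep_def)
qed (simp_all add: Vector_Spaces.linear_iff complex_vector.vector_space_axioms
       scaleC_add_right algebra_simps complex_vector.scale_left_commute)

lemma eval_term_cong:
  assumes "lie_rep \<sigma>" "uea_eq a b" shows "eval_term \<sigma> a = eval_term \<sigma> b"
proof -
  have add: "eval_term \<sigma> a (v + w) = eval_term \<sigma> a v + eval_term \<sigma> a w"
    and scale: "eval_term \<sigma> a (c *\<^sub>C v) = c *\<^sub>C eval_term \<sigma> a v" for a v w c
    using clinear_eval_term[OF assms(1), of a] by (simp_all add: Vector_Spaces.linear_iff)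
  show ?thesis using assms(2)
  proof (induction rule: uea_eq.induct)
    case (uea_cong_Mult a a' b b')
    then show ?case by (intro ext) simp
  qed (use assms(1) in \<open>auto simp: fun_eq_iff add scale scaleC_add_left scaleC_add_right
         scaleC_scaleC scaleC_one lie_rep_def algebra_simps\<close>)
qed

theorem ex1_uea_extension:
  assumes "lie_rep \<sigma>" shows "\<exists>!F. is_uea_extension \<sigma> F"
proof -
  define F where "F u = eval_term \<sigma> (rep_uea u)" for u
  have F: "F (abs_uea a) = eval_term \<sigma> a" for a
    unfolding F_def
    by (rule eval_term_cong[OF assms]) (metis Quotient3_rep_abs[OF Quotient3_uea] uea_refl)
  have ind: "\<exists>a. u = abs_uea a" for u :: "'a uea"
    by (metis Quotient3_uea Quotient3_abs_rep)
  have "is_uea_extension \<sigma> F"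
    unfolding is_uea_extension_def
  proof (intro conjI allI)
    fix u v :: "'a uea" and c :: complex and w :: 'b and x :: 'a
    obtain a b where ab: "u = abs_uea a" "v = abs_uea b" using ind by blast
    show "clinear (F u)" using F ab clinear_eval_term[OF assms] by simp
    show "F (uea_of x) = \<sigma> x" by (simp add: uea_of.abs_eq F fun_eq_iff)
    show "F 1 = id" by (simp add: one_uea.abs_eq F fun_eq_iff)
    show "F (u * v) = F u \<circ> F v" by (simp add: ab times_uea.abs_eq F fun_eq_iff)
    show "F (u + v) w = F u w + F v w" by (simp add: ab plus_uea.abs_eq F)
    show "F (c *\<^sub>C u) w = c *\<^sub>C F u w" by (simp add: ab scaleC_uea.abs_eq F)
  qed
  moreover have "G = F" if G: "is_uea_extension \<sigma> G" for G
  proof -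
    note G = G[unfolded is_uea_extension_def]
    have "G (abs_uea a) v = eval_term \<sigma> a v" for a v
    proof (induction a arbitrary: v)
      case (Gen x)
      then show ?case using G by (simp flip: uea_of.abs_eq)
    next
      case Zero
      have "G (0 *\<^sub>C 0) v = 0 *\<^sub>C G 0 v" using G by blast
      then show ?case by (simp flip: zero_uea.abs_eq)
    next
      case One
      then show ?case using G by (simp flip: one_uea.abs_eq)
    next
      case (Add a b)
      then show ?case using G by (simp flip: plus_uea.abs_eq)
    next
      case (Mult a b)
      then show ?case using G by (simp flip: times_uea.abs_eq)
    next
      case (Scale c a)
      then show ?case using G by (simp flip: scaleC_uea.abs_eq)
    qed
    with F ind show ?thesis by (metis ext)
  qed
  ultimately show ?thesis by blast
qed


section \<open>Generalised Casimir operators\<close>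

definition lie_basis :: "(nat \<Rightarrow> 'g::complex_lie_algebra) \<Rightarrow> nat \<Rightarrow> bool" where
  "lie_basis X d \<longleftrightarrow> inj_on X {1..d} \<and> complex_vector.independent (X ` {1..d}) \<and>
     complex_vector.span (X ` {1..d}) = UNIV"

definition multi_trace ::
    "('g::complex_lie_algebra \<Rightarrow> 'w::complex_vector \<Rightarrow> 'w) \<Rightarrow> 'g list \<Rightarrow> complex" where
  "multi_trace \<sigma>\<^sub>\<kappa> Ys = trace_end (foldr (\<lambda>Y f. \<sigma>\<^sub>\<kappa> Y \<circ> f) Ys id)"

definition dual_basis ::
    "('g::complex_lie_algebra \<Rightarrow> 'w::complex_vector \<Rightarrow> 'w) \<Rightarrow> (nat \<Rightarrow> 'g) \<Rightarrow> (nat \<Rightarrow> 'g) \<Rightarrow> nat \<Rightarrow> bool" where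
  "dual_basis \<sigma>\<^sub>\<kappa> X X' d \<longleftrightarrow> lie_basis X' d \<and>
     (\<forall>i\<in>{1..d}. \<forall>j\<in>{1..d}. multi_trace \<sigma>\<^sub>\<kappa> [X' i, X j] = (if i = j then 1 else 0))"

definition casimir ::
    "('g::complex_lie_algebra \<Rightarrow> 'w::complex_vector \<Rightarrow> 'w) \<Rightarrow> (nat \<Rightarrow> 'g) \<Rightarrow> (nat \<Rightarrow> 'g) \<Rightarrow> nat \<Rightarrow> nat \<Rightarrow> 'g uea" where
  "casimir \<sigma>\<^sub>\<kappa> X X' d p =
     (if p = 0 then of_nat (complex_vector.dim (UNIV :: 'w set)) *\<^sub>C 1
      else \<Sum>is\<in>{is. length is = p \<and> set is \<subseteq> {1..d}}.
             multi_trace \<sigma>\<^sub>\<kappa> (map X' is) *\<^sub>C prod_list (map (\<lambda>i. uea_of (X i)) is))"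

definition casimir_eigenvalue ::
    "('g::complex_lie_algebra \<Rightarrow> 'w::complex_vector \<Rightarrow> 'w) \<Rightarrow> (nat \<Rightarrow> 'g) \<Rightarrow> (nat \<Rightarrow> 'g) \<Rightarrow> nat \<Rightarrow>
     ('g \<Rightarrow> 'v::complex_vector \<Rightarrow> 'v) \<Rightarrow> nat \<Rightarrow> complex" where
  "casimir_eigenvalue \<sigma>\<^sub>\<kappa> X X' d \<sigma> p =
     (THE c. \<forall>v. uea_extension \<sigma> (casimir \<sigma>\<^sub>\<kappa> X X' d p) v = c *\<^sub>C v)"

text \<open>
  The field of rational functions embeds into the field of formal Laurent series, where the
  generating function is compared with its closed form.
\<close>

definition casimir_gf ::
    "('g::complex_lie_algebra \<Rightarrow> 'w::complex_vector \<Rightarrow> 'w) \<Rightarrow> (nat \<Rightarrow> 'g) \<Rightarrow> (nat \<Rightarrow> 'g) \<Rightarrow> nat \<Rightarrow>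
     ('g \<Rightarrow> 'v::complex_vector \<Rightarrow> 'v) \<Rightarrow> complex fls" where
  "casimir_gf \<sigma>\<^sub>\<kappa> X X' d \<sigma> = fps_to_fls (Abs_fps (casimir_eigenvalue \<sigma>\<^sub>\<kappa> X X' d \<sigma>))"


section \<open>Euclidean coordinates of roots and weights\<close>

datatype classical_type = Type_A | Type_B | Type_C | Type_D

definition admissible_rank :: "classical_type \<Rightarrow> nat \<Rightarrow> bool" where
  "admissible_rank t n \<longleftrightarrow>
     (case t of Type_A \<Rightarrow> 1 \<le> n | Type_B \<Rightarrow> 2 \<le> n | Type_C \<Rightarrow> 3 \<le> n | Type_D \<Rightarrow> 4 \<le> n)"

text \<open>A vector of \<open>\<real>\<^sup>k\<close> is a function on \<open>nat\<close> supported on \<open>{1..k}\<close>.\<close>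

definition eucl_dim :: "classical_type \<Rightarrow> nat \<Rightarrow> nat" where
  "eucl_dim t n = (if t = Type_A then n + 1 else n)"

definition eucl_inner :: "nat \<Rightarrow> (nat \<Rightarrow> real) \<Rightarrow> (nat \<Rightarrow> real) \<Rightarrow> real" where
  "eucl_inner k x y = (\<Sum>i=1..k. x i * y i)"

definition std_vec :: "nat \<Rightarrow> nat \<Rightarrow> real" where
  "std_vec i = (\<lambda>j. if j = i then 1 else 0)"

definition simple_root :: "classical_type \<Rightarrow> nat \<Rightarrow> nat \<Rightarrow> nat \<Rightarrow> real" where
  "simple_root t n i = (\<lambda>j.
     if i < n \<or> t = Type_A then std_vec i j - std_vec (i + 1) j
     else case t of
        Type_B \<Rightarrow> std_vec n j
      | Type_C \<Rightarrow> 2 * std_vec n j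
      | _ \<Rightarrow> std_vec (n - 1) j + std_vec n j)"

definition weight_space :: "classical_type \<Rightarrow> nat \<Rightarrow> (nat \<Rightarrow> real) set" where
  "weight_space t n = {w. (\<forall>j. j \<notin> {1..eucl_dim t n} \<longrightarrow> w j = 0) \<and>
     (t = Type_A \<longrightarrow> (\<Sum>j=1..n+1. w j) = 0)}"

definition coroot_pairing :: "classical_type \<Rightarrow> nat \<Rightarrow> (nat \<Rightarrow> real) \<Rightarrow> nat \<Rightarrow> real" where
  "coroot_pairing t n w i =
     2 * eucl_inner (eucl_dim t n) w (simple_root t n i) /
       eucl_inner (eucl_dim t n) (simple_root t n i) (simple_root t n i)"

definition fundamental_weight :: "classical_type \<Rightarrow> nat \<Rightarrow> nat \<Rightarrow> nat \<Rightarrow> real" where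
  "fundamental_weight t n i =
     (THE w. w \<in> weight_space t n \<and>
        (\<forall>j\<in>{1..n}. coroot_pairing t n w j = (if j = i then 1 else 0)))"

definition dominant_integral :: "classical_type \<Rightarrow> nat \<Rightarrow> (nat \<Rightarrow> real) set" where
  "dominant_integral t n =
     {\<lambda>j. \<Sum>i=1..n. real (m i) * fundamental_weight t n i j | m :: nat \<Rightarrow> nat. True}"

definition weyl_rho :: "classical_type \<Rightarrow> nat \<Rightarrow> nat \<Rightarrow> real" where
  "weyl_rho t n = (\<lambda>j. \<Sum>i=1..n. fundamental_weight t n i j)"

text \<open>The coordinates \<open>\<ell>\<^sub>i\<close> of \<open>\<ell> = \<lambda> + \<rho>\<close>, extended to integer indices by
  \<open>\<ell>\<^bsub>-i\<^esub> = -\<ell>\<^sub>i\<close> and \<open>\<ell>\<^sub>0 = 0\<close>.\<close>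

definition ell :: "classical_type \<Rightarrow> nat \<Rightarrow> (nat \<Rightarrow> real) \<Rightarrow> int \<Rightarrow> real" where
  "ell t n lam i =
     (if 0 < i then lam (nat i) + weyl_rho t n (nat i)
      else if i < 0 then - (lam (nat (-i)) + weyl_rho t n (nat (-i)))
      else 0)"

text \<open>
  The defining data pin down the fundamental weights, and the resulting \<open>\<varpi>\<^sub>1\<close> and \<open>\<rho>\<close> have the
  usual coordinates.
\<close>

lemma admissible_rank_ge:
  assumes "admissible_rank t n"
  shows "1 \<le> n" "t \<noteq> Type_A \<Longrightarrow> 2 \<le> n"
  using assms by (auto simp: admissible_rank_def split: classical_type.splits)

lemma eucl_inner_std_vec:
  "i \<in> {1..k} \<Longrightarrow> eucl_inner k w (std_vec i) = w i"
  by (simp add: eucl_inner_def std_vec_def if_distrib[of "\<lambda>x. _ * x"] sum.delta cong: if_cong)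

lemma eucl_inner_linear:
  "eucl_inner k w (\<lambda>j. x j + y j) = eucl_inner k w x + eucl_inner k w y"
  "eucl_inner k w (\<lambda>j. x j - y j) = eucl_inner k w x - eucl_inner k w y"
  "eucl_inner k w (\<lambda>j. c * y j) = c * eucl_inner k w y"
  by (simp_all add: eucl_inner_def algebra_simps sum.distrib sum_subtractf sum_distrib_left)

lemma eucl_inner_sum:
  "eucl_inner k (\<lambda>j. \<Sum>m\<in>M. f m j) x = (\<Sum>m\<in>M. eucl_inner k (f m) x)"
  unfolding eucl_inner_def sum_distrib_right by (rule sum.swap)

lemma coroot_pairing_eq:
  assumes "admissible_rank t n" "i \<in> {1..n}"
  shows "coroot_pairing t n w i =
     (if i < n \<or> t = Type_A then w i - w (i + 1)
      else case t of Type_B \<Rightarrow> 2 * w n | Type_C \<Rightarrow> w n | _ \<Rightarrow> w (n - 1) + w n)"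
proof -
  note n = admissible_rank_ge[OF assms(1)]
  have *: "eucl_inner k v (simple_root t n i) =
     (if i < n \<or> t = Type_A then v i - v (i + 1)
      else case t of Type_B \<Rightarrow> v n | Type_C \<Rightarrow> 2 * v n | _ \<Rightarrow> v (n - 1) + v n)"
    if "k = eucl_dim t n" for v k
    using n assms(2) that
    by (cases t) (auto simp: simple_root_def eucl_inner_linear eucl_inner_std_vec eucl_dim_def)
  show ?thesis
    unfolding coroot_pairing_def *[OF refl] using n assms(2)
    by (cases t) (auto simp: simple_root_def std_vec_def)
qed

lemma weight_eqI:
  assumes "admissible_rank t n" "u \<in> weight_space t n" "v \<in> weight_space t n"
    and "\<And>i. i \<in> {1..n} \<Longrightarrow> coroot_pairing t n u i = coroot_pairing t n v i"
  shows "u = v"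
proof -
  note n = admissible_rank_ge[OF assms(1)]
  define w where "w j = u j - v j" for j
  have pair: "(if i < n \<or> t = Type_A then w i - w (i + 1)
      else case t of Type_B \<Rightarrow> 2 * w n | Type_C \<Rightarrow> w n | _ \<Rightarrow> w (n - 1) + w n) = 0"
    if "i \<in> {1..n}" for i
    using assms(4)[OF that] unfolding coroot_pairing_eq[OF assms(1) that] w_def
    by (cases t) (auto split: if_splits)
  define k where "k = eucl_dim t n"
  have step: "w i = w (i + 1)" if "1 \<le> i" "i < k" for i
    using pair[of i] that by (auto simp: k_def eucl_dim_def split: if_splits)
  have const: "w i = w k" if "1 \<le> i" "i \<le> k" for i
    using that(2,1) by (induction i rule: inc_induct) (use step in auto)
  have "w k = 0"
  proof (cases "t = Type_A")
    case True
    have "(\<Sum>j=1..n+1. w j) = 0"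
      using assms(2,3) True by (simp add: w_def weight_space_def sum_subtractf)
    moreover have "(\<Sum>j=1..n+1. w j) = (\<Sum>j=1..n+1. w k)"
      by (rule sum.cong[OF refl], rule const) (use True in \<open>auto simp: k_def eucl_dim_def\<close>)
    ultimately have "real (n + 1) * w k = 0" by (simp only: sum_constant card_atLeastAtMost) simp
    then show ?thesis by simp
  next
    case False
    with const[of "n - 1"] pair[of n] n show ?thesis
      by (cases t) (auto simp: k_def eucl_dim_def)
  qed
  moreover have "w j = 0" if "j \<notin> {1..k}" for j
    using assms(2,3) that by (auto simp: w_def weight_space_def k_def)
  ultimately have "w j = 0" for j using const[of j] by (cases "j \<in> {1..k}") auto
  then show ?thesis by (simp add: w_def fun_eq_iff)
qed

definition fundamental_weight_explicit :: "classical_type \<Rightarrow> nat \<Rightarrow> nat \<Rightarrow> nat \<Rightarrow> real" where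
  "fundamental_weight_explicit t n i = (\<lambda>j.
     if j \<notin> {1..eucl_dim t n} then 0
     else case t of
       Type_A \<Rightarrow> (if j \<le> i then 1 else 0) - real i / real (n + 1)
     | Type_B \<Rightarrow> (if i = n then 1 / 2 else if j \<le> i then 1 else 0)
     | Type_C \<Rightarrow> (if j \<le> i then 1 else 0)
     | Type_D \<Rightarrow> (if i = n then 1 / 2
                  else if i = n - 1 then (if j = n then - 1 / 2 else 1 / 2)
                  else if j \<le> i then 1 else 0))"

lemma fundamental_weight_eq:
  assumes "admissible_rank t n" "i \<in> {1..n}"
  shows "fundamental_weight t n i = fundamental_weight_explicit t n i"
    and fundamental_weight_in_weight_space: "fundamental_weight t n i \<in> weight_space t n"
    and coroot_pairing_fundamental_weight: "j \<in> {1..n} \<Longrightarrow>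
      coroot_pairing t n (fundamental_weight t n i) j = (if j = i then 1 else 0)"
proof -
  let ?P = "\<lambda>w. w \<in> weight_space t n \<and>
        (\<forall>j\<in>{1..n}. coroot_pairing t n w j = (if j = i then 1 else 0))"
  let ?w = "fundamental_weight_explicit t n i"
  have sum: "(\<Sum>j=1..n+1. if j \<le> i then 1 else 0) = real i"
  proof -
    have "(\<Sum>j=1..n+1. if j \<le> i then 1 else 0) = (\<Sum>j\<in>{1..i}. 1::real)"
      by (rule sum.mono_neutral_cong_right) (use assms(2) in auto)
    then show ?thesis by simp
  qed
  have "(\<Sum>j=1..n+1. (if j \<le> i then 1 else 0) - real i / real (n + 1)) = 0"
    unfolding sum_subtractf sum by simp
  then have "?w \<in> weight_space t n"
    by (auto simp: weight_space_def fundamental_weight_explicit_def eucl_dim_def simp del: sum.cl_ivl_Suc)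
  moreover have "coroot_pairing t n ?w j = (if j = i then 1 else 0)" if "j \<in> {1..n}" for j
    unfolding coroot_pairing_eq[OF assms(1) that]
    using admissible_rank_ge[OF assms(1)] assms(2) that
    by (cases t) (auto simp: fundamental_weight_explicit_def eucl_dim_def)
  ultimately have P: "?P ?w" by blast
  show eq: "fundamental_weight t n i = ?w"
    unfolding fundamental_weight_def
    by (rule the_equality[where P = ?P, OF P]) (rule weight_eqI[OF assms(1)], use P in auto)
  show "fundamental_weight t n i \<in> weight_space t n" using P eq by simp
  show "coroot_pairing t n (fundamental_weight t n i) j = (if j = i then 1 else 0)"
    if "j \<in> {1..n}" using P eq that by simp
qed

lemma fundamental_weight_1:
  assumes "admissible_rank t n"
  shows "fundamental_weight t n 1 = (\<lambda>j. std_vec 1 j -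
           (if t = Type_A \<and> j \<in> {1..n+1} then 1 / real (n + 1) else 0))"
proof
  fix j
  have "1 \<in> {1..n}" using admissible_rank_ge[OF assms] by simp
  then show "fundamental_weight t n 1 j = std_vec 1 j -
           (if t = Type_A \<and> j \<in> {1..n+1} then 1 / real (n + 1) else 0)"
    unfolding fundamental_weight_eq(1)[OF assms \<open>1 \<in> {1..n}\<close>]
    using assms
    by (cases t) (auto simp: admissible_rank_def fundamental_weight_explicit_def eucl_dim_def std_vec_def)
qed

lemma weyl_rho_eq:
  assumes "admissible_rank t n"
  shows "weyl_rho t n = (\<lambda>j. if j \<notin> {1..eucl_dim t n} then 0 else
           case t of
             Type_A \<Rightarrow> real n / 2 - real (j - 1)
           | Type_B \<Rightarrow> real n - real j + 1 / 2
           | Type_C \<Rightarrow> real n - real j + 1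
           | Type_D \<Rightarrow> real n - real j)" (is "_ = ?r")
proof (rule weight_eqI[OF assms])
  note n = admissible_rank_ge[OF assms]
  have mem: "fundamental_weight t n i \<in> weight_space t n" if "i \<in> {1..n}" for i
    by (rule fundamental_weight_in_weight_space[OF assms that])
  show "weyl_rho t n \<in> weight_space t n"
    unfolding weight_space_def weyl_rho_def
  proof (intro CollectI conjI allI impI)
    show "(\<Sum>i=1..n. fundamental_weight t n i j) = 0" if "j \<notin> {1..eucl_dim t n}" for j
      using mem that by (intro sum.neutral) (auto simp: weight_space_def)
    show "(\<Sum>j=1..n+1. \<Sum>i=1..n. fundamental_weight t n i j) = 0" if "t = Type_A"
      using mem that by (subst sum.swap) (intro sum.neutral, auto simp: weight_space_def)
  qed
  have "(\<Sum>j=1..m+1. a - real (j - 1)) = (m + 1) * (a - m / 2)" for m :: nat and a :: real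
    by (induction m) (simp_all add: field_simps)
  from this[of "real n / 2" n] have "(\<Sum>j=1..n+1. real n / 2 - real (j - 1)) = 0" by simp
  then show "?r \<in> weight_space t n"
    by (auto simp: weight_space_def eucl_dim_def simp del: sum.cl_ivl_Suc)
  fix i assume i: "i \<in> {1..n}"
  have "coroot_pairing t n (weyl_rho t n) i =
        (\<Sum>m=1..n. coroot_pairing t n (fundamental_weight t n m) i)"
    unfolding coroot_pairing_def weyl_rho_def eucl_inner_sum
    by (simp only: sum_distrib_left sum_divide_distrib)
  also have "\<dots> = 1"
    using i by (simp add: coroot_pairing_fundamental_weight[OF assms] sum.delta)
  also have "\<dots> = coroot_pairing t n ?r i"
    unfolding coroot_pairing_eq[OF assms i] using n i
    by (cases t) (auto simp: eucl_dim_def of_nat_diff)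
  finally show "coroot_pairing t n (weyl_rho t n) i = coroot_pairing t n ?r i" .
qed


section \<open>The classical Lie algebras and highest weight representations\<close>

text \<open>
  The orthogonal and symplectic algebras are taken with respect to the antidiagonal (skew-)symmetric
  form, so that the diagonal matrices form a Cartan subalgebra; rows and columns are indexed from
  \<open>0\<close>.
\<close>

definition mat_trace :: "complex mat \<Rightarrow> complex" where
  "mat_trace M = (\<Sum>i<dim_row M. M $$ (i, i))"

definition special_linear :: "nat \<Rightarrow> complex mat set" where
  "special_linear N = {M \<in> carrier_mat N N. mat_trace M = 0}"

definition form_preserving :: "nat \<Rightarrow> complex mat \<Rightarrow> complex mat set" where
  "form_preserving N J = {M \<in> carrier_mat N N. transpose_mat M * J + J * M = 0\<^sub>m N N}"

definition special_orthogonal :: "nat \<Rightarrow> complex mat set" where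
  "special_orthogonal N =
     form_preserving N (mat N N (\<lambda>(i, j). if i + j + 1 = N then 1 else 0))"

definition symplectic :: "nat \<Rightarrow> complex mat set" where
  "symplectic N =
     form_preserving N (mat N N (\<lambda>(i, j). if i + j + 1 = N then if i < j then 1 else -1 else 0))"

definition classical_matrices :: "classical_type \<Rightarrow> nat \<Rightarrow> complex mat set" where
  "classical_matrices t n =
     (case t of
        Type_A \<Rightarrow> special_linear (n + 1)
      | Type_B \<Rightarrow> special_orthogonal (2 * n + 1)
      | Type_C \<Rightarrow> symplectic (2 * n)
      | Type_D \<Rightarrow> special_orthogonal (2 * n))"

text \<open>
  A Lie algebra isomorphism \<open>\<phi>\<close> onto a classical matrix algebra. It carries the choice of
  a Cartan subalgebra and of simple roots: the Cartan subalgebra corresponds to the diagonal matrices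
  and the Euclidean basis vector \<open>e\<^sub>i\<close> to the \<open>i\<close>-th diagonal entry. Up to the choice of \<open>\<phi>\<close>,
  every Cartan subalgebra with every choice of simple roots arises in this way.
\<close>

definition classical_iso ::
    "classical_type \<Rightarrow> nat \<Rightarrow> ('g::complex_lie_algebra \<Rightarrow> complex mat) \<Rightarrow> bool" where
  "classical_iso t n \<phi> \<longleftrightarrow>
     bij_betw \<phi> UNIV (classical_matrices t n) \<and>
     (\<forall>x y. \<phi> (x + y) = \<phi> x + \<phi> y) \<and>
     (\<forall>c x. \<phi> (c *\<^sub>C x) = c \<cdot>\<^sub>m \<phi> x) \<and>
     (\<forall>x y. \<phi> (lie_bracket x y) = \<phi> x * \<phi> y - \<phi> y * \<phi> x)"

definition cartan :: "('g::complex_lie_algebra \<Rightarrow> complex mat) \<Rightarrow> 'g set" where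
  "cartan \<phi> = {h. diagonal_mat (\<phi> h)}"

definition weight_at ::
    "classical_type \<Rightarrow> nat \<Rightarrow> ('g::complex_lie_algebra \<Rightarrow> complex mat) \<Rightarrow> (nat \<Rightarrow> real) \<Rightarrow> 'g \<Rightarrow> complex" where
  "weight_at t n \<phi> \<mu> h = (\<Sum>i=1..eucl_dim t n. complex_of_real (\<mu> i) * \<phi> h $$ (i - 1, i - 1))"

definition root_space ::
    "classical_type \<Rightarrow> nat \<Rightarrow> ('g::complex_lie_algebra \<Rightarrow> complex mat) \<Rightarrow> (nat \<Rightarrow> real) \<Rightarrow> 'g set" where
  "root_space t n \<phi> \<beta> = {x. \<forall>h\<in>cartan \<phi>. lie_bracket h x = weight_at t n \<phi> \<beta> h *\<^sub>C x}"

definition positive_roots ::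
    "classical_type \<Rightarrow> nat \<Rightarrow> ('g::complex_lie_algebra \<Rightarrow> complex mat) \<Rightarrow> (nat \<Rightarrow> real) set" where
  "positive_roots t n \<phi> =
     {\<beta>. \<beta> \<noteq> (\<lambda>_. 0) \<and> root_space t n \<phi> \<beta> \<noteq> {0} \<and>
        (\<exists>c::nat \<Rightarrow> nat. \<beta> = (\<lambda>j. \<Sum>i=1..n. real (c i) * simple_root t n i j))}"

definition highest_weight_vector ::
    "classical_type \<Rightarrow> nat \<Rightarrow> ('g::complex_lie_algebra \<Rightarrow> complex mat) \<Rightarrow> (nat \<Rightarrow> real) \<Rightarrow>
     ('g \<Rightarrow> 'v::complex_vector \<Rightarrow> 'v) \<Rightarrow> 'v \<Rightarrow> bool" where
  "highest_weight_vector t n \<phi> \<mu> \<sigma> v \<longleftrightarrow> v \<noteq> 0 \<and>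
     (\<forall>h\<in>cartan \<phi>. \<sigma> h v = weight_at t n \<phi> \<mu> h *\<^sub>C v) \<and>
     (\<forall>\<beta>\<in>positive_roots t n \<phi>. \<forall>x\<in>root_space t n \<phi> \<beta>. \<sigma> x v = 0)"

text \<open>\<open>\<sigma>\<close> is (a model of) the finite-dimensional irreducible representation \<open>V(\<mu>)\<close>.\<close>

definition irreducible_rep_of_weight ::
    "classical_type \<Rightarrow> nat \<Rightarrow> ('g::complex_lie_algebra \<Rightarrow> complex mat) \<Rightarrow> (nat \<Rightarrow> real) \<Rightarrow>
     ('g \<Rightarrow> 'v::complex_vector \<Rightarrow> 'v) \<Rightarrow> bool" where
  "irreducible_rep_of_weight t n \<phi> \<mu> \<sigma> \<longleftrightarrow>
     finite_dim TYPE('v) \<and> irreducible_rep \<sigma> \<and> (\<exists>v. highest_weight_vector t n \<phi> \<mu> \<sigma> v)"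

end

theory Submission
  imports Defs
begin

text \<open>
  Let \<open>N\<close> be the size of the matrices of the classical algebra and let \<open>m a b\<close> be the element of the
  algebra that represents the matrix entry \<open>(a, b)\<close> under the trace form. Collect the operators
  \<open>\<sigma> (m a b)\<close> into an \<open>N \<times> N\<close> matrix \<open>T\<close> of operators on \<open>V(\<lambda>)\<close>. The representation \<open>V(\<varpi>\<^sub>1)\<close> is the
  natural one (\<open>natural_basis_exists\<close>), so the form \<open>(Y\<^sub>1, \<dots>, Y\<^sub>p)\<close> is the trace of a product of
  matrices (\<open>natural_multi_trace\<close>), and expanding that product shows that the \<open>p\<close>-th Casimir operator
  acts as \<open>\<Sum>a. (T^p) a a\<close> (\<open>op_pow_eq_word_sum\<close>). This sum commutes with the algebra, hence is a
  scalar on the irreducible \<open>V(\<lambda>)\<close> (\<open>op_pow_trace_scalar\<close>).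

  To find the scalar, evaluate it on a highest weight vector \<open>v\<close>. There \<open>T^p\<close> is upper triangular with
  scalars \<open>t\<^sub>p(a)\<close> on the diagonal: in \<open>(T\<^bsup>p+1\<^esup>) a a v = \<Sum>c. T a c (T^p) c a v\<close> the terms with \<open>c > a\<close>
  vanish, and for \<open>c < a\<close> the operator \<open>T a c\<close> kills \<open>v\<close>, so only its commutator with \<open>(T^p) c a\<close>
  survives. This yields a recurrence in \<open>p\<close> (\<open>op_pow_highest_vector\<close>) and, for the generating
  functions \<open>t\<^sub>a(z)\<close>, a triangular linear system (\<open>diag_laurent_recurrence\<close>)
  \<open>D\<^sub>a t\<^sub>a = q + z (\<Sum>b<a. t\<^sub>b) - \<epsilon> z [a' < a] t\<^sub>a'\<close>, where \<open>a' = N - 1 - a\<close> is the reflected index,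
  \<open>q\<close> is \<open>1\<close> in type A and \<open>2\<close> otherwise, \<open>\<epsilon>\<close> is \<open>0\<close> in type A, \<open>1\<close> in the orthogonal and \<open>-1\<close> in the
  symplectic case, and \<open>D\<^sub>a\<close> is affine in \<open>z\<close>.

  In type A the partial sums \<open>S\<^sub>a = 1 + z (\<Sum>b<a. t\<^sub>b)\<close> satisfy \<open>S\<^sub>a\<^sub>+\<^sub>1 = S\<^sub>a (1 + z / D\<^sub>a)\<close>, which is the
  product formula. In the other types the diagonal weights at \<open>a\<close> and \<open>a'\<close> are opposite, so that
  \<open>D\<^sub>a + D\<^sub>a'\<close> does not depend on \<open>a\<close>, after a correction at the middle index in type B; because of this the reflected terms sum up to a single rational
  factor and a constant (\<open>reflected_product_formula\<close>). Finally, the numbers in \<open>D\<^sub>a\<close> are the shifted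
  coordinates of \<open>\<lambda> + \<rho>\<close> (\<open>ell_linear\<close>, \<open>ell_reflected\<close>).
\<close>

section \<open>Traces of endomorphisms\<close>

text \<open>
  Expanding \<open>f b\<close> in the basis \<open>C\<close> and back in \<open>B\<close> writes both sums as the same double sum of products
  of coefficients.
\<close>

lemma trace_basis_change:
  fixes f :: "'v::complex_vector \<Rightarrow> 'v"
  assumes f: "clinear f"
    and B: "finite B" "complex_vector.independent B" "complex_vector.span B = UNIV"
    and C: "finite C" "complex_vector.independent C" "complex_vector.span C = UNIV"
  shows "(\<Sum>b\<in>B. complex_vector.representation B (f b) b)
       = (\<Sum>c\<in>C. complex_vector.representation C (f c) c)"
proof -
  let ?B = "complex_vector.representation B" and ?C = "complex_vector.representation C"
  have hom: "module_hom (*\<^sub>C) (*\<^sub>C) f"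
    using f by (simp add: Vector_Spaces.linear_def)
  have f_expand: "f b = (\<Sum>c\<in>C. ?C b c *\<^sub>C f c)" for b
  proof -
    have "f b = f (\<Sum>c\<in>C. ?C b c *\<^sub>C c)"
      using complex_vector.sum_representation_eq[OF C(2), of b C] C by simp
    also have "\<dots> = (\<Sum>c\<in>C. ?C b c *\<^sub>C f c)"
      by (simp add: module_hom.sum[OF hom] module_hom.scale[OF hom])
    finally show ?thesis .
  qed
  have repB_sum: "?B (\<Sum>c\<in>C. r c *\<^sub>C g c) b = (\<Sum>c\<in>C. r c * ?B (g c) b)" for r g b
    using B by (simp add: complex_vector.representation_sum complex_vector.representation_scale
        complex_vector.span_scale)
  have repC_sum: "?C (\<Sum>c\<in>B. r c *\<^sub>C g c) b = (\<Sum>c\<in>B. r c * ?C (g c) b)" for r g b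
    using C by (simp add: complex_vector.representation_sum complex_vector.representation_scale
        complex_vector.span_scale)
  have "(\<Sum>b\<in>B. ?B (f b) b) = (\<Sum>b\<in>B. \<Sum>c\<in>C. ?C b c * ?B (f c) b)"
    by (subst f_expand) (simp add: repB_sum)
  also have "\<dots> = (\<Sum>c\<in>C. \<Sum>b\<in>B. ?B (f c) b * ?C b c)"
    by (subst sum.swap) (simp add: mult.commute)
  also have "\<dots> = (\<Sum>c\<in>C. ?C (\<Sum>b\<in>B. ?B (f c) b *\<^sub>C b) c)"
    by (simp add: repC_sum)
  also have "\<dots> = (\<Sum>c\<in>C. ?C (f c) c)"
    using complex_vector.sum_representation_eq[OF B(2), of _ B] B by simp
  finally show ?thesis .
qed

lemma trace_end_basis:
  assumes "clinear f"
    and B: "finite B" "complex_vector.independent B" "complex_vector.span B = UNIV"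
  shows "trace_end f = (\<Sum>b\<in>B. complex_vector.representation B (f b) b)"
proof -
  let ?P = "\<lambda>B::'a set. finite B \<and> complex_vector.independent B \<and> complex_vector.span B = UNIV"
  have "?P (SOME B. ?P B)" by (rule someI[of ?P B]) (use B in simp)
  then show ?thesis
    unfolding trace_end_def Let_def by (intro trace_basis_change assms) auto
qed

section \<open>Matrix Lie algebras with dual matrix units\<close>

text \<open>
  A Lie algebra of matrices, given by its entry functions \<open>e\<close>, on which the trace form is
  non-degenerate: \<open>m a b\<close> is the element whose trace pairing with \<open>x\<close> is the entry \<open>e x a b\<close>.
  The elements \<open>m a b\<close> span the algebra but are linearly dependent in general.
\<close>

locale dual_matrix_units =
  fixes N :: nat
    and e :: "'g::complex_lie_algebra \<Rightarrow> nat \<Rightarrow> nat \<Rightarrow> complex"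
    and m :: "nat \<Rightarrow> nat \<Rightarrow> 'g"
  assumes entry_add: "e (x + y) a b = e x a b + e y a b"
    and entry_scale: "e (c *\<^sub>C x) a b = c * e x a b"
    and entry_bracket: "\<lbrakk>a < N; b < N\<rbrakk> \<Longrightarrow>
      e (lie_bracket x y) a b = (\<Sum>c<N. e x a c * e y c b) - (\<Sum>c<N. e y a c * e x c b)"
    and entry_eqI: "(\<And>a b. \<lbrakk>a < N; b < N\<rbrakk> \<Longrightarrow> e x a b = e y a b) \<Longrightarrow> x = y"
    and entry_dual: "\<lbrakk>a < N; b < N\<rbrakk> \<Longrightarrow> (\<Sum>c<N. \<Sum>d<N. e (m a b) c d * e x d c) = e x a b"
begin

definition trace_form :: "'g \<Rightarrow> 'g \<Rightarrow> complex" where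
  "trace_form x y = (\<Sum>a<N. \<Sum>b<N. e x a b * e y b a)"

lemma trace_form_dual: "\<lbrakk>a < N; b < N\<rbrakk> \<Longrightarrow> trace_form (m a b) x = e x a b"
  by (simp add: trace_form_def entry_dual)

lemma trace_form_commute: "trace_form x y = trace_form y x"
  unfolding trace_form_def by (subst sum.swap) (simp add: mult.commute)

lemma entry_zero: "e 0 a b = 0"
  using entry_scale[of 0 0 a b] by simp

lemma entry_sum: "e (\<Sum>i\<in>I. f i) a b = (\<Sum>i\<in>I. e (f i) a b)"
  by (induction I rule: infinite_finite_induct) (auto simp: entry_zero entry_add)

lemma entry_minus: "e (x - y) a b = e x a b - e y a b"
proof -
  have "e (x - y) a b + e y a b = e x a b"
    using entry_add[of "x - y" y a b] by simp
  then show ?thesis by (simp add: algebra_simps)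
qed

lemma entry_dual_symmetric:
  "\<lbrakk>a < N; b < N; c < N; d < N\<rbrakk> \<Longrightarrow> e (m a b) c d = e (m c d) a b"
  by (metis trace_form_dual trace_form_commute)

lemma dual_unit_expansion: "x = (\<Sum>a<N. \<Sum>b<N. e x a b *\<^sub>C m b a)"
proof (rule entry_eqI)
  fix c d assume cd: "c < N" "d < N"
  have "e (\<Sum>a<N. \<Sum>b<N. e x a b *\<^sub>C m b a) c d = (\<Sum>a<N. \<Sum>b<N. e x a b * e (m b a) c d)"
    by (simp add: entry_sum entry_scale)
  also have "\<dots> = (\<Sum>a<N. \<Sum>b<N. e x a b * e (m c d) b a)"
    using cd by (intro sum.cong refl) (simp add: entry_dual_symmetric[of _ _ c d])
  also have "\<dots> = trace_form x (m c d)"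
    by (simp add: trace_form_def)
  finally show "e x c d = e (\<Sum>a<N. \<Sum>b<N. e x a b *\<^sub>C m b a) c d"
    using cd by (simp add: trace_form_dual trace_form_commute[of x])
qed

lemma trace_form_invariant:
  "trace_form (lie_bracket x y) z = trace_form x (lie_bracket y z)"
proof -
  have "trace_form (lie_bracket x y) z
      = (\<Sum>a<N. \<Sum>b<N. \<Sum>c<N. e x a c * e y c b * e z b a)
      - (\<Sum>a<N. \<Sum>b<N. \<Sum>c<N. e y a c * e x c b * e z b a)"
    by (simp add: trace_form_def entry_bracket left_diff_distrib sum_subtractf sum_distrib_right)
  also have "(\<Sum>a<N. \<Sum>b<N. \<Sum>c<N. e x a c * e y c b * e z b a)
           = (\<Sum>a<N. \<Sum>b<N. \<Sum>c<N. e x a b * (e y b c * e z c a))"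
    by (rule sum.cong[OF refl], subst sum.swap) (simp add: mult.assoc)
  also have "(\<Sum>a<N. \<Sum>b<N. \<Sum>c<N. e y a c * e x c b * e z b a)
           = (\<Sum>c<N. \<Sum>b<N. \<Sum>a<N. e y a c * e x c b * e z b a)"
    by (subst sum.swap, subst (2) sum.swap, subst sum.swap) simp
  also have "\<dots> = (\<Sum>a<N. \<Sum>b<N. \<Sum>c<N. e x a b * (e z b c * e y c a))"
    by (simp add: ac_simps)
  finally show ?thesis
    by (simp add: trace_form_def entry_bracket right_diff_distrib sum_subtractf sum_distrib_left)
qed

text \<open>
  By invariance of the trace form, pairing \<open>[x, m a b]\<close> with \<open>m k l\<close> reads off an entry of
  \<open>[m k l, x]\<close>. The result is the commutation rule of \<open>x\<close> with matrix units, although the \<open>m a b\<close> are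
  only their projections to the algebra.
\<close>

lemma bracket_dual_unit:
  assumes "a < N" "b < N"
  shows "lie_bracket x (m a b) = (\<Sum>c<N. e x c b *\<^sub>C m a c) - (\<Sum>c<N. e x a c *\<^sub>C m c b)"
proof (rule entry_eqI)
  fix k l assume kl: "k < N" "l < N"
  have "e (lie_bracket x (m a b)) k l = trace_form (lie_bracket (m k l) x) (m a b)"
    using kl by (simp add: trace_form_dual trace_form_invariant)
  also have "\<dots> = e (lie_bracket (m k l) x) a b"
    using assms by (simp add: trace_form_dual trace_form_commute)
  also have "\<dots> = (\<Sum>c<N. e x c b * e (m a c) k l) - (\<Sum>c<N. e x a c * e (m c b) k l)"
    using assms kl by (simp add: entry_bracket entry_dual_symmetric[of _ _ k l] mult.commute)
  finally show "e (lie_bracket x (m a b)) k l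
      = e ((\<Sum>c<N. e x c b *\<^sub>C m a c) - (\<Sum>c<N. e x a c *\<^sub>C m c b)) k l"
    by (simp add: entry_minus entry_sum entry_scale)
qed

end

section \<open>Powers of the operator matrix\<close>

lemma lie_rep_simps:
  assumes "lie_rep \<sigma>"
  shows "\<sigma> x (v + w) = \<sigma> x v + \<sigma> x w" "\<sigma> x (c *\<^sub>C v) = c *\<^sub>C \<sigma> x v"
    "\<sigma> x (v - w) = \<sigma> x v - \<sigma> x w" "\<sigma> x 0 = 0" "\<sigma> x (\<Sum>i\<in>I. f i) = (\<Sum>i\<in>I. \<sigma> x (f i))"
    "\<sigma> (x + y) v = \<sigma> x v + \<sigma> y v" "\<sigma> (c *\<^sub>C x) v = c *\<^sub>C \<sigma> x v"
    "\<sigma> (x - y) v = \<sigma> x v - \<sigma> y v" "\<sigma> 0 v = 0" "\<sigma> (\<Sum>i\<in>J. g i) v = (\<Sum>i\<in>J. \<sigma> (g i) v)"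
    "\<sigma> (lie_bracket x y) v = \<sigma> x (\<sigma> y v) - \<sigma> y (\<sigma> x v)"
proof -
  have lin: "module_hom (*\<^sub>C) (*\<^sub>C) (\<sigma> x)" for x
    using assms by (auto simp: lie_rep_def Vector_Spaces.linear_def)
  have lin2: "module_hom (*\<^sub>C) (*\<^sub>C) (\<lambda>x. \<sigma> x v)" for v
    using assms by (auto simp: lie_rep_def module_hom_iff complex_vector.module_axioms)
  show "\<sigma> x (v + w) = \<sigma> x v + \<sigma> x w" "\<sigma> x (c *\<^sub>C v) = c *\<^sub>C \<sigma> x v"
    "\<sigma> x (v - w) = \<sigma> x v - \<sigma> x w" "\<sigma> x 0 = 0" "\<sigma> x (\<Sum>i\<in>I. f i) = (\<Sum>i\<in>I. \<sigma> x (f i))"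
    using lin[of x] by (auto simp: module_hom.add module_hom.scale module_hom.diff
        module_hom.zero module_hom.sum)
  show "\<sigma> (x + y) v = \<sigma> x v + \<sigma> y v" "\<sigma> (c *\<^sub>C x) v = c *\<^sub>C \<sigma> x v"
    "\<sigma> (x - y) v = \<sigma> x v - \<sigma> y v" "\<sigma> 0 v = 0" "\<sigma> (\<Sum>i\<in>J. g i) v = (\<Sum>i\<in>J. \<sigma> (g i) v)"
    using module_hom.add[OF lin2] module_hom.scale[OF lin2] module_hom.diff[OF lin2]
      module_hom.zero[OF lin2] module_hom.sum[OF lin2] by auto
  show "\<sigma> (lie_bracket x y) v = \<sigma> x (\<sigma> y v) - \<sigma> y (\<sigma> x v)"
    using assms by (auto simp: lie_rep_def)
qed

context dual_matrix_units
begin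

text \<open>
  The entries of the \<open>p\<close>-th power of the matrix of operators \<open>\<sigma> (m a b)\<close>.
\<close>

primrec op_pow :: "('g \<Rightarrow> 'v::complex_vector \<Rightarrow> 'v) \<Rightarrow> nat \<Rightarrow> nat \<Rightarrow> nat \<Rightarrow> 'v \<Rightarrow> 'v" where
  "op_pow \<sigma> 0 a b v = (if a = b then v else 0)"
| "op_pow \<sigma> (Suc p) a b v = (\<Sum>c<N. \<sigma> (m a c) (op_pow \<sigma> p c b v))"

lemma op_pow_linear:
  assumes "lie_rep \<sigma>"
  shows "op_pow \<sigma> p a b (v + w) = op_pow \<sigma> p a b v + op_pow \<sigma> p a b w"
    and "op_pow \<sigma> p a b (k *\<^sub>C v) = k *\<^sub>C op_pow \<sigma> p a b v"
    and "op_pow \<sigma> p a b 0 = 0"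
  by (induction p arbitrary: a b)
     (auto simp: lie_rep_simps[OF assms] sum.distrib complex_vector.scale_sum_right)

text \<open>
  The powers of the operator matrix transform under the algebra like the matrix itself, that is, by
  the rule \<open>bracket_dual_unit\<close>: commutation is a derivation, and in the product of two such matrices
  the terms carrying the inner index cancel.
\<close>

lemma op_pow_commutator:
  assumes \<sigma>: "lie_rep \<sigma>" and "a < N" "b < N"
  shows "\<sigma> x (op_pow \<sigma> p a b v) = op_pow \<sigma> p a b (\<sigma> x v)
     + (\<Sum>c<N. e x c b *\<^sub>C op_pow \<sigma> p a c v) - (\<Sum>c<N. e x a c *\<^sub>C op_pow \<sigma> p c b v)"
  using assms(2,3)
proof (induction p arbitrary: a b)
  case 0
  have "(\<Sum>c<N. e x c b *\<^sub>C (if a = c then v else 0)) = e x a b *\<^sub>C v"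
    "(\<Sum>c<N. e x a c *\<^sub>C (if c = b then v else 0)) = e x a b *\<^sub>C v"
    using 0 by (simp_all add: if_distrib[of "\<lambda>v. _ *\<^sub>C v"] sum.delta sum.delta' cong: if_cong)
  then show ?case by (auto simp: lie_rep_simps[OF \<sigma>])
next
  case (Suc p)
  let ?O = "\<lambda>c d. op_pow \<sigma> p c d v"
  have swap: "\<sigma> x (\<sigma> y u) = \<sigma> y (\<sigma> x u) + \<sigma> (lie_bracket x y) u" for y u
    by (simp add: lie_rep_simps[OF \<sigma>])
  have "\<sigma> x (op_pow \<sigma> (Suc p) a b v)
      = (\<Sum>d<N. \<sigma> (m a d) (\<sigma> x (?O d b))) + (\<Sum>d<N. \<sigma> (lie_bracket x (m a d)) (?O d b))"
    by (simp add: lie_rep_simps(5)[OF \<sigma>] swap sum.distrib)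
  also have "(\<Sum>d<N. \<sigma> (m a d) (\<sigma> x (?O d b))) = op_pow \<sigma> (Suc p) a b (\<sigma> x v)
      + (\<Sum>d<N. \<Sum>c<N. e x c b *\<^sub>C \<sigma> (m a d) (?O d c))
      - (\<Sum>d<N. \<Sum>c<N. e x d c *\<^sub>C \<sigma> (m a d) (?O c b))"
    using Suc by (simp add: Suc.IH lie_rep_simps[OF \<sigma>] sum.distrib sum_subtractf)
  also have "(\<Sum>d<N. \<sigma> (lie_bracket x (m a d)) (?O d b))
      = (\<Sum>d<N. \<Sum>c<N. e x c d *\<^sub>C \<sigma> (m a c) (?O d b))
      - (\<Sum>d<N. \<Sum>c<N. e x a c *\<^sub>C \<sigma> (m c d) (?O d b))"
    using Suc.prems by (simp add: bracket_dual_unit lie_rep_simps[OF \<sigma>] sum_subtractf)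
  also have "(\<Sum>d<N. \<Sum>c<N. e x c d *\<^sub>C \<sigma> (m a c) (?O d b))
      = (\<Sum>d<N. \<Sum>c<N. e x d c *\<^sub>C \<sigma> (m a d) (?O c b))"
    by (rule sum.swap)
  also have "(\<Sum>d<N. \<Sum>c<N. e x a c *\<^sub>C \<sigma> (m c d) (?O d b))
      = (\<Sum>c<N. e x a c *\<^sub>C op_pow \<sigma> (Suc p) c b v)"
    by (subst sum.swap) (simp add: complex_vector.scale_sum_right)
  also have "(\<Sum>d<N. \<Sum>c<N. e x c b *\<^sub>C \<sigma> (m a d) (?O d c))
      = (\<Sum>c<N. e x c b *\<^sub>C op_pow \<sigma> (Suc p) a c v)"
    by (subst sum.swap) (simp add: complex_vector.scale_sum_right)
  finally show ?case by simp
qed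

text \<open>
  An entry of the product of the matrices in a word.
\<close>

primrec word_entry :: "'g list \<Rightarrow> nat \<Rightarrow> nat \<Rightarrow> complex" where
  "word_entry [] a b = (if a = b then 1 else 0)"
| "word_entry (x # xs) a b = (\<Sum>c<N. e x a c * word_entry xs c b)"

text \<open>
  Expanding every \<open>m a c\<close> in the basis \<open>X\<close> gives the coefficients \<open>e (X' i) a c\<close>, so the power becomes a
  sum over words with matrix products of the dual basis as coefficients.
\<close>

lemma op_pow_eq_word_sum:
  fixes X X' :: "nat \<Rightarrow> 'g"
  assumes \<sigma>: "lie_rep \<sigma>"
    and dual: "\<And>x. x = (\<Sum>i\<in>{1..d}. trace_form (X' i) x *\<^sub>C X i)"
    and "a < N" "b < N"
  shows "op_pow \<sigma> p a b v = (\<Sum>is\<in>{is. length is = p \<and> set is \<subseteq> {1..d}}.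
           word_entry (map X' is) a b *\<^sub>C foldr (\<lambda>i. \<sigma> (X i)) is v)"
  using assms(3,4)
proof (induction p arbitrary: a b)
  case 0
  have "{is. length is = 0 \<and> set is \<subseteq> {1..d}} = {[]}" by auto
  then show ?case by auto
next
  case (Suc p)
  let ?L = "{is. set is \<subseteq> {1..d} \<and> length is = p}"
  let ?f = "\<lambda>is. word_entry (map X' is) a b *\<^sub>C foldr (\<lambda>i. \<sigma> (X i)) is v"
  have "trace_form (X' i) (m a c) = e (X' i) a c" if "c < N" for i c
    using that Suc.prems by (metis trace_form_dual trace_form_commute)
  then have m: "m a c = (\<Sum>i\<in>{1..d}. e (X' i) a c *\<^sub>C X i)" if "c < N" for c
    using dual[of "m a c"] that by simp
  have "sum ?f {is. length is = Suc p \<and> set is \<subseteq> {1..d}}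
      = sum ?f ((\<lambda>(is, i). i # is) ` (?L \<times> {1..d}))"
    by (rule sum.cong) (auto simp flip: lists_length_Suc_eq)
  also have "\<dots> = (\<Sum>(is, i)\<in>?L \<times> {1..d}. ?f (i # is))"
    by (subst sum.reindex) (auto simp: inj_on_def case_prod_beta)
  also have "\<dots> = (\<Sum>is\<in>?L. \<Sum>i\<in>{1..d}. ?f (i # is))"
    by (simp add: sum.cartesian_product)
  also have "\<dots> = (\<Sum>is\<in>?L. \<Sum>i\<in>{1..d}. \<Sum>c<N.
      (e (X' i) a c * word_entry (map X' is) c b) *\<^sub>C \<sigma> (X i) (foldr (\<lambda>i. \<sigma> (X i)) is v))"
    by (simp add: complex_vector.scale_sum_left)
  also have "\<dots> = (\<Sum>c<N. \<Sum>i\<in>{1..d}. \<Sum>is\<in>?L.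
      (e (X' i) a c * word_entry (map X' is) c b) *\<^sub>C \<sigma> (X i) (foldr (\<lambda>i. \<sigma> (X i)) is v))"
    by (subst sum.swap, subst (2) sum.swap, subst sum.swap) simp
  also have "\<dots> = (\<Sum>c<N. \<sigma> (m a c) (op_pow \<sigma> p c b v))"
    by (rule sum.cong[OF refl], subst sum.swap)
       (simp add: Suc m lie_rep_simps[OF \<sigma>] complex_vector.scale_sum_right conj_commute mult.commute)
  finally show ?case by simp
qed

end

section \<open>The generalised Casimir operators as scalars\<close>

context dual_matrix_units
begin

lemma op_pow_trace_commute:
  assumes "lie_rep \<sigma>"
  shows "\<sigma> x (\<Sum>a<N. op_pow \<sigma> p a a v) = (\<Sum>a<N. op_pow \<sigma> p a a (\<sigma> x v))"
proof -
  have "\<sigma> x (\<Sum>a<N. op_pow \<sigma> p a a v) = (\<Sum>a<N. op_pow \<sigma> p a a (\<sigma> x v))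
      + (\<Sum>a<N. \<Sum>c<N. e x c a *\<^sub>C op_pow \<sigma> p a c v) - (\<Sum>a<N. \<Sum>c<N. e x a c *\<^sub>C op_pow \<sigma> p c a v)"
    by (simp add: lie_rep_simps(5)[OF assms] op_pow_commutator[OF assms] sum.distrib sum_subtractf)
  also have "(\<Sum>a<N. \<Sum>c<N. e x c a *\<^sub>C op_pow \<sigma> p a c v)
           = (\<Sum>a<N. \<Sum>c<N. e x a c *\<^sub>C op_pow \<sigma> p c a v)"
    by (rule sum.swap)
  finally show ?thesis by simp
qed

text \<open>
  Schur's lemma in the form needed here: since the trace of the power commutes with the action, its
  eigenspace for \<open>c\<close> is a submodule, and it contains \<open>v\<^sub>0\<close>.
\<close>

lemma op_pow_trace_scalar:
  assumes irr: "irreducible_rep \<sigma>" and "v\<^sub>0 \<noteq> 0"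
    and "(\<Sum>a<N. op_pow \<sigma> p a a v\<^sub>0) = c *\<^sub>C v\<^sub>0"
  shows "(\<Sum>a<N. op_pow \<sigma> p a a v) = c *\<^sub>C v"
proof -
  have \<sigma>: "lie_rep \<sigma>" using irr by (simp add: irreducible_rep_def)
  define W where "W = {v. (\<Sum>a<N. op_pow \<sigma> p a a v) = c *\<^sub>C v}"
  have "complex_vector.subspace W"
    unfolding W_def complex_vector.subspace_def
    by (auto simp: op_pow_linear[OF \<sigma>] sum.distrib scaleC_add_right
        complex_vector.scale_sum_right[symmetric] complex_vector.scale_left_commute)
  moreover have "\<sigma> x w \<in> W" if "w \<in> W" for x w
    using that by (simp add: W_def op_pow_trace_commute[OF \<sigma>, symmetric] lie_rep_simps[OF \<sigma>])
  moreover have "v\<^sub>0 \<in> W" using assms(3) by (simp add: W_def)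
  ultimately have "W = UNIV"
    using irr \<open>v\<^sub>0 \<noteq> 0\<close> unfolding irreducible_rep_def by blast
  then show ?thesis by (auto simp: W_def)
qed

end

lemma uea_extension_props:
  assumes "lie_rep \<sigma>"
  shows "uea_extension \<sigma> (a + b) v = uea_extension \<sigma> a v + uea_extension \<sigma> b v"
    and "uea_extension \<sigma> (c *\<^sub>C a) v = c *\<^sub>C uea_extension \<sigma> a v"
    and "uea_extension \<sigma> (a * b) v = uea_extension \<sigma> a (uea_extension \<sigma> b v)"
    and "uea_extension \<sigma> 1 v = v"
    and "uea_extension \<sigma> (uea_of x) v = \<sigma> x v"
proof -
  have "is_uea_extension \<sigma> (uea_extension \<sigma>)"
    unfolding uea_extension_def by (rule theI'[OF ex1_uea_extension[OF assms]])
  then show "uea_extension \<sigma> (a + b) v = uea_extension \<sigma> a v + uea_extension \<sigma> b v"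
    "uea_extension \<sigma> (c *\<^sub>C a) v = c *\<^sub>C uea_extension \<sigma> a v"
    "uea_extension \<sigma> (a * b) v = uea_extension \<sigma> a (uea_extension \<sigma> b v)"
    "uea_extension \<sigma> 1 v = v" "uea_extension \<sigma> (uea_of x) v = \<sigma> x v"
    by (simp_all add: is_uea_extension_def)
qed

lemma uea_extension_sum:
  assumes "lie_rep \<sigma>"
  shows "uea_extension \<sigma> (\<Sum>i\<in>I. f i) v = (\<Sum>i\<in>I. uea_extension \<sigma> (f i) v)"
proof (induction I rule: infinite_finite_induct)
  case empty
  show ?case using uea_extension_props(2)[OF assms, of 0 0 v] by simp
next
  case (infinite I)
  then show ?case using uea_extension_props(2)[OF assms, of 0 0 v] by simp
qed (simp add: uea_extension_props[OF assms])

lemma uea_extension_prod_list: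
  assumes "lie_rep \<sigma>"
  shows "uea_extension \<sigma> (prod_list (map (\<lambda>i. uea_of (X i)) is)) v = foldr (\<lambda>i. \<sigma> (X i)) is v"
  by (induction "is") (simp_all add: uea_extension_props[OF assms])

section \<open>Eigenvalues on highest weight vectors\<close>

text \<open>
  The shape of the dual units in the classical algebras, with \<open>N - 1 - a\<close> the index reflected in the
  antidiagonal: \<open>m a b\<close> is the projection of the matrix unit with entry \<open>1\<close> at \<open>(b, a)\<close>. For
  \<open>q = 2\<close> and \<open>\<tau> = 0\<close> it is the antisymmetrisation with respect to a form with signs \<open>s\<close>, which is
  symmetric for \<open>\<epsilon> = 1\<close> and alternating for \<open>\<epsilon> = -1\<close>; for \<open>q = 1\<close>, \<open>s = 0\<close> and \<open>\<tau> = 1 / N\<close> it is the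
  traceless part.
\<close>

locale split_matrix_units = dual_matrix_units N e m
  for N and e :: "'g::complex_lie_algebra \<Rightarrow> nat \<Rightarrow> nat \<Rightarrow> complex" and m +
  fixes q \<tau> \<epsilon> :: complex and s :: "nat \<Rightarrow> complex"
  assumes entry_unit: "\<lbrakk>a < N; b < N; c < N; d < N\<rbrakk> \<Longrightarrow> e (m a b) c d =
      ((if c = b \<and> d = a then 1 else 0)
        - s a * s b * (if c = N - 1 - a \<and> d = N - 1 - b then 1 else 0)) / q
      - (if a = b \<and> c = d then \<tau> else 0)"
    and sign_opposite: "a < N \<Longrightarrow> s a * s (N - 1 - a) = \<epsilon>"
    and q_nonzero: "q \<noteq> 0"
begin

definition reflection_sign :: "nat \<Rightarrow> nat \<Rightarrow> complex" where
  "reflection_sign a b = (if b = N - 1 - a then \<epsilon> else 0)"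

text \<open>
  Off the diagonal, a dual unit is a multiple of a matrix unit as far as its own column and row are
  concerned. The multiple differs from \<open>1 / q\<close> only when the position lies on the antidiagonal.
\<close>

lemma entry_unit_column:
  assumes "a \<noteq> c" "a < N" "c < N" "d < N"
  shows "e (m a c) d a = (if d = c then (1 - reflection_sign a c) / q else 0)"
    and "e (m a c) c d = (if d = a then (1 - reflection_sign a c) / q else 0)"
proof -
  have "s a * s c = \<epsilon>" if "c = N - 1 - a"
    using sign_opposite[of a] that assms by simp
  moreover have "a = N - 1 - c \<longleftrightarrow> c = N - 1 - a" using assms by auto
  ultimately show "e (m a c) d a = (if d = c then (1 - reflection_sign a c) / q else 0)"
    "e (m a c) c d = (if d = a then (1 - reflection_sign a c) / q else 0)"
    using assms by (auto simp: entry_unit reflection_sign_def)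
qed

text \<open>
  The parameter \<open>\<nu> a\<close> is the weight evaluated at \<open>q\<close> times the diagonal unit \<open>m a a\<close>, which makes it
  the value of the weight on the \<open>a\<close>-th diagonal entry.
\<close>

definition highest_vector :: "('g \<Rightarrow> 'v::complex_vector \<Rightarrow> 'v) \<Rightarrow> (nat \<Rightarrow> complex) \<Rightarrow> 'v \<Rightarrow> bool" where
  "highest_vector \<sigma> \<nu> v \<longleftrightarrow> v \<noteq> 0 \<and> (\<forall>a<N. \<forall>b<a. \<sigma> (m a b) v = 0) \<and>
     (\<forall>a<N. \<sigma> (m a a) v = (\<nu> a / q) *\<^sub>C v)"

primrec diag_eigenvalue :: "(nat \<Rightarrow> complex) \<Rightarrow> nat \<Rightarrow> nat \<Rightarrow> complex" where
  "diag_eigenvalue \<nu> 0 a = 1"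
| "diag_eigenvalue \<nu> (Suc p) a = (\<nu> a * diag_eigenvalue \<nu> p a
     + (\<Sum>b<a. (1 - reflection_sign a b) * (diag_eigenvalue \<nu> p b - diag_eigenvalue \<nu> p a))) / q"

text \<open>
  Triangularity and the recurrence for the diagonal are proved together by induction on \<open>p\<close>. For
  \<open>c < a\<close> the operator \<open>\<sigma> (m a c)\<close> kills \<open>v\<close>, so moving it to the right through the \<open>p\<close>-th power leaves
  only the commutator terms of \<open>op_pow_commutator\<close>; by \<open>entry_unit_column\<close> those contributing to the
  diagonal are again diagonal entries.
\<close>

lemma op_pow_highest_vector:
  assumes \<sigma>: "lie_rep \<sigma>" and v: "highest_vector \<sigma> \<nu> v" and "a < N"
  shows "(\<forall>b<a. op_pow \<sigma> p a b v = 0) \<and> op_pow \<sigma> p a a v = diag_eigenvalue \<nu> p a *\<^sub>C v"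
  using assms(3)
proof (induction p arbitrary: a)
  case 0
  then show ?case by (simp add: scaleC_one)
next
  case (Suc p)
  have IH0: "op_pow \<sigma> p c b v = 0" if "b < c" "c < N" for b c
    using Suc.IH that by blast
  have IH1: "op_pow \<sigma> p c c v = diag_eigenvalue \<nu> p c *\<^sub>C v" if "c < N" for c
    using Suc.IH that by blast
  have comm: "\<sigma> (m a c) (op_pow \<sigma> p c b v) = (\<Sum>d<N. e (m a c) d b *\<^sub>C op_pow \<sigma> p c d v)
      - (\<Sum>d<N. e (m a c) c d *\<^sub>C op_pow \<sigma> p d b v)" if "c < a" "b < N" for b c
    using op_pow_commutator[OF \<sigma>, of c b "m a c" p v] v that Suc.prems
    by (simp add: highest_vector_def op_pow_linear[OF \<sigma>])
  have "op_pow \<sigma> (Suc p) a b v = 0" if "b < a" for b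
  proof -
    have "\<sigma> (m a c) (op_pow \<sigma> p c b v) = 0" if "c < N" for c
    proof (cases "b < c")
      case True
      then show ?thesis using that by (simp add: IH0 lie_rep_simps[OF \<sigma>])
    next
      case False
      have n1: "e (m a c) d b *\<^sub>C op_pow \<sigma> p c d v = 0" if "d < N" for d
      proof (cases "d < c")
        case False
        then have "e (m a c) d b = 0"
          using \<open>\<not> b < c\<close> \<open>b < a\<close> \<open>c < N\<close> that Suc.prems by (subst entry_unit) auto
        then show ?thesis by simp
      qed (use \<open>c < N\<close> in \<open>simp add: IH0\<close>)
      have n2: "e (m a c) c d *\<^sub>C op_pow \<sigma> p d b v = 0" if "d < N" for d
        using entry_unit_column(2)[of a c d] \<open>\<not> b < c\<close> \<open>b < a\<close> Suc.prems that by (simp add: IH0)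
      have "(\<Sum>d<N. e (m a c) d b *\<^sub>C op_pow \<sigma> p c d v) = 0"
        "(\<Sum>d<N. e (m a c) c d *\<^sub>C op_pow \<sigma> p d b v) = 0"
        by (rule sum.neutral, use n1 n2 in blast)+
      then show ?thesis using comm[of c b] \<open>\<not> b < c\<close> \<open>b < a\<close> Suc.prems by simp
    qed
    then show ?thesis by simp
  qed
  moreover have "op_pow \<sigma> (Suc p) a a v = diag_eigenvalue \<nu> (Suc p) a *\<^sub>C v"
  proof -
    let ?t = "diag_eigenvalue \<nu> p"
    have below: "\<sigma> (m a c) (op_pow \<sigma> p c a v)
        = ((1 - reflection_sign a c) * (?t c - ?t a) / q) *\<^sub>C v" if "c < a" for c
    proof -
      let ?k = "(1 - reflection_sign a c) / q"
      have "(\<Sum>d<N. e (m a c) d a *\<^sub>C op_pow \<sigma> p c d v)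
          = (\<Sum>d<N. if d = c then ?k *\<^sub>C op_pow \<sigma> p c c v else 0)"
        using that Suc.prems by (intro sum.cong refl) (simp add: entry_unit_column)
      moreover have "(\<Sum>d<N. e (m a c) c d *\<^sub>C op_pow \<sigma> p d a v)
          = (\<Sum>d<N. if d = a then ?k *\<^sub>C op_pow \<sigma> p a a v else 0)"
        using that Suc.prems by (intro sum.cong refl) (simp add: entry_unit_column)
      ultimately have "\<sigma> (m a c) (op_pow \<sigma> p c a v) = (?k * ?t c) *\<^sub>C v - (?k * ?t a) *\<^sub>C v"
        using that Suc.prems by (simp add: comm IH1 scaleC_scaleC)
      also have "\<dots> = (?k * ?t c - ?k * ?t a) *\<^sub>C v"
        by (rule complex_vector.scale_left_diff_distrib[symmetric])
      also have "?k * ?t c - ?k * ?t a = (1 - reflection_sign a c) * (?t c - ?t a) / q"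
        using q_nonzero by (simp add: field_simps)
      finally show ?thesis .
    qed
    have "op_pow \<sigma> (Suc p) a a v
        = (\<Sum>c\<in>insert a {..<a}. \<sigma> (m a c) (op_pow \<sigma> p c a v))"
      unfolding op_pow.simps
      by (rule sum.mono_neutral_right) (use Suc.prems in \<open>auto simp: IH0 lie_rep_simps[OF \<sigma>]\<close>)
    also have "\<dots> = (?t a * (\<nu> a / q)) *\<^sub>C v
        + (\<Sum>c<a. ((1 - reflection_sign a c) * (?t c - ?t a) / q) *\<^sub>C v)"
      using v Suc.prems by (simp add: below IH1 lie_rep_simps[OF \<sigma>] highest_vector_def scaleC_scaleC)
    also have "\<dots> = diag_eigenvalue \<nu> (Suc p) a *\<^sub>C v"
      by (simp add: complex_vector.scale_sum_left[symmetric] scaleC_add_left[symmetric]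
          sum_divide_distrib add_divide_distrib mult.commute)
    finally show ?thesis .
  qed
  ultimately show ?case by blast
qed

lemma op_pow_trace_eigenvalue:
  assumes "irreducible_rep \<sigma>" and "highest_vector \<sigma> \<nu> v\<^sub>0"
  shows "(\<Sum>a<N. op_pow \<sigma> p a a v) = (\<Sum>a<N. diag_eigenvalue \<nu> p a) *\<^sub>C v"
proof (rule op_pow_trace_scalar[OF assms(1)])
  show "v\<^sub>0 \<noteq> 0" using assms(2) by (simp add: highest_vector_def)
  have "lie_rep \<sigma>" using assms(1) by (simp add: irreducible_rep_def)
  then show "(\<Sum>a<N. op_pow \<sigma> p a a v\<^sub>0) = (\<Sum>a<N. diag_eigenvalue \<nu> p a) *\<^sub>C v\<^sub>0"
    using op_pow_highest_vector[OF _ assms(2)] by (simp add: complex_vector.scale_sum_left)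
qed

end

section \<open>The natural representation\<close>

text \<open>
  The product of the operators \<open>T - (c - 1), \<dots>, T - (c - n)\<close>. It annihilates eigenvectors for the
  eigenvalues \<open>c - 1, \<dots>, c - n\<close> but acts on eigenvectors for \<open>c\<close> as multiplication by \<open>n!\<close>.
\<close>

primrec eigen_cascade :: "('w \<Rightarrow> 'w) \<Rightarrow> complex \<Rightarrow> nat \<Rightarrow> 'w::complex_vector \<Rightarrow> 'w" where
  "eigen_cascade T c 0 w = w"
| "eigen_cascade T c (Suc n) w =
     T (eigen_cascade T c n w) - (c - of_nat (Suc n)) *\<^sub>C eigen_cascade T c n w"

lemma eigen_cascade_eigenvector:
  assumes T: "\<And>k w. T (k *\<^sub>C w) = k *\<^sub>C T w" and "T w = (c - of_nat j) *\<^sub>C w"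
  shows "eigen_cascade T c n w = (\<Prod>i=1..n. of_nat i - of_nat j) *\<^sub>C w"
proof (induction n)
  case 0
  then show ?case by (simp add: scaleC_one)
next
  case (Suc n)
  let ?p = "\<Prod>i=1..n. of_nat i - of_nat j :: complex"
  have "eigen_cascade T c (Suc n) w
      = (?p * (c - of_nat j)) *\<^sub>C w - ((c - of_nat (Suc n)) * ?p) *\<^sub>C w"
    using Suc assms by (simp add: scaleC_scaleC)
  also have "\<dots> = (?p * (of_nat (Suc n) - of_nat j)) *\<^sub>C w"
    unfolding complex_vector.scale_left_diff_distrib[symmetric] by (simp add: algebra_simps)
  finally show ?case by simp
qed

lemma eigen_cascade_add:
  assumes "\<And>v w. T (v + w) = T v + T w"
  shows "eigen_cascade T c n (v + w) = eigen_cascade T c n v + eigen_cascade T c n w"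
  by (induction n) (simp_all add: assms scaleC_add_right)

text \<open>
  Sums of eigenvectors of \<open>T\<close> whose eigenvalues lie strictly below \<open>c\<close>, at integral distance.
\<close>

inductive lower_sum :: "('w \<Rightarrow> 'w) \<Rightarrow> complex \<Rightarrow> 'w::complex_vector \<Rightarrow> bool" for T c where
  eigen: "\<lbrakk>T w = (c - of_nat j) *\<^sub>C w; 0 < j\<rbrakk> \<Longrightarrow> lower_sum T c w"
| add: "\<lbrakk>lower_sum T c v; lower_sum T c w\<rbrakk> \<Longrightarrow> lower_sum T c (v + w)"

lemma not_lower_sum_eigenvector:
  assumes T: "\<And>v w. T (v + w) = T v + T w" "\<And>k w. T (k *\<^sub>C w) = k *\<^sub>C T w"
    and w: "T w = c *\<^sub>C w" "w \<noteq> 0"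
  shows "\<not> lower_sum T c w"
proof
  assume "lower_sum T c w"
  then have "\<exists>k. \<forall>n\<ge>k. eigen_cascade T c n w = 0"
  proof (induction rule: lower_sum.induct)
    case (eigen w j)
    have "(\<Prod>i=1..n. of_nat i - of_nat j) = (0::complex)" if "j \<le> n" for n
      by (rule prod_zero) (use that \<open>0 < j\<close> in auto)
    then have "eigen_cascade T c n w = 0" if "j \<le> n" for n
      using that by (simp only: eigen_cascade_eigenvector[OF T(2) eigen(1)]) simp
    then show ?case by blast
  next
    case (add v w)
    then obtain k l where "\<forall>n\<ge>k. eigen_cascade T c n v = 0" "\<forall>n\<ge>l. eigen_cascade T c n w = 0"
      by blast
    then show ?case by (intro exI[of _ "max k l"]) (simp add: eigen_cascade_add[OF T(1)])
  qed
  then obtain k where "eigen_cascade T c k w = 0" by blast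
  moreover have "eigen_cascade T c k w = (\<Prod>i=1..k. of_nat i - of_nat 0) *\<^sub>C w"
    by (rule eigen_cascade_eigenvector[OF T(2)]) (use w in simp)
  ultimately show False using w by simp
qed

text \<open>
  The grading element \<open>h\<close> is the diagonal matrix with entries descending in steps of \<open>1\<close> and symmetric
  around \<open>0\<close>, so that \<open>m a b\<close> lowers the degree by \<open>b - a\<close>. The size condition for \<open>\<epsilon> = 1\<close> excludes the
  orthogonal algebra of \<open>2 \<times> 2\<close> matrices, whose natural representation is reducible.
\<close>

locale graded_matrix_units = split_matrix_units N e m q \<tau> \<epsilon> s
  for N and e :: "'g::complex_lie_algebra \<Rightarrow> nat \<Rightarrow> nat \<Rightarrow> complex" and m q \<tau> \<epsilon> s +
  fixes h :: 'g
  assumes entry_grading: "\<lbrakk>a < N; b < N\<rbrakk> \<Longrightarrow>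
      e h a b = (if a = b then (of_nat N - 1) / 2 - of_nat a else 0)"
    and size: "2 \<le> N" "\<epsilon> = 1 \<Longrightarrow> 3 \<le> N"
begin

lemma zero_less_size: "0 < N"
  using size(1) by simp

text \<open>
  The dual units move any index to any other one in at most two steps. A single step fails exactly
  between reflected indices in the symmetric case, where the dual unit vanishes; a third index then
  serves as a stopover.
\<close>

lemma units_connected:
  assumes "P a" "a < N" "b < N"
    and step: "\<And>a c. \<lbrakk>P a; a < N; c < N; a \<noteq> c; reflection_sign a c \<noteq> 1\<rbrakk> \<Longrightarrow> P c"
  shows "P b"
proof (cases "a = b \<or> reflection_sign a b \<noteq> 1")
  case True
  then show ?thesis using assms by blast
next
  case False
  then have b: "b = N - 1 - a" "\<epsilon> = 1" "a \<noteq> b"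
    by (auto simp: reflection_sign_def split: if_splits)
  have "card ({..<N} - {a, b}) \<ge> 1"
    using size(2) b assms by (simp add: card_Diff_subset)
  then obtain c where c: "c < N" "c \<noteq> a" "c \<noteq> b"
    by (metis DiffD1 DiffD2 card.empty equals0I insertCI lessThan_iff not_one_le_zero)
  have "reflection_sign a c = 0" "reflection_sign c b = 0"
    using c b(1) assms(2,3) by (auto simp: reflection_sign_def)
  then show ?thesis using c assms step[of a c] step[of c b] by simp
qed

text \<open>
  The natural representation on vectors of length \<open>N\<close>, encoded as functions that vanish from \<open>N\<close> on.
\<close>

definition act :: "'g \<Rightarrow> (nat \<Rightarrow> complex) \<Rightarrow> nat \<Rightarrow> complex" where
  "act x f = (\<lambda>a. if a < N then \<Sum>b<N. e x a b * f b else 0)"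

definition unit_vec :: "nat \<Rightarrow> nat \<Rightarrow> complex" where
  "unit_vec a = (\<lambda>b. if b = a then 1 else 0)"

lemma act_add: "act x (\<lambda>a. f a + g a) = (\<lambda>a. act x f a + act x g a)"
  by (auto simp: act_def algebra_simps sum.distrib)

lemma act_scale: "act x (\<lambda>a. k * f a) = (\<lambda>a. k * act x f a)"
  by (auto simp: act_def algebra_simps sum_distrib_left)

lemma act_zero: "act x (\<lambda>_. 0) = (\<lambda>_. 0)"
  by (auto simp: act_def)

lemma act_unit_vec: "b < N \<Longrightarrow> act x (unit_vec b) = (\<lambda>a. if a < N then e x a b else 0)"
  by (auto simp: act_def unit_vec_def if_distrib[of "\<lambda>x. _ * x"] cong: if_cong)

lemma act_bracket:
  "act x (act y f) = (\<lambda>a. act y (act x f) a + act (lie_bracket x y) f a)"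
proof
  fix a
  have "(\<Sum>b<N. (\<Sum>c<N. e x a c * e y c b) * f b) = (\<Sum>b<N. e x a b * (\<Sum>c<N. e y b c * f c))"
    for x y by (simp add: sum_distrib_left sum_distrib_right mult.assoc, rule sum.swap)
  then show "act x (act y f) a = act y (act x f) a + act (lie_bracket x y) f a"
    by (simp add: act_def entry_bracket left_diff_distrib sum_subtractf)
qed

lemma act_expansion: "act x f = (\<lambda>a. \<Sum>c<N. \<Sum>d<N. e x c d * act (m d c) f a)"
proof
  fix a
  have "e x a b = (\<Sum>c<N. \<Sum>d<N. e x c d * e (m d c) a b)" for b
    by (subst dual_unit_expansion[of x]) (simp add: entry_sum entry_scale)
  then have "act x f a = (if a < N then \<Sum>b<N. \<Sum>c<N. \<Sum>d<N. e x c d * (e (m d c) a b * f b) else 0)"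
    by (simp add: act_def sum_distrib_right mult.assoc)
  also have "(\<Sum>b<N. \<Sum>c<N. \<Sum>d<N. e x c d * (e (m d c) a b * f b))
      = (\<Sum>c<N. \<Sum>d<N. \<Sum>b<N. e x c d * (e (m d c) a b * f b))"
    by (subst sum.swap) (rule sum.cong[OF refl], rule sum.swap)
  finally show "act x f a = (\<Sum>c<N. \<Sum>d<N. e x c d * act (m d c) f a)"
    by (simp add: act_def sum_distrib_left)
qed

lemma bracket_grading:
  assumes "a < N" "b < N"
  shows "lie_bracket h (m a b) = (of_nat a - of_nat b) *\<^sub>C m a b"
proof -
  have "(\<Sum>c<N. e h c b *\<^sub>C m a c) = (\<Sum>c<N. if c = b then e h b b *\<^sub>C m a b else 0)"
    using assms by (intro sum.cong) (auto simp: entry_grading)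
  moreover have "(\<Sum>c<N. e h a c *\<^sub>C m c b) = (\<Sum>c<N. if c = a then e h a a *\<^sub>C m a b else 0)"
    using assms by (intro sum.cong) (auto simp: entry_grading)
  ultimately show ?thesis
    using assms by (simp add: bracket_dual_unit entry_grading
        complex_vector.scale_left_diff_distrib[symmetric])
qed

text \<open>
  The submodule of the direct sum of \<open>\<sigma>\<close> and the natural representation generated by the pair of highest
  weight vectors. It will turn out to be the graph of an isomorphism. Only lowering operators are
  used as generators; closure under the whole algebra is \<open>cyclic_graph_invariant\<close>.
\<close>

inductive cyclic_graph ::
    "('g \<Rightarrow> 'w::complex_vector \<Rightarrow> 'w) \<Rightarrow> 'w \<Rightarrow> 'w \<Rightarrow> (nat \<Rightarrow> complex) \<Rightarrow> bool" for \<sigma> w\<^sub>0 where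
  base: "cyclic_graph \<sigma> w\<^sub>0 w\<^sub>0 (unit_vec 0)"
| add: "\<lbrakk>cyclic_graph \<sigma> w\<^sub>0 v f; cyclic_graph \<sigma> w\<^sub>0 w g\<rbrakk> \<Longrightarrow>
    cyclic_graph \<sigma> w\<^sub>0 (v + w) (\<lambda>a. f a + g a)"
| scale: "cyclic_graph \<sigma> w\<^sub>0 v f \<Longrightarrow> cyclic_graph \<sigma> w\<^sub>0 (k *\<^sub>C v) (\<lambda>a. k * f a)"
| lower: "\<lbrakk>a < b; b < N; cyclic_graph \<sigma> w\<^sub>0 v f\<rbrakk> \<Longrightarrow>
    cyclic_graph \<sigma> w\<^sub>0 (\<sigma> (m a b) v) (act (m a b) f)"

lemma cyclic_graph_zero: "cyclic_graph \<sigma> w\<^sub>0 0 (\<lambda>_. 0)"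
  using scale[OF base, where k = 0] by simp

lemma cyclic_graph_sum:
  "(\<And>i. i \<in> I \<Longrightarrow> cyclic_graph \<sigma> w\<^sub>0 (v i) (f i)) \<Longrightarrow>
     cyclic_graph \<sigma> w\<^sub>0 (\<Sum>i\<in>I. v i) (\<lambda>a. \<Sum>i\<in>I. f i a)"
  by (induction I rule: infinite_finite_induct) (simp_all add: cyclic_graph_zero cyclic_graph.add)

lemma cyclic_graph_diff:
  assumes "cyclic_graph \<sigma> w\<^sub>0 v f" "cyclic_graph \<sigma> w\<^sub>0 w g"
  shows "cyclic_graph \<sigma> w\<^sub>0 (v - w) (\<lambda>a. f a - g a)"
  using add[OF assms(1) scale[OF assms(2), of "-1"]]
  by (simp add: complex_vector.scale_minus_left scaleC_one)

lemma cyclic_graph_support: "\<lbrakk>cyclic_graph \<sigma> w\<^sub>0 v f; N \<le> a\<rbrakk> \<Longrightarrow> f a = 0"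
  by (induction rule: cyclic_graph.induct) (use size(1) in \<open>auto simp: unit_vec_def act_def\<close>)

context
  fixes \<sigma> :: "'g \<Rightarrow> 'w::complex_vector \<Rightarrow> 'w" and w\<^sub>0 :: 'w
  assumes irr: "irreducible_rep \<sigma>"
    and highest: "highest_vector \<sigma> (\<lambda>a. q * e (m a a) 0 0) w\<^sub>0"
begin

lemma natural_lie_rep: "lie_rep \<sigma>"
  using irr by (simp add: irreducible_rep_def)

text \<open>
  Induction over the generation: an operator \<open>x\<close> is moved past a lowering operator at the price of
  the bracket, which is again an element of the algebra and covered by the induction hypothesis. On
  the generating pair itself all dual units but the lowering ones act by the same scalar on
  both components.
\<close>

lemma cyclic_graph_invariant: "cyclic_graph \<sigma> w\<^sub>0 v f \<Longrightarrow> cyclic_graph \<sigma> w\<^sub>0 (\<sigma> x v) (act x f)"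
proof (induction arbitrary: x rule: cyclic_graph.induct)
  case base
  have "cyclic_graph \<sigma> w\<^sub>0 (\<sigma> (m b a) w\<^sub>0) (act (m b a) (unit_vec 0))" if "a < N" "b < N" for a b
  proof (cases "b < a")
    case True
    then show ?thesis using that by (intro cyclic_graph.lower cyclic_graph.base)
  next
    case False
    have "\<sigma> (m b a) w\<^sub>0 = (if a = b then e (m a a) 0 0 else 0) *\<^sub>C w\<^sub>0"
      using highest False that q_nonzero by (auto simp: highest_vector_def)
    moreover have "act (m b a) (unit_vec 0) = (\<lambda>c. (if a = b then e (m a a) 0 0 else 0) * unit_vec 0 c)"
      using False that size(1) unfolding act_unit_vec[OF zero_less_size]
      by (auto simp: fun_eq_iff unit_vec_def entry_unit)
    ultimately show ?thesis by (simp only: cyclic_graph.scale[OF cyclic_graph.base])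
  qed
  then have "cyclic_graph \<sigma> w\<^sub>0 (\<Sum>a<N. \<Sum>b<N. e x a b *\<^sub>C \<sigma> (m b a) w\<^sub>0)
      (\<lambda>c. \<Sum>a<N. \<Sum>b<N. e x a b * act (m b a) (unit_vec 0) c)"
    by (intro cyclic_graph_sum cyclic_graph.scale) auto
  moreover have "\<sigma> x w\<^sub>0 = (\<Sum>a<N. \<Sum>b<N. e x a b *\<^sub>C \<sigma> (m b a) w\<^sub>0)"
    by (subst dual_unit_expansion[of x]) (simp add: lie_rep_simps[OF natural_lie_rep])
  ultimately show ?case by (simp add: act_expansion[of x])
next
  case (add v f w g)
  then show ?case
    by (simp add: lie_rep_simps[OF natural_lie_rep] act_add cyclic_graph.add)
next
  case (scale v f k)
  then show ?case
    by (simp add: lie_rep_simps[OF natural_lie_rep] act_scale cyclic_graph.scale)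
next
  case (lower a b v f)
  have swap: "\<sigma> x (\<sigma> (m a b) v) = \<sigma> (m a b) (\<sigma> x v) + \<sigma> (lie_bracket x (m a b)) v"
    by (simp add: lie_rep_simps[OF natural_lie_rep])
  show ?case
    unfolding swap act_bracket[of x "m a b" f]
    by (intro cyclic_graph.add cyclic_graph.lower lower)
qed

abbreviation below_highest :: "'w \<Rightarrow> bool" where
  "below_highest \<equiv> lower_sum (\<sigma> h) ((of_nat N - 1) / 2)"

lemma below_highest_scale: "below_highest w \<Longrightarrow> below_highest (k *\<^sub>C w)"
proof (induction rule: lower_sum.induct)
  case (eigen w j)
  then show ?case
    by (intro lower_sum.eigen[where j = j])
       (simp_all add: lie_rep_simps[OF natural_lie_rep] complex_vector.scale_left_commute)
qed (simp add: scaleC_add_right lower_sum.add)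

lemma lowering_eigenvector:
  assumes "a < b" "b < N" "\<sigma> h w = ((of_nat N - 1) / 2 - of_nat j) *\<^sub>C w"
  shows "below_highest (\<sigma> (m a b) w)"
proof (rule lower_sum.eigen[where j = "j + (b - a)"])
  have "\<sigma> h (\<sigma> (m a b) w) = \<sigma> (m a b) (\<sigma> h w) + \<sigma> (lie_bracket h (m a b)) w"
    by (simp add: lie_rep_simps[OF natural_lie_rep])
  also have "\<dots> = ((of_nat N - 1) / 2 - of_nat j) *\<^sub>C \<sigma> (m a b) w
      + (of_nat a - of_nat b) *\<^sub>C \<sigma> (m a b) w"
    using assms by (simp only: bracket_grading assms(3) lie_rep_simps[OF natural_lie_rep])
  also have "\<dots> = ((of_nat N - 1) / 2 - of_nat (j + (b - a))) *\<^sub>C \<sigma> (m a b) w"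
    unfolding scaleC_add_left[symmetric] using assms(1) by (simp add: of_nat_diff algebra_simps)
  finally show "\<sigma> h (\<sigma> (m a b) w) = ((of_nat N - 1) / 2 - of_nat (j + (b - a))) *\<^sub>C \<sigma> (m a b) w" .
qed (use assms in simp)

lemma below_highest_lower:
  "below_highest w \<Longrightarrow> a < b \<Longrightarrow> b < N \<Longrightarrow> below_highest (\<sigma> (m a b) w)"
proof (induction rule: lower_sum.induct)
  case (eigen w j)
  then show ?case by (intro lowering_eigenvector)
qed (simp add: lie_rep_simps[OF natural_lie_rep] lower_sum.add)

lemma grading_highest: "\<sigma> h w\<^sub>0 = ((of_nat N - 1) / 2) *\<^sub>C w\<^sub>0"
proof -
  have "\<sigma> h w\<^sub>0 = (\<Sum>a<N. \<Sum>b<N. e h a b *\<^sub>C \<sigma> (m b a) w\<^sub>0)"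
    by (subst dual_unit_expansion[of h]) (simp add: lie_rep_simps[OF natural_lie_rep])
  also have "\<dots> = (\<Sum>a<N. \<Sum>b<N. (e h a b * e (m b a) 0 0) *\<^sub>C w\<^sub>0)"
  proof (intro sum.cong refl)
    fix a b assume "a \<in> {..<N}" "b \<in> {..<N}"
    then show "e h a b *\<^sub>C \<sigma> (m b a) w\<^sub>0 = (e h a b * e (m b a) 0 0) *\<^sub>C w\<^sub>0"
      using highest q_nonzero by (cases "a = b")
        (auto simp: highest_vector_def scaleC_scaleC entry_grading)
  qed
  also have "\<dots> = e (\<Sum>a<N. \<Sum>b<N. e h a b *\<^sub>C m b a) 0 0 *\<^sub>C w\<^sub>0"
    by (simp add: entry_sum entry_scale complex_vector.scale_sum_left)
  also have "\<dots> = ((of_nat N - 1) / 2) *\<^sub>C w\<^sub>0"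
    by (simp only: dual_unit_expansion[symmetric]) (simp add: entry_grading zero_less_size)
  finally show ?thesis .
qed

lemma not_below_highest: "\<not> below_highest w\<^sub>0"
  by (rule not_lower_sum_eigenvector)
     (use highest in \<open>auto simp: lie_rep_simps[OF natural_lie_rep] grading_highest highest_vector_def\<close>)

text \<open>
  Lowering operators map the first component to lower degree and the second one to vectors with
  coordinate \<open>0\<close> equal to \<open>0\<close>, so both components keep the same coefficient at the top. As \<open>w\<^sub>0\<close> is not
  of lower degree, the graph does not contain \<open>(w\<^sub>0, 0)\<close>, nor any \<open>(0, f)\<close> with \<open>f 0 \<noteq> 0\<close>.
\<close>

lemma cyclic_graph_top:
  "cyclic_graph \<sigma> w\<^sub>0 v f \<Longrightarrow> \<exists>l. below_highest l \<and> v = f 0 *\<^sub>C w\<^sub>0 + l"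
proof (induction rule: cyclic_graph.induct)
  case base
  have "below_highest 0"
    by (rule lower_sum.eigen[where j = 1]) (simp_all add: lie_rep_simps[OF natural_lie_rep])
  then show ?case by (intro exI[of _ 0]) (simp add: unit_vec_def scaleC_one)
next
  case (add v f w g)
  then obtain k l where "below_highest k" "v = f 0 *\<^sub>C w\<^sub>0 + k" "below_highest l" "w = g 0 *\<^sub>C w\<^sub>0 + l"
    by blast
  then show ?case
    by (intro exI[of _ "k + l"]) (simp add: lower_sum.add scaleC_add_left)
next
  case (scale v f k)
  then obtain l where "below_highest l" "v = f 0 *\<^sub>C w\<^sub>0 + l" by blast
  then show ?case
    by (intro exI[of _ "k *\<^sub>C l"]) (simp add: below_highest_scale scaleC_add_right scaleC_scaleC)
next
  case (lower a b v f)
  then obtain l where l: "below_highest l" "v = f 0 *\<^sub>C w\<^sub>0 + l" by blast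
  have "below_highest (\<sigma> (m a b) w\<^sub>0)"
    using lowering_eigenvector[of a b w\<^sub>0 0] lower grading_highest by simp
  then have "below_highest (\<sigma> (m a b) v)"
    using l lower by (simp add: lie_rep_simps[OF natural_lie_rep] lower_sum.add
        below_highest_scale below_highest_lower)
  moreover have "act (m a b) f 0 = 0"
    using lower size(1) by (simp add: act_def) (rule sum.neutral, auto simp: entry_unit)
  ultimately show ?case by auto
qed

lemma cyclic_graph_total: "\<exists>f. cyclic_graph \<sigma> w\<^sub>0 v f"
proof -
  let ?W = "{v. \<exists>f. cyclic_graph \<sigma> w\<^sub>0 v f}"
  have "complex_vector.subspace ?W"
    unfolding complex_vector.subspace_def
    by (blast intro: cyclic_graph_zero cyclic_graph.add cyclic_graph.scale)
  moreover have "\<forall>x. \<forall>w\<in>?W. \<sigma> x w \<in> ?W" by (blast intro: cyclic_graph_invariant)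
  moreover have "w\<^sub>0 \<in> ?W" "w\<^sub>0 \<noteq> 0"
    using highest by (auto intro: cyclic_graph.base simp: highest_vector_def)
  ultimately have "?W = UNIV" using irr unfolding irreducible_rep_def by blast
  then show ?thesis by blast
qed

text \<open>
  The vectors \<open>v\<close> for which \<open>(v, 0)\<close> lies in the graph form a submodule missing \<open>w\<^sub>0\<close>.
\<close>

lemma cyclic_graph_left_zero: "cyclic_graph \<sigma> w\<^sub>0 v (\<lambda>_. 0) \<Longrightarrow> v = 0"
proof -
  let ?W = "{v. cyclic_graph \<sigma> w\<^sub>0 v (\<lambda>_. 0)}"
  have "complex_vector.subspace ?W"
    unfolding complex_vector.subspace_def
    using cyclic_graph_zero cyclic_graph.add[of \<sigma> w\<^sub>0 _ "\<lambda>_. 0" _ "\<lambda>_. 0"]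
      cyclic_graph.scale[of \<sigma> w\<^sub>0 _ "\<lambda>_. 0"] by auto
  moreover have "\<forall>x. \<forall>w\<in>?W. \<sigma> x w \<in> ?W"
    using cyclic_graph_invariant[of _ "\<lambda>_. 0"] by (auto simp: act_zero)
  moreover have "w\<^sub>0 \<notin> ?W"
    using cyclic_graph_top[of w\<^sub>0 "\<lambda>_. 0"] not_below_highest by auto
  ultimately have "?W = {0}" using irr unfolding irreducible_rep_def by blast
  then show "cyclic_graph \<sigma> w\<^sub>0 v (\<lambda>_. 0) \<Longrightarrow> v = 0" by blast
qed

text \<open>
  If \<open>(0, f)\<close> lies in the graph and \<open>f\<close> has a non-zero coordinate, then the dual units produce such
  an \<open>f\<close> with non-zero coordinate \<open>0\<close>, contradicting \<open>cyclic_graph_top\<close>.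
\<close>

lemma cyclic_graph_right_zero:
  assumes "cyclic_graph \<sigma> w\<^sub>0 0 f"
  shows "f a = 0"
proof (rule ccontr)
  let ?P = "\<lambda>a. \<exists>f. cyclic_graph \<sigma> w\<^sub>0 0 f \<and> f a \<noteq> 0"
  assume "f a \<noteq> 0"
  have "a < N" using cyclic_graph_support[OF assms, of a] \<open>f a \<noteq> 0\<close> by force
  have "?P 0"
  proof (rule units_connected[of ?P])
    show "?P a" using assms \<open>f a \<noteq> 0\<close> by blast
    show "0 < N" using size(1) by simp
    fix a c assume "?P a" and *: "a < N" "c < N" "a \<noteq> c" "reflection_sign a c \<noteq> 1"
    then obtain f where f: "cyclic_graph \<sigma> w\<^sub>0 0 f" "f a \<noteq> 0" by blast
    have "act (m a c) f c = (\<Sum>d<N. e (m a c) c d * f d)"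
      using * by (simp add: act_def)
    also have "\<dots> = (\<Sum>d<N. if d = a then (1 - reflection_sign a c) / q * f d else 0)"
      by (rule sum.cong) (use * in \<open>auto simp: entry_unit_column\<close>)
    also have "\<dots> \<noteq> 0" using * f q_nonzero by simp
    finally show "?P c"
      using cyclic_graph_invariant[OF f(1), of "m a c"] by (auto simp: lie_rep_simps[OF natural_lie_rep])
  qed fact
  then obtain g l where g: "cyclic_graph \<sigma> w\<^sub>0 0 g" "g 0 \<noteq> 0" "below_highest l" "0 = g 0 *\<^sub>C w\<^sub>0 + l"
    using cyclic_graph_top by blast
  then have "(- 1 / g 0) *\<^sub>C l = (1 / g 0) *\<^sub>C (g 0 *\<^sub>C w\<^sub>0)"
    by (metis add.inverse_inverse complex_vector.scale_minus_left complex_vector.scale_minus_right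
        divide_minus_left eq_neg_iff_add_eq_0)
  also have "\<dots> = w\<^sub>0" using g by (simp add: scaleC_scaleC scaleC_one)
  finally show False using below_highest_scale[OF g(3), of "- 1 / g 0"] not_below_highest by simp
qed

text \<open>
  The graph is that of an isomorphism: it is total on the irreducible \<open>\<sigma>\<close>, contains every unit vector
  as a second component by \<open>units_connected\<close>, and is single-valued in both directions by the two
  preceding lemmas. The vector \<open>u b\<close> is the partner of the unit vector \<open>b\<close>.
\<close>

theorem natural_basis_exists:
  obtains u :: "nat \<Rightarrow> 'w" where
    "inj_on u {..<N}" "complex_vector.independent (u ` {..<N})"
    "complex_vector.span (u ` {..<N}) = UNIV"
    "\<And>x b. b < N \<Longrightarrow> \<sigma> x (u b) = (\<Sum>a<N. e x a b *\<^sub>C u a)"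
proof -
  have "\<exists>w. cyclic_graph \<sigma> w\<^sub>0 w (unit_vec b)" if "b < N" for b
  proof (rule units_connected[of "\<lambda>b. \<exists>w. cyclic_graph \<sigma> w\<^sub>0 w (unit_vec b)" 0])
    show "\<exists>w. cyclic_graph \<sigma> w\<^sub>0 w (unit_vec 0)" by (blast intro: cyclic_graph.base)
    show "0 < N" using size(1) by simp
    fix a c assume "\<exists>w. cyclic_graph \<sigma> w\<^sub>0 w (unit_vec a)"
      and *: "a < N" "c < N" "a \<noteq> c" "reflection_sign a c \<noteq> 1"
    then obtain w where w: "cyclic_graph \<sigma> w\<^sub>0 w (unit_vec a)" by blast
    let ?k = "(1 - reflection_sign a c) / q"
    have "?k \<noteq> 0" using * q_nonzero by simp
    moreover have "act (m a c) (unit_vec a) = (\<lambda>d. ?k * unit_vec c d)"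
      using * unfolding act_unit_vec[OF \<open>a < N\<close>]
      by (auto simp: unit_vec_def entry_unit_column fun_eq_iff)
    ultimately have "(\<lambda>d. 1 / ?k * act (m a c) (unit_vec a) d) = unit_vec c" by auto
    then show "\<exists>w. cyclic_graph \<sigma> w\<^sub>0 w (unit_vec c)"
      using cyclic_graph.scale[OF cyclic_graph_invariant[OF w, of "m a c"], of "1 / ?k"] by auto
  qed fact
  then obtain u where u: "cyclic_graph \<sigma> w\<^sub>0 (u b) (unit_vec b)" if "b < N" for b by metis
  have comb: "cyclic_graph \<sigma> w\<^sub>0 (\<Sum>a<N. r a *\<^sub>C u a) (\<lambda>c. if c < N then r c else 0)" for r
  proof -
    have "(\<Sum>a<N. r a * unit_vec a c) = (if c < N then r c else 0)" for c
      by (simp add: unit_vec_def if_distrib[of "\<lambda>x. _ * x"] cong: if_cong)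
    then show ?thesis
      using cyclic_graph_sum[OF cyclic_graph.scale[OF u], of "{..<N}" "\<lambda>i. i" r] by simp
  qed
  have unique: "v = w" if "cyclic_graph \<sigma> w\<^sub>0 v f" "cyclic_graph \<sigma> w\<^sub>0 w f" for v w f
    using cyclic_graph_left_zero[of "v - w"] cyclic_graph_diff[OF that] by simp
  have zero: "r a = 0" if "(\<Sum>a<N. r a *\<^sub>C u a) = 0" "a < N" for r a
    using cyclic_graph_right_zero[of "\<lambda>c. if c < N then r c else 0" a] comb[of r] that by simp
  have inj: "inj_on u {..<N}"
  proof (rule inj_onI)
    fix a b assume ab: "a \<in> {..<N}" "b \<in> {..<N}" "u a = u b"
    have "cyclic_graph \<sigma> w\<^sub>0 (u a - u b) (\<lambda>c. unit_vec a c - unit_vec b c)"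
      using ab by (intro cyclic_graph_diff u) auto
    then show "a = b" using ab cyclic_graph_right_zero[of "\<lambda>c. unit_vec a c - unit_vec b c" a]
      by (simp add: unit_vec_def split: if_splits)
  qed
  have indep: "complex_vector.independent (u ` {..<N})"
  proof (rule complex_vector.independent_if_scalars_zero)
    fix r w assume *: "(\<Sum>x\<in>u ` {..<N}. r x *\<^sub>C x) = 0" and "w \<in> u ` {..<N}"
    then obtain a where a: "a < N" "w = u a" by auto
    have "(\<Sum>a<N. r (u a) *\<^sub>C u a) = 0" using * inj by (simp add: sum.reindex)
    then show "r w = 0" using zero[of "\<lambda>a. r (u a)" a] a by simp
  qed simp
  have span: "w \<in> complex_vector.span (u ` {..<N})" for w
  proof -
    obtain f where f: "cyclic_graph \<sigma> w\<^sub>0 w f" using cyclic_graph_total by blast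
    then have "f = (\<lambda>c. if c < N then f c else 0)"
      using cyclic_graph_support[OF f] by (auto simp: fun_eq_iff)
    then have "w = (\<Sum>a<N. f a *\<^sub>C u a)" using unique comb f by metis
    moreover have "(\<Sum>a<N. f a *\<^sub>C u a) \<in> complex_vector.span (u ` {..<N})"
      by (intro complex_vector.span_sum complex_vector.span_scale complex_vector.span_base) auto
    ultimately show ?thesis by simp
  qed
  have action: "\<sigma> x (u b) = (\<Sum>a<N. e x a b *\<^sub>C u a)" if "b < N" for x b
    using cyclic_graph_invariant[OF u[OF that], of x] comb[of "\<lambda>a. e x a b"] that
    by (intro unique) (simp_all add: act_unit_vec)
  show ?thesis by (rule that[of u]) (use inj indep span action in auto)
qed

theorem natural_multi_trace: "multi_trace \<sigma> xs = (\<Sum>a<N. word_entry xs a a)"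
  and natural_dim: "complex_vector.dim (UNIV :: 'w set) = N"
proof -
  obtain u where u: "inj_on u {..<N}" "complex_vector.independent (u ` {..<N})"
      "complex_vector.span (u ` {..<N}) = UNIV"
    and action: "\<And>x b. b < N \<Longrightarrow> \<sigma> x (u b) = (\<Sum>a<N. e x a b *\<^sub>C u a)"
    by (rule natural_basis_exists) blast
  let ?B = "u ` {..<N}" and ?F = "\<lambda>xs. foldr (\<lambda>Y f. \<sigma> Y \<circ> f) xs id"
  have "clinear (?F xs)"
    by (induction xs) (simp_all add: Vector_Spaces.linear_iff complex_vector.vector_space_axioms
        lie_rep_simps(1,2)[OF natural_lie_rep])
  then have "multi_trace \<sigma> xs = (\<Sum>b\<in>?B. complex_vector.representation ?B (?F xs b) b)"
    unfolding multi_trace_def by (rule trace_end_basis) (use u in auto)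
  also have "\<dots> = (\<Sum>b<N. complex_vector.representation ?B (?F xs (u b)) (u b))"
    using u(1) by (simp add: sum.reindex)
  also have "\<dots> = (\<Sum>b<N. word_entry xs b b)"
  proof (intro sum.cong refl)
    fix b assume b: "b \<in> {..<N}"
    have F: "?F xs (u b) = (\<Sum>a<N. word_entry xs a b *\<^sub>C u a)" for xs
    proof (induction xs)
      case Nil
      have "(\<Sum>a<N. word_entry [] a b *\<^sub>C u a) = (\<Sum>a<N. if a = b then u a else 0)"
        by (intro sum.cong) (auto simp: scaleC_one)
      then show ?case using b by simp
    next
      case (Cons x xs)
      have "?F (x # xs) (u b) = (\<Sum>c<N. \<Sum>a<N. (word_entry xs c b * e x a c) *\<^sub>C u a)"
        by (simp add: Cons lie_rep_simps[OF natural_lie_rep] action complex_vector.scale_sum_right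
            scaleC_scaleC)
      also have "\<dots> = (\<Sum>a<N. word_entry (x # xs) a b *\<^sub>C u a)"
        by (subst sum.swap) (simp add: complex_vector.scale_sum_left mult.commute)
      finally show ?case .
    qed
    have rep: "complex_vector.representation ?B (u a) (u b) = (if a = b then 1 else 0)"
      if "a < N" for a
      using complex_vector.representation_basis[OF u(2), of "u a"] b that
      by (auto simp: inj_on_eq_iff[OF u(1)])
    have "complex_vector.representation ?B (?F xs (u b)) (u b)
        = (\<Sum>a<N. word_entry xs a b * (if a = b then 1 else 0))"
      unfolding F using u(2,3)
      by (simp add: complex_vector.representation_sum complex_vector.representation_scale rep)
    then show "complex_vector.representation ?B (?F xs (u b)) (u b) = word_entry xs b b"
      using b by (simp add: if_distrib[of "\<lambda>x. _ * x"] cong: if_cong)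
  qed
  finally show "multi_trace \<sigma> xs = (\<Sum>a<N. word_entry xs a a)" .
  have "complex_vector.dim (UNIV :: 'w set) = card ?B"
    using u by (metis complex_vector.dim_span_eq_card_independent)
  then show "complex_vector.dim (UNIV :: 'w set) = N" using u(1) by (simp add: card_image)
qed

end

end

section \<open>Summing the recurrence\<close>

text \<open>
  Write \<open>S\<^sub>a = 2 + z (\<Sum>b<a. T\<^sub>b)\<close>, \<open>P\<^sub>a = \<Prod>b<a. 1 + z / D\<^sub>b\<close> and \<open>B = \<epsilon> z / E\<close>. Below the middle there are
  no reflected terms and \<open>S\<^sub>a = 2 P\<^sub>a\<close>. From the middle on,
  \<open>S\<^sub>a = 2 (1 - B) P\<^sub>a + B S\<^bsub>N-a\<^esub>\<close>; the induction step reduces to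
  \<open>B (D\<^sub>a + D\<^sub>a' + z) = \<epsilon> z\<close>, which is the choice of \<open>B\<close>. At \<open>a = N\<close> this is the claim, as \<open>S\<^sub>0 = 2\<close>.

  For odd \<open>N\<close> the middle index is its own reflection and its equation has the coefficient
  \<open>D\<^sub>a + \<epsilon> z / 2\<close> rather than \<open>D\<^sub>a\<close>. With \<open>\<epsilon> = 1\<close> this is what makes the formula start correctly
  above the middle, and it keeps \<open>D\<^sub>a + D\<^sub>a'\<close> constant there too.
\<close>

lemma reflected_product_formula:
  fixes D T :: "nat \<Rightarrow> 'a::field_char_0" and z \<epsilon> E :: 'a and N :: nat
  defines "E \<equiv> 4 + (of_nat N - \<epsilon>) * z"
  assumes rec: "\<And>a. a < N \<Longrightarrow>
        (D a + (if N - 1 - a = a then \<epsilon> * z / 2 else 0)) * T a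
        = 2 + z * (\<Sum>b<a. T b) - (if N - 1 - a < a then \<epsilon> * z * T (N - 1 - a) else 0)"
    and pair: "\<And>a. a < N \<Longrightarrow> D a + D (N - 1 - a) = E - z"
    and nz: "\<And>a. a < N \<Longrightarrow> D a \<noteq> 0" "E \<noteq> 0"
    and mid: "odd N \<Longrightarrow> \<epsilon> = 1"
  shows "2 + z * (\<Sum>a<N. T a) = 2 * (1 - \<epsilon> * z / E) * (\<Prod>a<N. 1 + z / D a) + 2 * (\<epsilon> * z / E)"
proof -
  define S where "S a = 2 + z * (\<Sum>b<a. T b)" for a
  define P where "P a = (\<Prod>b<a. 1 + z / D b)" for a
  define B where "B = \<epsilon> * z / E"
  have S0: "S 0 = 2" and S_Suc: "S (Suc a) = S a + z * T a" for a
    by (simp_all add: S_def algebra_simps)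
  have P_Suc: "P (Suc a) = P a * (1 + z / D a)" for a
    by (simp add: P_def)
  have BE: "B * E = \<epsilon> * z" using nz by (simp add: B_def)
  have lower_T: "T a = S a / D a" if "2 * a + 1 < N" for a
  proof -
    have "\<not> N - 1 - a = a" "\<not> N - 1 - a < a" "a < N" using that by auto
    then have "D a * T a = S a" using rec[of a] by (simp add: S_def)
    then show ?thesis using nz(1)[of a] \<open>a < N\<close> by (simp add: eq_divide_eq mult.commute)
  qed
  have lower: "S a = 2 * P a" if "a \<le> N div 2" for a
    using that
  proof (induction a)
    case (Suc a)
    then show ?case using lower_T[of a] by (simp add: S_Suc P_Suc algebra_simps)
  qed (simp add: S0 P_def)
  have upper: "S a = 2 * (1 - B) * P a + B * S (N - a)" if "N - N div 2 \<le> a" "a \<le> N" for a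
    using that
  proof (induction a rule: dec_induct)
    case base
    show ?case
    proof (cases "even N")
      case True
      then have "N - N div 2 = N div 2" "N - (N - N div 2) = N div 2" by auto
      then show ?thesis by (simp add: lower algebra_simps)
    next
      case False
      define n where "n = N div 2"
      have n: "N = 2 * n + 1" using False by (simp add: n_def odd_two_times_div_two_succ)
      have eps: "\<epsilon> = 1" using mid False by simp
      have E: "E = 2 * D n + z" using pair[of n] n by (simp add: algebra_simps)
      have D: "D n + z / 2 \<noteq> 0" using nz(2) by (auto simp: E field_simps)
      have "(D n + z / 2) * T n = S n"
        using rec[of n] n by (simp add: S_def eps)
      then have "T n = S n / (D n + z / 2)" using D by (simp add: field_simps)
      then have "S (Suc n) = S n * (1 + z / (D n + z / 2))" by (simp add: S_Suc field_simps)
      also have "1 + z / (D n + z / 2) = (1 - B) * (1 + z / D n) + B"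
      proof -
        have "1 - B = (E - z) / E" using nz(2) by (simp add: B_def eps diff_divide_distrib)
        then have "(1 - B) * (1 + z / D n) + B = 2 * D n / E * (1 + z / D n) + z / E"
          by (simp add: E B_def eps)
        also have "\<dots> = (2 * D n + 2 * z + z) / E"
          using nz(1)[of n] n by (simp add: distrib_left add_divide_distrib)
        also have "\<dots> = 1 + 2 * z / E" using nz(2) by (simp add: E add_divide_distrib[symmetric] field_simps)
        also have "2 * z / E = z / (D n + z / 2)"
          using D nz(2) by (simp add: E frac_eq_eq algebra_simps)
        finally show ?thesis by simp
      qed
      also have "S n * \<dots> = 2 * (1 - B) * P (Suc n) + B * S n"
      proof -
        have "s * ((1 - B) * (1 + w) + B) = 2 * (1 - B) * (p * (1 + w)) + B * s"
          if "s = 2 * p" for s p w :: 'a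
          using that by (simp add: algebra_simps)
        then show ?thesis unfolding P_Suc using lower[of n] n by simp
      qed
      finally show ?thesis using n by simp
    qed
  next
    case (step a)
    define b where "b = N - 1 - a"
    have ab: "a < N" "b < a" "N - 1 - b = a" "N - a = Suc b" "N - Suc a = b" "2 * b + 1 < N"
      using step by (auto simp: b_def)
    have "a \<noteq> N - 1 - a" using ab(2) unfolding b_def by simp
    then have Ta: "D a * T a = S a - \<epsilon> * z * T b"
      using rec[of a] ab(1,2) by (simp add: S_def b_def)
    have Tb: "S b = D b * T b" using lower_T[OF ab(6)] nz(1)[of b] ab by simp
    have IH: "S a = 2 * (1 - B) * P a + B * (S b + z * T b)"
      using step ab by (simp add: S_Suc)
    have sum: "D a + D b = E - z" using pair[OF ab(1)] by (simp only: b_def)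
    define u where "u = z / D a"
    have u: "D a * u = z" using nz(1) ab by (simp add: u_def)
    have "D a * (S a + z * T a - 2 * (1 - B) * (P a * (1 + u)) - B * S b)
        = D a * S a + z * (D a * T a) - 2 * (1 - B) * P a * (D a + D a * u) - D a * (B * S b)"
      by (simp add: algebra_simps)
    also have "2 * (1 - B) * P a = S a - B * (S b + z * T b)" using IH by simp
    also have "D a * S a + z * (D a * T a) - (S a - B * (S b + z * T b)) * (D a + D a * u)
          - D a * (B * S b)
        = z * T b * (B * (D a + D b + z) - \<epsilon> * z)"
      unfolding Ta u Tb by (simp add: algebra_simps)
    also have "\<dots> = 0" by (simp add: sum BE)
    finally have "D a * (S a + z * T a - 2 * (1 - B) * (P a * (1 + u)) - B * S b) = 0" .
    then have "S a + z * T a = 2 * (1 - B) * (P a * (1 + u)) + B * S b"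
      using nz(1)[OF ab(1)] by (simp add: diff_eq_eq add.commute)
    then show ?case by (simp add: S_Suc P_Suc ab u_def)
  qed
  show ?thesis using upper[of N] by (simp add: S0 S_def P_def B_def)
qed

lemma solve_affine:
  fixes x s p k :: "'a::field"
  assumes "x \<noteq> 0"
  shows "1 + x * s = p \<Longrightarrow> s = 1 / x * (p - 1)"
    and "2 + x * s = 2 * (1 - k) * p + 2 * k \<Longrightarrow> s = 2 / x * (1 - k) * (p - 1)"
proof -
  show "1 + x * s = p \<Longrightarrow> s = 1 / x * (p - 1)" using assms by (auto simp: field_simps)
  assume "2 + x * s = 2 * (1 - k) * p + 2 * k"
  then have "x * s = 2 * (1 - k) * (p - 1)" by (simp add: algebra_simps)
  then show "s = 2 / x * (1 - k) * (p - 1)" using assms by (simp add: field_simps)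
qed

lemma fls_linear_nonzero: "k \<noteq> 0 \<Longrightarrow> fls_const k - fls_const (c::complex) * fls_X \<noteq> 0"
proof
  assume "fls_const k - fls_const c * fls_X = 0" "k \<noteq> 0"
  then have "fls_nth (fls_const k - fls_const c * fls_X) 0 = 0" by simp
  then show False using \<open>k \<noteq> 0\<close> by (simp add: fls_X_times_conv_shift)
qed

context split_matrix_units
begin

definition diag_series :: "(nat \<Rightarrow> complex) \<Rightarrow> nat \<Rightarrow> complex fps" where
  "diag_series \<nu> a = Abs_fps (\<lambda>p. diag_eigenvalue \<nu> p a)"

lemma sum_reflection_sign:
  fixes f :: "nat \<Rightarrow> complex"
  assumes "a < N"
  shows "(\<Sum>b<a. reflection_sign a b * f b) = (if N - 1 - a < a then \<epsilon> * f (N - 1 - a) else 0)"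
proof -
  have "(\<Sum>b<a. reflection_sign a b * f b) = (\<Sum>b<a. if b = N - 1 - a then \<epsilon> * f b else 0)"
    by (rule sum.cong) (auto simp: reflection_sign_def)
  then show ?thesis by simp
qed

text \<open>
  The recurrence for the diagonal eigenvalues, multiplied by \<open>z^(p+1)\<close> and summed over \<open>p\<close>. The number of
  \<open>b < a\<close>, weighted with \<open>1 - reflection_sign a b\<close>, shifts \<open>\<nu> a\<close> by \<open>-a\<close>, up to the sign \<open>\<epsilon>\<close> when
  the reflected index lies below \<open>a\<close>.
\<close>

lemma diag_series_recurrence:
  assumes "a < N"
  shows "(fps_const q - fps_const (\<nu> a - of_nat a + (if N - 1 - a < a then \<epsilon> else 0)) * fps_X)
           * diag_series \<nu> a
       = fps_const q + fps_X * (\<Sum>b<a. diag_series \<nu> b)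
         - (if N - 1 - a < a then fps_const \<epsilon> * fps_X * diag_series \<nu> (N - 1 - a) else 0)"
    (is "?L = ?R")
proof (rule fps_ext)
  fix p
  show "?L $ p = ?R $ p"
  proof (cases p)
    case 0
    then show ?thesis by (simp add: diag_series_def left_diff_distrib mult.assoc)
  next
    case (Suc k)
    let ?t = "diag_eigenvalue \<nu> k"
    have "q * diag_eigenvalue \<nu> (Suc k) a
        = \<nu> a * ?t a + (\<Sum>b<a. (1 - reflection_sign a b) * (?t b - ?t a))"
      using q_nonzero by simp
    also have "\<dots>
        = \<nu> a * ?t a + ((\<Sum>b<a. ?t b) - (\<Sum>b<a. reflection_sign a b * ?t b)
          - (of_nat a - (\<Sum>b<a. reflection_sign a b * 1)) * ?t a)"
      by (simp add: algebra_simps sum.distrib sum_subtractf sum_distrib_left sum_distrib_right)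
    finally show ?thesis
      using Suc unfolding sum_reflection_sign[OF assms]
      by (cases "N - 1 - a < a")
         (simp_all add: diag_series_def left_diff_distrib mult.assoc fps_sum_nth algebra_simps
          del: diag_eigenvalue.simps(2))
  qed
qed

abbreviation diag_laurent :: "(nat \<Rightarrow> complex) \<Rightarrow> nat \<Rightarrow> complex fls" where
  "diag_laurent \<nu> a \<equiv> fps_to_fls (diag_series \<nu> a)"

lemma fps_to_fls_sum: "fps_to_fls (\<Sum>a\<in>A. f a) = (\<Sum>a\<in>A. fps_to_fls (f a :: complex fps))"
  by (induction A rule: infinite_finite_induct) simp_all

lemma diag_laurent_recurrence:
  assumes "a < N"
  shows "(fls_const q - fls_const (\<nu> a - of_nat a + (if N - 1 - a < a then \<epsilon> else 0)) * fls_X)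
           * diag_laurent \<nu> a
       = fls_const q + fls_X * (\<Sum>b<a. diag_laurent \<nu> b)
         - (if N - 1 - a < a then fls_const \<epsilon> * fls_X * diag_laurent \<nu> (N - 1 - a) else 0)"
  using arg_cong[OF diag_series_recurrence[OF assms, of \<nu>], of fps_to_fls]
  by (simp add: fls_times_fps_to_fls fps_to_fls_sum split: if_splits)

lemma generating_function_linear:
  assumes "q = 1" "\<epsilon> = 0"
  shows "(\<Sum>a<N. diag_laurent \<nu> a)
    = 1 / fls_X * ((\<Prod>a<N. 1 + fls_X / (1 - fls_const (\<nu> a - of_nat a) * fls_X)) - 1)"
proof -
  let ?D = "\<lambda>a. 1 - fls_const (\<nu> a - of_nat a) * fls_X"
  have D: "?D a \<noteq> 0" for a using fls_linear_nonzero[of 1] by simp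
  have q: "fls_const q = 1" and eps: "fls_const \<epsilon> = 0" "(if P then \<epsilon> else 0) = 0" for P
    by (simp_all add: assms)
  have "1 + fls_X * (\<Sum>b<a. diag_laurent \<nu> b) = (\<Prod>b<a. 1 + fls_X / ?D b)" if "a \<le> N" for a
    using that
  proof (induction a)
    case (Suc a)
    let ?S = "1 + fls_X * (\<Sum>b<a. diag_laurent \<nu> b)"
    have "?D a * diag_laurent \<nu> a = ?S"
      using diag_laurent_recurrence[of a \<nu>] Suc.prems q eps by simp
    then have "diag_laurent \<nu> a = ?S / ?D a" using D[of a] by (simp add: eq_divide_eq mult.commute)
    then have "1 + fls_X * (\<Sum>b<Suc a. diag_laurent \<nu> b) = ?S + fls_X * (?S / ?D a)"
      by (simp only: sum.lessThan_Suc distrib_left add.assoc)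
    also have "\<dots> = ?S * (1 + fls_X / ?D a)"
    proof -
      have "s + x * (s / d) = s * (1 + x / d)" for s x d :: "complex fls"
        by (simp add: distrib_left mult.commute)
      then show ?thesis .
    qed
    also have "?S = (\<Prod>b<a. 1 + fls_X / ?D b)" using Suc by simp
    finally show ?case by simp
  qed simp
  then have "1 + fls_X * (\<Sum>b<N. diag_laurent \<nu> b) = (\<Prod>b<N. 1 + fls_X / ?D b)" by blast
  then show ?thesis by (rule solve_affine(1)[OF fls_X_nonzero])
qed

lemma generating_function_reflected:
  assumes "q = 2" "\<And>a. a < N \<Longrightarrow> \<nu> a + \<nu> (N - 1 - a) = 0" "odd N \<Longrightarrow> \<epsilon> = 1"
  shows "(\<Sum>a<N. diag_laurent \<nu> a)
    = 2 / fls_X * (1 - fls_const \<epsilon> * fls_X / (4 + (of_nat N - fls_const \<epsilon>) * fls_X))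
      * ((\<Prod>a<N. 1 + fls_X / (2 - fls_const (\<nu> a - of_nat a
            + (if N - 1 - a < a then \<epsilon> else if N - 1 - a = a then \<epsilon> / 2 else 0)) * fls_X)) - 1)"
proof -
  define c where "c a = \<nu> a - of_nat a
      + (if N - 1 - a < a then \<epsilon> else if N - 1 - a = a then \<epsilon> / 2 else 0)" for a
  let ?D = "\<lambda>a. 2 - fls_const (c a) * fls_X"
  let ?E = "4 + (of_nat N - fls_const \<epsilon>) * fls_X"
  have two: "fls_const (2::complex) = 2" and four: "fls_const (4::complex) = 4"
    using fls_const_numeral by auto
  have q: "fls_const q = 2" by (simp add: assms(1))
  have "fls_const (\<epsilon> / 2) * fls_const 2 = fls_const \<epsilon>"
    by (simp only: fls_const_mult_const) simp
  then have half: "fls_const (\<epsilon> / 2) = fls_const \<epsilon> / 2"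
    unfolding two by (simp add: eq_divide_eq)
  have "2 + fls_X * (\<Sum>a<N. diag_laurent \<nu> a)
      = 2 * (1 - fls_const \<epsilon> * fls_X / ?E) * (\<Prod>a<N. 1 + fls_X / ?D a)
        + 2 * (fls_const \<epsilon> * fls_X / ?E)"
  proof (rule reflected_product_formula)
    fix a assume a: "a < N"
    have c: "\<nu> a - of_nat a + (if N - 1 - a < a then \<epsilon> else 0)
        = c a - (if N - 1 - a = a then \<epsilon> / 2 else 0)"
      by (simp add: c_def)
    show "(?D a + (if N - 1 - a = a then fls_const \<epsilon> * fls_X / 2 else 0)) * diag_laurent \<nu> a
      = 2 + fls_X * (\<Sum>b<a. diag_laurent \<nu> b)
        - (if N - 1 - a < a then fls_const \<epsilon> * fls_X * diag_laurent \<nu> (N - 1 - a) else 0)"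
      using diag_laurent_recurrence[OF a, of \<nu>] unfolding c
      by (simp add: q two half fls_minus_const[symmetric] algebra_simps split: if_splits)
    have "c a + c (N - 1 - a) = \<epsilon> - (of_nat N - 1)"
      using assms(2)[OF a] a by (auto simp: c_def of_nat_diff algebra_simps)
    then have sum: "fls_const (c a) + fls_const (c (N - 1 - a)) = fls_const \<epsilon> - (of_nat N - 1)"
      by (metis fls_const_1 fls_of_nat fls_minus_const fls_plus_const)
    have "?D a + ?D (N - 1 - a)
        = 4 - (fls_const (c a) + fls_const (c (N - 1 - a))) * fls_X"
      by (simp add: algebra_simps)
    then show "?D a + ?D (N - 1 - a) = ?E - fls_X"
      unfolding sum by (simp add: algebra_simps)
    show "?D a \<noteq> 0" using fls_linear_nonzero[of 2] by (simp add: two)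
  next
    have "?E = fls_const 4 - fls_const (\<epsilon> - of_nat N) * fls_X"
      by (simp add: four fls_minus_const[symmetric] fls_of_nat algebra_simps)
    then show "?E \<noteq> 0" using fls_linear_nonzero[of 4] by simp
    show "odd N \<Longrightarrow> fls_const \<epsilon> = 1" using assms(3) by simp
  qed
  then show ?thesis
    unfolding c_def by (rule solve_affine(2)[OF fls_X_nonzero])
qed

end

section \<open>The generating function of the eigenvalues\<close>

context graded_matrix_units
begin

lemma trace_form_linear:
  "trace_form x (y + z) = trace_form x y + trace_form x z"
  "trace_form x (k *\<^sub>C y) = k * trace_form x y"
  by (simp_all add: trace_form_def entry_add entry_scale algebra_simps sum.distrib sum_distrib_left)

lemma word_entry_trace_pair: "(\<Sum>a<N. word_entry [x, y] a a) = trace_form x y"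
  by (simp add: trace_form_def if_distrib[of "\<lambda>x. _ * x"] cong: if_cong)

text \<open>
  Both sides are linear in \<open>x\<close> and agree on the basis \<open>X\<close>.
\<close>

lemma dual_basis_expansion:
  assumes X: "lie_basis X d"
    and dual: "\<And>i j. \<lbrakk>i \<in> {1..d}; j \<in> {1..d}\<rbrakk> \<Longrightarrow> trace_form (X' i) (X j) = (if i = j then 1 else 0)"
  shows "x = (\<Sum>i\<in>{1..d}. trace_form (X' i) x *\<^sub>C X i)"
proof -
  define f where "f x = (\<Sum>i\<in>{1..d}. trace_form (X' i) x *\<^sub>C X i)" for x
  have "x \<in> complex_vector.span (X ` {1..d})" using X by (simp add: lie_basis_def)
  then have "f x = x"
  proof (induction rule: complex_vector.span_induct_alt)
    case base
    show ?case using trace_form_linear(2)[of _ 0 0] by (simp add: f_def)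
  next
    case (step c y z)
    then obtain j where j: "j \<in> {1..d}" "y = X j" by blast
    have "f y = (\<Sum>i\<in>{1..d}. if i = j then y else 0)"
      unfolding f_def using j by (intro sum.cong refl) (auto simp: dual scaleC_one)
    then have "f y = y" using j by simp
    moreover have "f (c *\<^sub>C y + z) = c *\<^sub>C f y + f z"
      by (simp add: f_def trace_form_linear scaleC_add_left sum.distrib
          complex_vector.scale_sum_right scaleC_scaleC)
    ultimately show ?case using step by simp
  qed
  then show ?thesis by (simp add: f_def)
qed

text \<open>
  The multilinear traces of \<open>\<kappa>\<close> are traces of matrix products, so \<open>X'\<close> is dual to \<open>X\<close> for the
  trace form and the Casimir element acts as the trace of a power of the operator matrix. The value
  at \<open>p = 0\<close> fits because the dimension of \<open>\<kappa>\<close> is \<open>N\<close>.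
\<close>

theorem casimir_eigenvalue_eq:
  fixes \<sigma> :: "'g \<Rightarrow> 'v::complex_vector \<Rightarrow> 'v" and \<kappa> :: "'g \<Rightarrow> 'w::complex_vector \<Rightarrow> 'w"
  assumes \<sigma>: "irreducible_rep \<sigma>" "highest_vector \<sigma> \<nu> v\<^sub>0"
    and \<kappa>: "irreducible_rep \<kappa>" "highest_vector \<kappa> (\<lambda>a. q * e (m a a) 0 0) w\<^sub>0"
    and X: "lie_basis X d" "dual_basis \<kappa> X X' d"
  shows "casimir_eigenvalue \<kappa> X X' d \<sigma> p = (\<Sum>a<N. diag_eigenvalue \<nu> p a)"
proof -
  have rep: "lie_rep \<sigma>" using \<sigma> by (simp add: irreducible_rep_def)
  have "trace_form (X' i) (X j) = (if i = j then 1 else 0)" if "i \<in> {1..d}" "j \<in> {1..d}" for i j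
    using X(2) that unfolding dual_basis_def natural_multi_trace[OF \<kappa>] word_entry_trace_pair by blast
  note expansion = dual_basis_expansion[OF X(1) this]
  have "uea_extension \<sigma> (casimir \<kappa> X X' d p) v = (\<Sum>a<N. op_pow \<sigma> p a a v)" for v
  proof (cases "p = 0")
    case True
    then show ?thesis
      by (simp add: casimir_def natural_dim[OF \<kappa>] uea_extension_props[OF rep]
          complex_vector.sum_constant_scale)
  next
    case False
    let ?L = "{is. length is = p \<and> set is \<subseteq> {1..d}}"
    have "uea_extension \<sigma> (casimir \<kappa> X X' d p) v
        = (\<Sum>is\<in>?L. multi_trace \<kappa> (map X' is) *\<^sub>C foldr (\<lambda>i. \<sigma> (X i)) is v)"
      using False by (simp only: casimir_def if_False uea_extension_sum[OF rep]
          uea_extension_props[OF rep] uea_extension_prod_list[OF rep])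
    also have "\<dots> = (\<Sum>is\<in>?L. \<Sum>a<N. word_entry (map X' is) a a *\<^sub>C foldr (\<lambda>i. \<sigma> (X i)) is v)"
      by (simp only: natural_multi_trace[OF \<kappa>] complex_vector.scale_sum_left)
    also have "\<dots> = (\<Sum>a<N. \<Sum>is\<in>?L. word_entry (map X' is) a a *\<^sub>C foldr (\<lambda>i. \<sigma> (X i)) is v)"
      by (rule sum.swap)
    also have "\<dots> = (\<Sum>a<N. op_pow \<sigma> p a a v)"
      by (intro sum.cong refl op_pow_eq_word_sum[OF rep expansion, symmetric]) auto
    finally show ?thesis .
  qed
  then have scalar: "uea_extension \<sigma> (casimir \<kappa> X X' d p) v = (\<Sum>a<N. diag_eigenvalue \<nu> p a) *\<^sub>C v" for v
    by (simp add: op_pow_trace_eigenvalue[OF \<sigma>])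
  have "v\<^sub>0 \<noteq> 0" using \<sigma> by (simp add: highest_vector_def)
  then show ?thesis
    unfolding casimir_eigenvalue_def scalar by (intro the_equality) auto
qed

corollary casimir_gf_eq:
  fixes \<sigma> :: "'g \<Rightarrow> 'v::complex_vector \<Rightarrow> 'v" and \<kappa> :: "'g \<Rightarrow> 'w::complex_vector \<Rightarrow> 'w"
  assumes "irreducible_rep \<sigma>" "highest_vector \<sigma> \<nu> v\<^sub>0"
    and "irreducible_rep \<kappa>" "highest_vector \<kappa> (\<lambda>a. q * e (m a a) 0 0) w\<^sub>0"
    and "lie_basis X d" "dual_basis \<kappa> X X' d"
  shows "casimir_gf \<kappa> X X' d \<sigma> = (\<Sum>a<N. diag_laurent \<nu> a)"
proof -
  have "Abs_fps (casimir_eigenvalue \<kappa> X X' d \<sigma>) = (\<Sum>a<N. diag_series \<nu> a)"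
    by (rule fps_ext) (simp add: casimir_eigenvalue_eq[OF assms] diag_series_def fps_sum_nth)
  then show ?thesis by (simp add: casimir_gf_def fps_to_fls_sum)
qed

end

section \<open>The classical Lie algebras\<close>

definition matrix_size :: "classical_type \<Rightarrow> nat \<Rightarrow> nat" where
  "matrix_size t n = (case t of Type_A \<Rightarrow> n + 1 | Type_B \<Rightarrow> 2 * n + 1 | _ \<Rightarrow> 2 * n)"

text \<open>
  The three functions below are the parameters \<open>s\<close>, \<open>\<epsilon>\<close> and \<open>q\<close> of \<open>split_matrix_units\<close>: the
  non-zero entries of the antidiagonal form (with \<open>0\<close> in type A, where there is no form), its symmetry,
  and the denominator of the projection to the algebra.
\<close>

definition form_sign :: "classical_type \<Rightarrow> nat \<Rightarrow> nat \<Rightarrow> complex" where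
  "form_sign t n a = (case t of Type_A \<Rightarrow> 0 | Type_C \<Rightarrow> if a < n then 1 else -1 | _ \<Rightarrow> 1)"

definition form_symmetry :: "classical_type \<Rightarrow> complex" where
  "form_symmetry t = (case t of Type_A \<Rightarrow> 0 | Type_C \<Rightarrow> -1 | _ \<Rightarrow> 1)"

definition projection_degree :: "classical_type \<Rightarrow> complex" where
  "projection_degree t = (if t = Type_A then 1 else 2)"

definition trace_correction :: "classical_type \<Rightarrow> nat \<Rightarrow> complex" where
  "trace_correction t n = (if t = Type_A then 1 / of_nat (n + 1) else 0)"

text \<open>
  Preserving an antidiagonal form with entries \<open>\<plusminus>1\<close> means being antisymmetric, up to signs, under
  reflection in the antidiagonal: the defining matrix equation at \<open>(a, N - 1 - b)\<close> has just two terms.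
\<close>

lemma form_preserving_antidiagonal:
  fixes s :: "nat \<Rightarrow> complex"
  assumes s: "\<And>a. a < N \<Longrightarrow> s a * s a = 1"
  shows "form_preserving N (mat N N (\<lambda>(i, j). if i + j + 1 = N then s i else 0))
    = {M \<in> carrier_mat N N. \<forall>a<N. \<forall>b<N. M $$ (N - 1 - a, N - 1 - b) = - (s a * s b * M $$ (b, a))}"
    (is "form_preserving N ?J = ?R")
proof -
  have entries: "(transpose_mat M * ?J + ?J * M) $$ (a, N - 1 - b)
      = s b * M $$ (b, a) + s a * M $$ (N - 1 - a, N - 1 - b)"
    if M: "M \<in> carrier_mat N N" and ab: "a < N" "b < N" for M a b
  proof -
    have "(transpose_mat M * ?J) $$ (a, N - 1 - b)
        = (\<Sum>k\<in>{0..<N}. M $$ (k, a) * (if k + (N - 1 - b) + 1 = N then s k else 0))"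
      using M ab by (simp add: scalar_prod_def)
    also have "\<dots> = (\<Sum>k\<in>{0..<N}. if k = b then s b * M $$ (b, a) else 0)"
      by (rule sum.cong) (use ab in auto)
    finally have 1: "(transpose_mat M * ?J) $$ (a, N - 1 - b)
        = (\<Sum>k\<in>{0..<N}. if k = b then s b * M $$ (b, a) else 0)" .
    have "(?J * M) $$ (a, N - 1 - b)
        = (\<Sum>k\<in>{0..<N}. (if a + k + 1 = N then s a else 0) * M $$ (k, N - 1 - b))"
      using M ab by (simp add: scalar_prod_def)
    also have "\<dots> = (\<Sum>k\<in>{0..<N}. if k = N - 1 - a then s a * M $$ (N - 1 - a, N - 1 - b) else 0)"
      by (rule sum.cong) (use ab in auto)
    finally show ?thesis using M ab 1 by (simp add: sum.delta)
  qed
  have cancel: "s b * x + s a * y = 0 \<longleftrightarrow> y = - (s a * s b * x)" if "a < N" for a b x y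
  proof -
    have "s a * (s b * x + s a * y) = s a * s b * x + y"
      using s[OF that] by (simp add: algebra_simps)
    moreover have "s a \<noteq> 0" using s[OF that] by auto
    ultimately show ?thesis
      by (metis add.commute add_eq_0_iff mult_eq_0_iff)
  qed
  have "M \<in> form_preserving N ?J \<longleftrightarrow> M \<in> ?R" for M
  proof (cases "M \<in> carrier_mat N N")
    case True
    let ?Z = "transpose_mat M * ?J + ?J * M"
    have Z: "?Z \<in> carrier_mat N N" using True by (intro add_carrier_mat mult_carrier_mat) auto
    have "?Z = 0\<^sub>m N N \<longleftrightarrow> (\<forall>a<N. \<forall>b<N. ?Z $$ (a, b) = 0)"
      using Z by (auto intro!: eq_matI)
    also have "\<dots> \<longleftrightarrow> (\<forall>a<N. \<forall>b<N. ?Z $$ (a, N - 1 - b) = 0)"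
    proof (intro iffI allI impI)
      fix a b assume *: "\<forall>a<N. \<forall>b<N. ?Z $$ (a, N - 1 - b) = 0" "a < N" "b < N"
      moreover have "N - 1 - b < N" using *(3) by simp
      ultimately have "?Z $$ (a, N - 1 - (N - 1 - b)) = 0" by blast
      moreover have "N - 1 - (N - 1 - b) = b" using * by simp
      ultimately show "?Z $$ (a, b) = 0" by simp
    qed auto
    also have "\<dots> \<longleftrightarrow> M \<in> ?R"
    proof -
      have "?Z $$ (a, N - 1 - b) = 0 \<longleftrightarrow> M $$ (N - 1 - a, N - 1 - b) = - (s a * s b * M $$ (b, a))"
        if "a < N" "b < N" for a b
        unfolding entries[OF True that] by (rule cancel[OF that(1)])
      then show ?thesis unfolding mem_Collect_eq using True by blast
    qed
    finally show ?thesis using True by (simp add: form_preserving_def)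
  qed (simp add: form_preserving_def)
  then show ?thesis by blast
qed

lemma form_sign_square: "t \<noteq> Type_A \<Longrightarrow> form_sign t n a * form_sign t n a = 1"
  by (cases t) (auto simp: form_sign_def)

lemma form_sign_opposite:
  "a < matrix_size t n \<Longrightarrow> form_sign t n a * form_sign t n (matrix_size t n - 1 - a) = form_symmetry t"
  by (cases t) (auto simp: form_sign_def form_symmetry_def matrix_size_def)

lemma classical_matrices_iff:
  "M \<in> classical_matrices t n \<longleftrightarrow> M \<in> carrier_mat (matrix_size t n) (matrix_size t n) \<and>
    (if t = Type_A then (\<Sum>i<matrix_size t n. M $$ (i, i)) = 0
     else \<forall>a<matrix_size t n. \<forall>b<matrix_size t n.
       M $$ (matrix_size t n - 1 - a, matrix_size t n - 1 - b)
       = - (form_sign t n a * form_sign t n b * M $$ (b, a)))"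
proof (cases "t = Type_A")
  case True
  then show ?thesis
    by (auto simp: classical_matrices_def special_linear_def mat_trace_def matrix_size_def)
next
  case False
  let ?N = "matrix_size t n"
  have "classical_matrices t n
      = form_preserving ?N (mat ?N ?N (\<lambda>(i, j). if i + j + 1 = ?N then form_sign t n i else 0))"
  proof -
    have "mat ?N ?N (\<lambda>(i, j). if i + j + 1 = ?N then if i < j then 1 else -1 else 0)
        = mat ?N ?N (\<lambda>(i, j). if i + j + 1 = ?N then form_sign t n i else 0)" if "t = Type_C"
      by (rule cong_mat) (use that in \<open>auto simp: form_sign_def matrix_size_def\<close>)
    moreover have "mat ?N ?N (\<lambda>(i, j). if i + j + 1 = ?N then 1 else 0)
        = mat ?N ?N (\<lambda>(i, j). if i + j + 1 = ?N then form_sign t n i else 0)"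
      if "t = Type_B \<or> t = Type_D"
      by (rule cong_mat) (use that in \<open>auto simp: form_sign_def\<close>)
    ultimately show ?thesis
      using False by (cases t)
        (simp_all add: classical_matrices_def special_orthogonal_def symplectic_def matrix_size_def)
  qed
  then show ?thesis
    unfolding form_preserving_antidiagonal[OF form_sign_square[OF False]] using False by simp
qed

definition dual_unit_matrix :: "classical_type \<Rightarrow> nat \<Rightarrow> nat \<Rightarrow> nat \<Rightarrow> complex mat" where
  "dual_unit_matrix t n a b = (let N = matrix_size t n in mat N N (\<lambda>(c, d).
     ((if c = b \<and> d = a then 1 else 0)
        - form_sign t n a * form_sign t n b * (if c = N - 1 - a \<and> d = N - 1 - b then 1 else 0))
       / projection_degree t
     - (if a = b \<and> c = d then trace_correction t n else 0)))"

lemma dual_unit_matrix_entry: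
  assumes "c < matrix_size t n" "d < matrix_size t n"
  shows "dual_unit_matrix t n a b $$ (c, d) =
     ((if c = b \<and> d = a then 1 else 0) - form_sign t n a * form_sign t n b
        * (if c = matrix_size t n - 1 - a \<and> d = matrix_size t n - 1 - b then 1 else 0))
       / projection_degree t
     - (if a = b \<and> c = d then trace_correction t n else 0)"
  using assms by (simp only: dual_unit_matrix_def Let_def index_mat(1) prod.case)

lemma dual_unit_matrix_carrier:
  "dual_unit_matrix t n a b \<in> carrier_mat (matrix_size t n) (matrix_size t n)"
  by (simp add: dual_unit_matrix_def Let_def)

lemma dual_unit_matrix_classical:
  assumes "a < matrix_size t n" "b < matrix_size t n"
  shows "dual_unit_matrix t n a b \<in> classical_matrices t n"
proof (cases "t = Type_A")
  case True
  have "(\<Sum>i<matrix_size t n. dual_unit_matrix t n a b $$ (i, i))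
      = (\<Sum>i<matrix_size t n. if i = a then if a = b then 1 else 0 else 0)
        - (\<Sum>i<matrix_size t n. if a = b then trace_correction t n else 0)"
    unfolding sum_subtractf[symmetric]
    by (rule sum.cong) (use True in \<open>auto simp: dual_unit_matrix_def Let_def form_sign_def projection_degree_def\<close>)
  also have "\<dots> = 0"
  proof -
    have "of_nat (Suc n) * (1 / of_nat (Suc n)) = (1::complex)"
      by (simp only: of_nat_neq_0 nonzero_mult_div_cancel_left times_divide_eq_right mult_1_right
          divide_self not_False_eq_True)
    then have "of_nat (matrix_size t n) * trace_correction t n = 1"
      using True by (simp only: matrix_size_def trace_correction_def if_True classical_type.case
          Suc_eq_plus1 refl)
    then show ?thesis using assms(1) by (cases "a = b") (simp_all add: sum.delta)
  qed
  finally show ?thesis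
    unfolding classical_matrices_iff if_P[OF True] by (intro conjI dual_unit_matrix_carrier)
next
  case False
  let ?N = "matrix_size t n" and ?s = "form_sign t n"
  let ?U = "dual_unit_matrix t n a b"
  have U: "?U $$ (c, d) = ((if c = b \<and> d = a then 1 else 0)
      - ?s a * ?s b * (if c = ?N - 1 - a \<and> d = ?N - 1 - b then 1 else 0)) / 2"
    if "c < ?N" "d < ?N" for c d
    by (simp only: dual_unit_matrix_entry[OF that] trace_correction_def projection_degree_def
        False if_False if_cancel diff_0_right)
  have flip: "?N - 1 - c = d \<longleftrightarrow> c = ?N - 1 - d" "?N - 1 - c = ?N - 1 - d \<longleftrightarrow> c = d"
    if "c < ?N" "d < ?N" for c d using that by auto
  have "?U $$ (?N - 1 - c, ?N - 1 - d) = - (?s c * ?s d * ?U $$ (d, c))"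
    if cd: "c < ?N" "d < ?N" for c d
  proof -
    \<comment> \<open>Two reflected pairs of signs contribute the square of the symmetry of the form.\<close>
    have 1: "?s c * ?s d * (?s a * ?s b) = 1" if "c = ?N - 1 - b \<and> d = ?N - 1 - a"
    proof -
      have "?s c * ?s d * (?s a * ?s b) = (?s b * ?s (?N - 1 - b)) * (?s a * ?s (?N - 1 - a))"
        using that by simp
      also have "\<dots> = 1"
        unfolding form_sign_opposite[OF assms(1)] form_sign_opposite[OF assms(2)]
        using False by (cases t) (simp_all add: form_symmetry_def)
      finally show ?thesis .
    qed
    have 2: "?s c * ?s d = ?s a * ?s b" if "c = a \<and> d = b"
      using that by simp
    have lt: "?N - 1 - c < ?N" "?N - 1 - d < ?N" using cd by auto
    have U1: "?U $$ (?N - 1 - c, ?N - 1 - d) = ((if c = ?N - 1 - b \<and> d = ?N - 1 - a then 1 else 0)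
        - ?s a * ?s b * (if c = a \<and> d = b then 1 else 0)) / 2"
      unfolding U[OF lt] flip(1)[OF cd(1) assms(2)] flip(1)[OF cd(2) assms(1)]
        flip(2)[OF cd(1) assms(1)] flip(2)[OF cd(2) assms(2)] ..
    have U2: "?U $$ (d, c) = ((if c = a \<and> d = b then 1 else 0)
        - ?s a * ?s b * (if c = ?N - 1 - b \<and> d = ?N - 1 - a then 1 else 0)) / 2"
      unfolding U[OF cd(2,1)] by (simp only: conj_commute)
    have "((if P then 1 else 0) - S * (if Q then 1 else 0)) / 2
        = - (T * (((if Q then 1 else 0) - S * (if P then 1 else 0)) / 2))"
      if "P \<Longrightarrow> T * S = 1" "Q \<Longrightarrow> T = S" for P Q and S T :: complex
      using that by (cases P; cases Q) (simp_all add: field_simps)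
    note key = this
    show ?thesis unfolding U1 U2 by (rule key, erule 1, erule 2)
  qed
  then show ?thesis
    unfolding classical_matrices_iff if_not_P[OF False] by (intro conjI dual_unit_matrix_carrier) blast
qed

definition grading_matrix :: "nat \<Rightarrow> complex mat" where
  "grading_matrix N = mat N N (\<lambda>(a, b). if a = b then (of_nat N - 1) / 2 - of_nat a else 0)"

lemma grading_matrix_classical: "grading_matrix (matrix_size t n) \<in> classical_matrices t n"
proof (cases "t = Type_A")
  case True
  have *: "(\<Sum>i<k. c - of_nat i) = of_nat k * (c - (of_nat k - 1) / 2)" for k and c :: complex
    by (induction k) (simp_all add: field_simps)
  have "(\<Sum>i<matrix_size t n. grading_matrix (matrix_size t n) $$ (i, i)) = 0"
    using *[of "(of_nat (matrix_size t n) - 1) / 2" "matrix_size t n"]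
    by (simp add: grading_matrix_def)
  then show ?thesis
    unfolding classical_matrices_iff using True by (simp add: grading_matrix_def)
next
  case False
  have "(of_nat N - 1) / 2 - of_nat (N - Suc a) = - ((of_nat N - 1) / 2 - of_nat a :: complex)"
    if "a < N" for a N
    using that by (simp add: of_nat_diff field_simps)
  then show ?thesis
    using False by (auto simp: classical_matrices_iff grading_matrix_def form_sign_square)
qed

section \<open>Roots and weights in terms of matrix entries\<close>

text \<open>
  The value of a weight on the \<open>a\<close>-th diagonal entry: for the orthogonal and symplectic algebras the
  coordinates \<open>\<mu>\<^sub>1, \<dots>, \<mu>\<^sub>n\<close> are followed by their negatives in reverse order, with a \<open>0\<close> in between
  for odd size. The weight \<open>basis_weight t n a\<close> is the function "\<open>a\<close>-th diagonal entry" itself, that is,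
  the weight of the \<open>a\<close>-th natural basis vector.
\<close>

definition weight_coordinate :: "classical_type \<Rightarrow> nat \<Rightarrow> (nat \<Rightarrow> real) \<Rightarrow> nat \<Rightarrow> real" where
  "weight_coordinate t n \<mu> a = (if a < eucl_dim t n then \<mu> (a + 1) else 0)
     - (if t \<noteq> Type_A \<and> matrix_size t n - 1 - a < n then \<mu> (matrix_size t n - a) else 0)"

definition basis_weight :: "classical_type \<Rightarrow> nat \<Rightarrow> nat \<Rightarrow> nat \<Rightarrow> real" where
  "basis_weight t n a = (\<lambda>j. (if a < eucl_dim t n \<and> j = a + 1 then 1 else 0)
     - (if t \<noteq> Type_A \<and> matrix_size t n - 1 - a < n \<and> j = matrix_size t n - a then 1 else 0))"

definition nonneg_combination :: "classical_type \<Rightarrow> nat \<Rightarrow> (nat \<Rightarrow> real) \<Rightarrow> bool" where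
  "nonneg_combination t n \<beta> \<longleftrightarrow>
     (\<exists>c::nat \<Rightarrow> nat. \<beta> = (\<lambda>j. \<Sum>i=1..n. real (c i) * simple_root t n i j))"

locale classical_algebra =
  fixes t :: classical_type and n :: nat and \<phi> :: "'g::complex_lie_algebra \<Rightarrow> complex mat"
  assumes rank: "admissible_rank t n" and iso: "classical_iso t n \<phi>"
begin

abbreviation mat_dim :: nat where "mat_dim \<equiv> matrix_size t n"

definition entry :: "'g \<Rightarrow> nat \<Rightarrow> nat \<Rightarrow> complex" where
  "entry x a b = (if a < mat_dim \<and> b < mat_dim then \<phi> x $$ (a, b) else 0)"

definition from_matrix :: "complex mat \<Rightarrow> 'g" where
  "from_matrix = inv_into UNIV \<phi>"

definition dual_unit :: "nat \<Rightarrow> nat \<Rightarrow> 'g" where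
  "dual_unit a b = from_matrix (dual_unit_matrix t n a b)"

definition grading :: 'g where
  "grading = from_matrix (grading_matrix mat_dim)"

lemma matrix_classical: "\<phi> x \<in> classical_matrices t n"
  using iso bij_betw_apply[of \<phi> UNIV "classical_matrices t n" x] by (simp add: classical_iso_def)

lemma matrix_carrier: "\<phi> x \<in> carrier_mat mat_dim mat_dim"
  using matrix_classical[of x] by (simp add: classical_matrices_iff)

lemma from_matrix: "M \<in> classical_matrices t n \<Longrightarrow> \<phi> (from_matrix M) = M"
  using iso bij_betw_inv_into_right[of \<phi> UNIV "classical_matrices t n" M]
  by (simp add: classical_iso_def from_matrix_def)

lemma entry_dual_unit:
  assumes "a < mat_dim" "b < mat_dim" "c < mat_dim" "d < mat_dim"
  shows "entry (dual_unit a b) c d =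
     ((if c = b \<and> d = a then 1 else 0) - form_sign t n a * form_sign t n b
        * (if c = mat_dim - 1 - a \<and> d = mat_dim - 1 - b then 1 else 0)) / projection_degree t
     - (if a = b \<and> c = d then trace_correction t n else 0)"
proof -
  have "\<phi> (dual_unit a b) = dual_unit_matrix t n a b"
    unfolding dual_unit_def
    by (rule from_matrix, rule dual_unit_matrix_classical) (use assms in \<open>simp_all\<close>)
  then show ?thesis
    using assms dual_unit_matrix_entry[of c t n d a b] by (simp only: entry_def simp_thms if_True)
qed

lemma entry_trace:
  assumes "t = Type_A" shows "(\<Sum>a<mat_dim. entry x a a) = 0"
proof -
  have "(\<Sum>a<mat_dim. \<phi> x $$ (a, a)) = 0"
    using matrix_classical[of x] unfolding classical_matrices_iff if_P[OF assms] by blast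
  then show ?thesis by (simp add: entry_def)
qed

lemma entry_reflect:
  assumes "t \<noteq> Type_A" "a < mat_dim" "b < mat_dim"
  shows "form_sign t n a * form_sign t n b * entry x (mat_dim - 1 - b) (mat_dim - 1 - a) = - entry x a b"
proof -
  have "\<phi> x $$ (mat_dim - 1 - b, mat_dim - 1 - a) = - (form_sign t n b * form_sign t n a * \<phi> x $$ (a, b))"
    using matrix_classical[of x] assms unfolding classical_matrices_iff by auto
  then have "form_sign t n a * form_sign t n b * entry x (mat_dim - 1 - b) (mat_dim - 1 - a)
      = - ((form_sign t n a * form_sign t n a) * (form_sign t n b * form_sign t n b) * entry x a b)"
    using assms by (simp add: entry_def)
  then show ?thesis using assms by (simp add: form_sign_square)
qed

text \<open>
  The matrix unit at \<open>(b, a)\<close> picks the entry \<open>(a, b)\<close> of \<open>x\<close>. Its reflection picks the same entry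
  once more by the symmetry of \<open>x\<close>, which the factor \<open>1 / 2\<close> compensates, and the trace correction
  pairs to \<open>0\<close> since \<open>x\<close> is traceless in type A.
\<close>

lemma entry_dual_pairing:
  assumes ab: "a < mat_dim" "b < mat_dim"
  shows "(\<Sum>c<mat_dim. \<Sum>d<mat_dim. entry (dual_unit a b) c d * entry x d c) = entry x a b"
proof -
  have pick: "(\<Sum>c<mat_dim. \<Sum>d<mat_dim. (if c = k \<and> d = l then 1 else 0) * entry x d c) = entry x l k"
    if "k < mat_dim" "l < mat_dim" for k l
  proof -
    have "(\<Sum>d<mat_dim. (if c = k \<and> d = l then 1 else 0) * entry x d c)
        = (if c = k then entry x l k else 0)" for c
    proof -
      have "(\<Sum>d<mat_dim. (if c = k \<and> d = l then 1 else 0) * entry x d c)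
          = (\<Sum>d<mat_dim. if d = l then if c = k then entry x l k else 0 else 0)"
        by (rule sum.cong) auto
      then show ?thesis using that by simp
    qed
    then show ?thesis using that by simp
  qed
  have diag: "(\<Sum>c<mat_dim. \<Sum>d<mat_dim. (if a = b \<and> c = d then trace_correction t n else 0) * entry x d c) = 0"
  proof -
    have "(\<Sum>d<mat_dim. (if a = b \<and> c = d then trace_correction t n else 0) * entry x d c)
        = (if a = b then trace_correction t n else 0) * entry x c c" if "c < mat_dim" for c
    proof -
      have "(\<Sum>d<mat_dim. (if a = b \<and> c = d then trace_correction t n else 0) * entry x d c)
          = (\<Sum>d<mat_dim. if d = c then (if a = b then trace_correction t n else 0) * entry x c c else 0)"
        by (rule sum.cong) auto
      then show ?thesis using that by simp
    qed
    then have "(\<Sum>c<mat_dim. \<Sum>d<mat_dim. (if a = b \<and> c = d then trace_correction t n else 0) * entry x d c)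
        = (if a = b then trace_correction t n else 0) * (\<Sum>c<mat_dim. entry x c c)"
      by (simp add: sum_distrib_left)
    also have "\<dots> = 0"
    proof (cases "t = Type_A")
      case True
      show ?thesis by (simp only: entry_trace[OF True] mult_zero_right)
    qed (simp add: trace_correction_def)
    finally show ?thesis .
  qed
  let ?s = "form_sign t n a * form_sign t n b" and ?q = "projection_degree t"
  have "(\<Sum>c<mat_dim. \<Sum>d<mat_dim. entry (dual_unit a b) c d * entry x d c)
     = (\<Sum>c<mat_dim. \<Sum>d<mat_dim. (1 / ?q) * ((if c = b \<and> d = a then 1 else 0) * entry x d c)
         - (?s / ?q) * ((if c = mat_dim - 1 - a \<and> d = mat_dim - 1 - b then 1 else 0) * entry x d c)
         - (if a = b \<and> c = d then trace_correction t n else 0) * entry x d c)"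
  proof (intro sum.cong HOL.refl)
    fix c d assume "c \<in> {..<mat_dim}" "d \<in> {..<mat_dim}"
    then have "c < mat_dim" "d < mat_dim" by auto
    have "((p - s * r) / k - u) * y = 1 / k * (p * y) - s / k * (r * y) - u * y" for p s r k u y :: complex
      by (simp add: diff_divide_distrib left_diff_distrib)
    then show "entry (dual_unit a b) c d * entry x d c
      = (1 / ?q) * ((if c = b \<and> d = a then 1 else 0) * entry x d c)
         - (?s / ?q) * ((if c = mat_dim - 1 - a \<and> d = mat_dim - 1 - b then 1 else 0) * entry x d c)
         - (if a = b \<and> c = d then trace_correction t n else 0) * entry x d c"
      unfolding entry_dual_unit[OF ab \<open>c < mat_dim\<close> \<open>d < mat_dim\<close>] .
  qed
  also have "\<dots> = 1 / ?q * entry x a b - ?s / ?q * entry x (mat_dim - 1 - b) (mat_dim - 1 - a)"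
  proof -
    have "mat_dim - 1 - a < mat_dim" "mat_dim - 1 - b < mat_dim" using ab by auto
    then show ?thesis
      by (simp only: sum_subtractf sum_distrib_left[symmetric] pick ab diag diff_0_right)
  qed
  also have "\<dots> = entry x a b"
  proof (cases "t = Type_A")
    case True
    then have "form_sign t n a = 0" "projection_degree t = 1"
      by (simp_all add: form_sign_def projection_degree_def)
    then show ?thesis by simp
  next
    case False
    then show ?thesis using entry_reflect[OF False ab, of x] by (simp add: projection_degree_def)
  qed
  finally show ?thesis .
qed

sublocale graded_matrix_units mat_dim entry dual_unit "projection_degree t" "trace_correction t n"
  "form_symmetry t" "form_sign t n" grading
proof
  note [simp] = carrier_matD[OF matrix_carrier]
  fix x y :: 'g and c :: complex and a b c' d :: nat
  show "entry (x + y) a b = entry x a b + entry y a b"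
    using iso by (simp add: entry_def classical_iso_def)
  show "entry (c *\<^sub>C x) a b = c * entry x a b"
    using iso by (simp add: entry_def classical_iso_def)
  show "entry (lie_bracket x y) a b
      = (\<Sum>c<mat_dim. entry x a c * entry y c b) - (\<Sum>c<mat_dim. entry y a c * entry x c b)"
    if "a < mat_dim" "b < mat_dim"
  proof -
    have "\<phi> (lie_bracket x y) = \<phi> x * \<phi> y - \<phi> y * \<phi> x" using iso by (simp add: classical_iso_def)
    then show ?thesis
      using that by (simp add: entry_def scalar_prod_def atLeast0LessThan)
  qed
  show "x = y" if "\<And>a b. \<lbrakk>a < mat_dim; b < mat_dim\<rbrakk> \<Longrightarrow> entry x a b = entry y a b"
  proof -
    have "\<phi> x = \<phi> y"
      by (rule eq_matI) (use that in \<open>auto simp: entry_def\<close>)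
    then show ?thesis using iso by (auto simp: classical_iso_def bij_betw_def dest: injD)
  qed
  show "(\<Sum>c<mat_dim. \<Sum>d<mat_dim. entry (dual_unit a b) c d * entry x d c) = entry x a b"
    if "a < mat_dim" "b < mat_dim" using that by (rule entry_dual_pairing)
  show "entry (dual_unit a b) c' d =
     ((if c' = b \<and> d = a then 1 else 0) - form_sign t n a * form_sign t n b
        * (if c' = mat_dim - 1 - a \<and> d = mat_dim - 1 - b then 1 else 0)) / projection_degree t
     - (if a = b \<and> c' = d then trace_correction t n else 0)"
    if "a < mat_dim" "b < mat_dim" "c' < mat_dim" "d < mat_dim" using that by (rule entry_dual_unit)
  show "form_sign t n a * form_sign t n (mat_dim - 1 - a) = form_symmetry t" if "a < mat_dim"
    using that by (rule form_sign_opposite)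
  show "projection_degree t \<noteq> 0" by (simp add: projection_degree_def)
  show "entry grading a b = (if a = b then (of_nat mat_dim - 1) / 2 - of_nat a else 0)"
    if "a < mat_dim" "b < mat_dim"
    using that from_matrix[OF grading_matrix_classical[of t n]]
    by (simp add: entry_def grading_def grading_matrix_def)
  show "2 \<le> mat_dim" "form_symmetry t = 1 \<Longrightarrow> 3 \<le> mat_dim"
    using rank by (cases t; simp add: admissible_rank_def matrix_size_def form_symmetry_def)+
qed

lemma cartan_entry: "h \<in> cartan \<phi> \<Longrightarrow> a \<noteq> b \<Longrightarrow> entry h a b = 0"
  using matrix_carrier[of h] by (auto simp: cartan_def diagonal_mat_def entry_def)

lemma cartanI: "(\<And>a b. \<lbrakk>a < mat_dim; b < mat_dim; a \<noteq> b\<rbrakk> \<Longrightarrow> entry h a b = 0) \<Longrightarrow> h \<in> cartan \<phi>"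
  using matrix_carrier[of h] by (auto simp: cartan_def diagonal_mat_def entry_def)

lemma eucl_dim_le_size: "eucl_dim t n \<le> mat_dim"
  by (cases t) (auto simp: eucl_dim_def matrix_size_def)

lemma weight_at_entry: "weight_at t n \<phi> \<mu> h = (\<Sum>i<eucl_dim t n. complex_of_real (\<mu> (i + 1)) * entry h i i)"
proof -
  have "weight_at t n \<phi> \<mu> h = (\<Sum>i<eucl_dim t n. complex_of_real (\<mu> (i + 1)) * \<phi> h $$ (i, i))"
    unfolding weight_at_def
    by (rule sum.reindex_bij_witness[of _ "\<lambda>i. i + 1" "\<lambda>i. i - 1"]) auto
  also have "\<dots> = (\<Sum>i<eucl_dim t n. complex_of_real (\<mu> (i + 1)) * entry h i i)"
    using eucl_dim_le_size by (intro sum.cong) (auto simp: entry_def)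
  finally show ?thesis .
qed

lemma cartan_reflect:
  assumes "t \<noteq> Type_A" "a < mat_dim"
  shows "entry h (mat_dim - 1 - a) (mat_dim - 1 - a) = - entry h a a"
  using entry_reflect[OF assms(1) assms(2) assms(2), of h] assms(1) by (simp add: form_sign_square)

lemma weight_at_basis_weight:
  assumes "a < mat_dim"
  shows "weight_at t n \<phi> (basis_weight t n a) h = entry h a a"
proof -
  have "weight_at t n \<phi> (basis_weight t n a) h
      = (\<Sum>i<eucl_dim t n. if i = a then entry h a a else 0)
      - (\<Sum>i<eucl_dim t n. if t \<noteq> Type_A \<and> mat_dim - 1 - a < n \<and> i = mat_dim - 1 - a
            then entry h (mat_dim - 1 - a) (mat_dim - 1 - a) else 0)"
    unfolding weight_at_entry sum_subtractf[symmetric]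
    by (rule sum.cong) (use assms in \<open>auto simp: basis_weight_def\<close>)
  also have "\<dots> = entry h a a"
  proof (cases "t = Type_A")
    case True
    then have "eucl_dim t n = mat_dim" and A: "(t \<noteq> Type_A) = False"
      by (simp_all add: eucl_dim_def matrix_size_def)
    then show ?thesis using assms unfolding A by simp
  next
    case False
    consider "a < n" | "mat_dim - 1 - a < n" "\<not> a < n" | "\<not> a < n" "\<not> mat_dim - 1 - a < n" by blast
    then show ?thesis
    proof cases
      case 1
      then have "\<not> mat_dim - 1 - a < n" using False assms by (cases t) (auto simp: matrix_size_def)
      then show ?thesis using 1 False by (simp add: eucl_dim_def)
    next
      case 2
      then show ?thesis using False cartan_reflect[OF False assms, of h] by (simp add: eucl_dim_def)
    next
      case 3
      then have "mat_dim - 1 - a = a" using False assms by (cases t) (auto simp: matrix_size_def)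
      then have "entry h a a = 0" using cartan_reflect[OF False assms, of h] by simp
      then show ?thesis using 3 False by (simp add: eucl_dim_def)
    qed
  qed
  finally show ?thesis .
qed

lemma bracket_cartan_dual_unit:
  assumes h: "h \<in> cartan \<phi>" and ab: "a < mat_dim" "b < mat_dim"
  shows "lie_bracket h (dual_unit a b) = (entry h b b - entry h a a) *\<^sub>C dual_unit a b"
proof -
  have "(\<Sum>c<mat_dim. entry h c b *\<^sub>C dual_unit a c) = (\<Sum>c<mat_dim. if c = b then entry h b b *\<^sub>C dual_unit a b else 0)"
    by (intro sum.cong) (auto simp: cartan_entry[OF h])
  moreover have "(\<Sum>c<mat_dim. entry h a c *\<^sub>C dual_unit c b) = (\<Sum>c<mat_dim. if c = a then entry h a a *\<^sub>C dual_unit a b else 0)"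
    by (intro sum.cong) (auto simp: cartan_entry[OF h])
  ultimately show ?thesis
    using ab by (simp add: bracket_dual_unit complex_vector.scale_left_diff_distrib)
qed

lemma nonneg_combination_zero: "nonneg_combination t n (\<lambda>_. 0)"
  unfolding nonneg_combination_def by (rule exI[of _ "\<lambda>_. 0"]) simp

lemma nonneg_combination_simple:
  assumes "1 \<le> i" "i \<le> n" shows "nonneg_combination t n (simple_root t n i)"
proof -
  have eq: "simple_root t n i j = (\<Sum>k=1..n. real (if k = i then 1 else 0) * simple_root t n k j)" for j
  proof -
    have "(\<Sum>k=1..n. real (if k = i then 1 else 0) * simple_root t n k j)
        = (\<Sum>k=1..n. if k = i then simple_root t n i j else 0)"
      by (rule sum.cong) auto
    then show ?thesis using assms by simp
  qed
  show ?thesis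
    unfolding nonneg_combination_def
    by (rule exI[of _ "\<lambda>k. if k = i then 1 else 0"]) (rule ext, rule eq)
qed

lemma nonneg_combination_step:
  assumes "nonneg_combination t n (\<lambda>j. f j - g j)" "nonneg_combination t n (\<lambda>j. g j - h j)"
  shows "nonneg_combination t n (\<lambda>j. f j - h j)"
proof -
  obtain c d where "(\<lambda>j. f j - g j) = (\<lambda>j. \<Sum>i=1..n. real (c i) * simple_root t n i j)"
    "(\<lambda>j. g j - h j) = (\<lambda>j. \<Sum>i=1..n. real (d i) * simple_root t n i j)"
    using assms unfolding nonneg_combination_def by blast
  then have "f j - h j = (\<Sum>i=1..n. real (c i + d i) * simple_root t n i j)" for j
    by (simp add: fun_eq_iff distrib_right sum.distrib)
       (metis (no_types, lifting) add_diff_cancel_left' diff_add_cancel diff_diff_eq2)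
  then show ?thesis unfolding nonneg_combination_def by (intro exI[of _ "\<lambda>i. c i + d i"]) auto
qed

lemma basis_weight_cases:
  assumes "t \<noteq> Type_A"
  shows "b < n \<Longrightarrow> basis_weight t n b = std_vec (b + 1)"
    and "b < mat_dim \<Longrightarrow> mat_dim - 1 - b < n \<Longrightarrow> basis_weight t n b = (\<lambda>j. - std_vec (mat_dim - b) j)"
    and "t = Type_B \<Longrightarrow> basis_weight t n n = (\<lambda>_. 0)"
proof -
  have dim: "eucl_dim t n = n" "2 * n \<le> mat_dim" "mat_dim \<le> 2 * n + 1"
    using assms by (cases t; simp add: eucl_dim_def matrix_size_def)+
  show "basis_weight t n b = std_vec (b + 1)" if "b < n"
  proof -
    have "\<not> mat_dim - 1 - b < n" using that dim by linarith
    then show ?thesis using that by (simp add: basis_weight_def std_vec_def dim(1))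
  qed
  show "basis_weight t n b = (\<lambda>j. - std_vec (mat_dim - b) j)" if "b < mat_dim" "mat_dim - 1 - b < n"
  proof -
    have "\<not> b < n" using that dim by linarith
    then show ?thesis
      using that(2) assms by (simp add: basis_weight_def std_vec_def dim(1) fun_eq_iff)
  qed
  show "basis_weight t n n = (\<lambda>_. 0)" if "t = Type_B"
    using that by (simp add: basis_weight_def eucl_dim_def matrix_size_def)
qed

text \<open>
  Consecutive natural basis vectors differ in weight by a simple root. The exception in type D is the
  middle pair, whose weights differ by twice a unit vector, which is not a root.
\<close>

lemma basis_weight_diff_simple:
  assumes "Suc b < mat_dim" "\<not> (t = Type_D \<and> b = n - 1)"
  obtains i where "1 \<le> i" "i \<le> n"
    "(\<lambda>j. basis_weight t n b j - basis_weight t n (Suc b) j) = simple_root t n i"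
proof (cases "t = Type_A")
  case True
  have "(\<lambda>j. basis_weight t n b j - basis_weight t n (Suc b) j) = simple_root t n (b + 1)"
    using True assms(1)
    by (simp add: fun_eq_iff basis_weight_def simple_root_def std_vec_def eucl_dim_def matrix_size_def)
  then show ?thesis
    using that[of "b + 1"] True assms(1) by (simp add: matrix_size_def)
next
  case False
  note wt = basis_weight_cases[OF False]
  have n: "2 \<le> n" using admissible_rank_ge[OF rank] False by blast
  have dim: "2 * n \<le> mat_dim" "mat_dim \<le> 2 * n + 1"
    using False by (cases t; simp add: matrix_size_def)+
  have "b < n - 1 \<or> (b = n - 1 \<and> t = Type_B) \<or> (b = n - 1 \<and> t = Type_C)
      \<or> (b = n \<and> t = Type_B) \<or> mat_dim - 1 - b < n"
    using assms False n by (cases t; simp add: matrix_size_def; arith)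
  then consider "b < n - 1" | "b = n - 1" "t = Type_B" | "b = n - 1" "t = Type_C"
    | "b = n" "t = Type_B" | "mat_dim - 1 - b < n"
    by blast
  then show ?thesis
  proof cases
    case 1
    then have "Suc b < n" by simp
    then have "(\<lambda>j. basis_weight t n b j - basis_weight t n (Suc b) j) = simple_root t n (b + 1)"
      using wt(1)[of b] wt(1)[of "Suc b"] by (simp add: simple_root_def)
    then show ?thesis using that[of "b + 1"] 1 by simp
  next
    case 2
    then have b: "Suc b = n" "b < n" using n by auto
    have "(\<lambda>j. basis_weight t n b j - basis_weight t n (Suc b) j) = simple_root t n n"
      unfolding b(1) wt(1)[OF b(2)] wt(3)[OF 2(2)] using 2 b by (simp add: simple_root_def)
    then show ?thesis using that[of n] n by simp
  next
    case 3
    then have b: "Suc b = n" "b < n" "n < mat_dim" "mat_dim - 1 - n < n" "mat_dim - n = n"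
      using n by (auto simp: matrix_size_def)
    have "(\<lambda>j. basis_weight t n b j - basis_weight t n (Suc b) j) = simple_root t n n"
      unfolding b(1) wt(1)[OF b(2)] wt(2)[OF b(3,4)] b(5)
      using 3 b(1) by (simp add: simple_root_def fun_eq_iff)
    then show ?thesis using that[of n] n by simp
  next
    case 4
    then have b: "Suc n < mat_dim" "mat_dim - 1 - Suc n < n" "mat_dim - Suc n = n"
      using n by (auto simp: matrix_size_def)
    have "(\<lambda>j. basis_weight t n b j - basis_weight t n (Suc b) j) = simple_root t n n"
      unfolding 4(1) wt(3)[OF 4(2)] wt(2)[OF b(1,2)] b(3)
      using 4 by (simp add: simple_root_def fun_eq_iff)
    then show ?thesis using that[of n] n by simp
  next
    case 5
    have b: "b < mat_dim" "mat_dim - 1 - Suc b < n" "mat_dim - Suc b = mat_dim - 1 - b"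
      "mat_dim - b = mat_dim - 1 - b + 1" using assms(1) 5 by auto
    have "(\<lambda>j. basis_weight t n b j - basis_weight t n (Suc b) j) = simple_root t n (mat_dim - 1 - b)"
      unfolding wt(2)[OF b(1) 5] wt(2)[OF assms(1) b(2)] b(3,4) using 5
      by (simp add: simple_root_def fun_eq_iff)
    then show ?thesis using that[of "mat_dim - 1 - b"] 5 assms(1) by simp
  qed
qed

lemma basis_weight_chain:
  assumes "b \<le> a" "a < mat_dim" "\<And>c. \<lbrakk>b \<le> c; c < a\<rbrakk> \<Longrightarrow> \<not> (t = Type_D \<and> c = n - 1)"
  shows "nonneg_combination t n (\<lambda>j. basis_weight t n b j - basis_weight t n a j)"
  using assms
proof (induction a rule: dec_induct)
  case base
  then show ?case by (simp add: nonneg_combination_zero)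
next
  case (step a)
  obtain i where "1 \<le> i" "i \<le> n" "(\<lambda>j. basis_weight t n a j - basis_weight t n (Suc a) j) = simple_root t n i"
    by (rule basis_weight_diff_simple[of a]) (use step in auto)
  then have "nonneg_combination t n (\<lambda>j. basis_weight t n a j - basis_weight t n (Suc a) j)"
    using nonneg_combination_simple by simp
  moreover have "nonneg_combination t n (\<lambda>j. basis_weight t n b j - basis_weight t n a j)"
    using step by simp
  ultimately show ?case by (blast intro: nonneg_combination_step)
qed

text \<open>
  Differences of weights telescope into simple roots. In type D a chain across the middle has to
  avoid the exceptional pair; the last simple root \<open>e\<^bsub>n-1\<^esub> + e\<^sub>n\<close> is the difference between the
  matrix indices \<open>n - 2\<close> and \<open>n\<close>, and also between \<open>n - 1\<close> and \<open>n + 1\<close>.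
\<close>

lemma basis_weight_diff_nonneg:
  assumes "b < a" "a < mat_dim" "\<not> (t = Type_D \<and> b = n - 1 \<and> a = n)"
  shows "nonneg_combination t n (\<lambda>j. basis_weight t n b j - basis_weight t n a j)"
proof (cases "t = Type_D \<and> b \<le> n - 1 \<and> n \<le> a")
  case False
  then show ?thesis using assms by (intro basis_weight_chain) auto
next
  case True
  then have n: "4 \<le> n" "mat_dim = 2 * n" "eucl_dim t n = n"
    using rank by (auto simp: admissible_rank_def matrix_size_def eucl_dim_def)
  have last: "nonneg_combination t n (simple_root t n n)"
    using n by (intro nonneg_combination_simple) auto
  show ?thesis
  proof (cases "b = n - 1")
    case b: True
    have "(\<lambda>j. basis_weight t n (n - 1) j - basis_weight t n (n + 1) j) = simple_root t n n"
      using True n by (auto simp: fun_eq_iff basis_weight_def simple_root_def std_vec_def)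
    moreover have "nonneg_combination t n (\<lambda>j. basis_weight t n (n + 1) j - basis_weight t n a j)"
      using b True assms by (intro basis_weight_chain) auto
    ultimately show ?thesis
      using last b nonneg_combination_step[of "basis_weight t n (n - 1)" "basis_weight t n (n + 1)"] by simp
  next
    case b: False
    have "(\<lambda>j. basis_weight t n (n - 2) j - basis_weight t n n j) = simple_root t n n"
      using True n by (auto simp: fun_eq_iff basis_weight_def simple_root_def std_vec_def)
    then have "nonneg_combination t n (\<lambda>j. basis_weight t n (n - 2) j - basis_weight t n n j)"
      using last by simp
    moreover have "nonneg_combination t n (\<lambda>j. basis_weight t n b j - basis_weight t n (n - 2) j)"
      using b True n assms by (intro basis_weight_chain) auto
    moreover have "nonneg_combination t n (\<lambda>j. basis_weight t n n j - basis_weight t n a j)"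
      using b True n assms by (intro basis_weight_chain) auto
    ultimately show ?thesis by (blast intro: nonneg_combination_step)
  qed
qed

lemma basis_weight_neq:
  assumes "b < a" "a < mat_dim"
  shows "(\<lambda>j. basis_weight t n b j - basis_weight t n a j) \<noteq> (\<lambda>_. 0)"
proof -
  have "\<exists>j. basis_weight t n b j \<noteq> basis_weight t n a j"
  proof (cases "b < eucl_dim t n")
    case True
    then have "basis_weight t n b (b + 1) \<noteq> basis_weight t n a (b + 1)"
      using assms by (cases t) (auto simp: basis_weight_def eucl_dim_def matrix_size_def)
    then show ?thesis by blast
  next
    case False
    then have "basis_weight t n b (mat_dim - a) \<noteq> basis_weight t n a (mat_dim - a)"
      using assms by (cases t) (auto simp: basis_weight_def eucl_dim_def matrix_size_def)
    then show ?thesis by blast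
  qed
  then show ?thesis by (metis eq_iff_diff_eq_0)
qed

lemma weight_at_diff:
  "weight_at t n \<phi> (\<lambda>j. \<mu> j - \<mu>' j) h = weight_at t n \<phi> \<mu> h - weight_at t n \<phi> \<mu>' h"
  by (simp add: weight_at_def left_diff_distrib sum_subtractf)

text \<open>
  Brackets with diagonal matrices scale a dual unit by a difference of diagonal entries. Above the
  diagonal this difference is a non-negative combination of simple roots, except at the middle of the
  antidiagonal in type D, where the dual unit is \<open>0\<close>.
\<close>

lemma dual_unit_root_vector:
  assumes ab: "b < a" "a < mat_dim" and "dual_unit a b \<noteq> 0"
  shows "dual_unit a b \<in> root_space t n \<phi> (\<lambda>j. basis_weight t n b j - basis_weight t n a j)"
    and "(\<lambda>j. basis_weight t n b j - basis_weight t n a j) \<in> positive_roots t n \<phi>"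
proof -
  show root: "dual_unit a b \<in> root_space t n \<phi> (\<lambda>j. basis_weight t n b j - basis_weight t n a j)"
    using ab by (simp add: root_space_def bracket_cartan_dual_unit weight_at_diff weight_at_basis_weight)
  have "\<not> (t = Type_D \<and> b = n - 1 \<and> a = n)"
  proof
    assume D: "t = Type_D \<and> b = n - 1 \<and> a = n"
    have "dual_unit a b = 0"
    proof (rule entry_eqI)
      fix c d assume "c < mat_dim" "d < mat_dim"
      moreover have "b < mat_dim" "mat_dim - 1 - a = b" "mat_dim - 1 - b = a" "form_sign t n a = 1"
        "form_sign t n b = 1" "trace_correction t n = 0"
        using D ab by (auto simp: form_sign_def trace_correction_def matrix_size_def)
      ultimately show "entry (dual_unit a b) c d = entry 0 c d"
        using ab by (simp add: entry_dual_unit entry_zero)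
    qed
    then show False using assms by simp
  qed
  then show "(\<lambda>j. basis_weight t n b j - basis_weight t n a j) \<in> positive_roots t n \<phi>"
    using basis_weight_diff_nonneg[OF ab] basis_weight_neq[OF ab] root assms(3)
    by (auto simp: positive_roots_def nonneg_combination_def)
qed

text \<open>
  The link between the intrinsic notion of highest weight vector and the one in terms of dual units. In
  type A the trace correction evaluates to a multiple of the coordinate sum of \<open>\<mu>\<close>, which is \<open>0\<close>.
\<close>

lemma highest_weight_vector_highest:
  assumes v: "highest_weight_vector t n \<phi> \<mu> \<sigma> v" and \<sigma>: "lie_rep \<sigma>"
    and \<mu>: "\<mu> \<in> weight_space t n"
  shows "highest_vector \<sigma> (\<lambda>a. complex_of_real (weight_coordinate t n \<mu> a)) v"
  unfolding highest_vector_def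
proof (intro conjI allI impI)
  show "v \<noteq> 0" using v by (simp add: highest_weight_vector_def)
  show "\<sigma> (dual_unit a b) v = 0" if "a < mat_dim" "b < a" for a b
  proof (cases "dual_unit a b = 0")
    case True
    then show ?thesis by (simp add: lie_rep_simps[OF \<sigma>])
  next
    case False
    then show ?thesis
      using dual_unit_root_vector[OF \<open>b < a\<close> \<open>a < mat_dim\<close>] v unfolding highest_weight_vector_def by blast
  qed
  show "\<sigma> (dual_unit a a) v = (complex_of_real (weight_coordinate t n \<mu> a) / projection_degree t) *\<^sub>C v"
    if a: "a < mat_dim" for a
  proof -
    have "dual_unit a a \<in> cartan \<phi>"
      by (rule cartanI) (use a in \<open>auto simp: entry_dual_unit\<close>)
    moreover have "weight_at t n \<phi> \<mu> (dual_unit a a) = complex_of_real (weight_coordinate t n \<mu> a) / projection_degree t"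
    proof (cases "t = Type_A")
      case True
      have N: "eucl_dim t n = mat_dim" using True by (simp add: eucl_dim_def matrix_size_def)
      have "(\<Sum>i<mat_dim. \<mu> (i + 1)) = (\<Sum>j=1..n+1. \<mu> j)"
        using True
        by (intro sum.reindex_bij_witness[of _ "\<lambda>i. i - 1" "\<lambda>i. i + 1"]) (auto simp: matrix_size_def)
      also have "\<dots> = 0" using \<mu> True by (simp add: weight_space_def)
      finally have sum: "(\<Sum>i<mat_dim. complex_of_real (\<mu> (i + 1))) = 0"
        by (simp flip: of_real_sum)
      have A: "form_sign t n a = 0" "projection_degree t = 1"
        using True by (simp_all add: form_sign_def projection_degree_def)
      have "weight_at t n \<phi> \<mu> (dual_unit a a)
          = (\<Sum>i<mat_dim. if i = a then complex_of_real (\<mu> (a + 1)) else 0)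
            - (\<Sum>i<mat_dim. complex_of_real (\<mu> (i + 1)) * trace_correction t n)"
        unfolding weight_at_entry N sum_subtractf[symmetric]
        by (rule sum.cong) (use a in \<open>auto simp: entry_dual_unit A right_diff_distrib\<close>)
      also have "\<dots> = complex_of_real (\<mu> (a + 1))"
        unfolding sum_distrib_right[symmetric] sum using a by simp
      finally show ?thesis
        using True a N by (simp add: weight_coordinate_def projection_degree_def)
    next
      case False
      have k: "eucl_dim t n = n" "n \<le> mat_dim" using False by (cases t; simp add: eucl_dim_def matrix_size_def)+
      have "weight_at t n \<phi> \<mu> (dual_unit a a)
          = ((\<Sum>i<n. if i = a then complex_of_real (\<mu> (i + 1)) else 0)
            - (\<Sum>i<n. if i = mat_dim - 1 - a then complex_of_real (\<mu> (i + 1)) else 0)) / 2"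
        unfolding weight_at_entry k sum_subtractf[symmetric] sum_divide_distrib
        by (rule sum.cong)
           (use a False k in \<open>auto simp: entry_dual_unit form_sign_square projection_degree_def
              trace_correction_def\<close>)
      also have "\<dots> = complex_of_real (weight_coordinate t n \<mu> a) / projection_degree t"
      proof -
        have "mat_dim - 1 - a + 1 = mat_dim - a" using a by simp
        then show ?thesis using False k by (simp add: weight_coordinate_def projection_degree_def)
      qed
      finally show ?thesis .
    qed
    ultimately show ?thesis using v by (simp add: highest_weight_vector_def)
  qed
qed

lemma fundamental_coordinate:
  assumes "a < mat_dim"
  shows "complex_of_real (weight_coordinate t n (fundamental_weight t n 1) a)
    = projection_degree t * entry (dual_unit a a) 0 0"
proof -
  have n: "1 \<le> n" using admissible_rank_ge[OF rank] by simp
  show ?thesis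
    unfolding fundamental_weight_1[OF rank] entry_dual_unit[OF assms assms zero_less_size zero_less_size]
    using assms n
    by (cases t) (auto simp: weight_coordinate_def form_sign_def projection_degree_def
        trace_correction_def std_vec_def eucl_dim_def matrix_size_def)
qed

end

section \<open>The closed forms in Euclidean coordinates\<close>

context classical_algebra
begin

theorem casimir_gf_sum:
  fixes \<sigma> :: "'g \<Rightarrow> 'v::complex_vector \<Rightarrow> 'v" and \<kappa> :: "'g \<Rightarrow> 'w::complex_vector \<Rightarrow> 'w"
  assumes lam: "lam \<in> weight_space t n"
    and \<sigma>: "irreducible_rep_of_weight t n \<phi> lam \<sigma>"
    and \<kappa>: "irreducible_rep_of_weight t n \<phi> (fundamental_weight t n 1) \<kappa>"
    and X: "lie_basis X d" "dual_basis \<kappa> X X' d"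
  shows "casimir_gf \<kappa> X X' d \<sigma>
    = (\<Sum>a<mat_dim. diag_laurent (\<lambda>a. complex_of_real (weight_coordinate t n lam a)) a)"
proof -
  have one: "1 \<in> {1..n}" using admissible_rank_ge[OF rank] by simp
  obtain v\<^sub>0 where "highest_weight_vector t n \<phi> lam \<sigma> v\<^sub>0" and irr: "irreducible_rep \<sigma>"
    using \<sigma> by (auto simp: irreducible_rep_of_weight_def)
  then have v: "highest_vector \<sigma> (\<lambda>a. complex_of_real (weight_coordinate t n lam a)) v\<^sub>0"
    using lam by (intro highest_weight_vector_highest) (auto simp: irreducible_rep_def)
  obtain w\<^sub>0 where "highest_weight_vector t n \<phi> (fundamental_weight t n 1) \<kappa> w\<^sub>0"
    and irr_\<kappa>: "irreducible_rep \<kappa>"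
    using \<kappa> by (auto simp: irreducible_rep_of_weight_def)
  then have "highest_vector \<kappa> (\<lambda>a. complex_of_real (weight_coordinate t n (fundamental_weight t n 1) a)) w\<^sub>0"
    by (intro highest_weight_vector_highest fundamental_weight_in_weight_space[OF rank one])
       (auto simp: irreducible_rep_def)
  then have w: "highest_vector \<kappa> (\<lambda>a. projection_degree t * entry (dual_unit a a) 0 0) w\<^sub>0"
    by (simp add: highest_vector_def fundamental_coordinate del: One_nat_def)
  show ?thesis by (rule casimir_gf_eq[OF irr v irr_\<kappa> w X])
qed

end

lemma dominant_integral_weight_space:
  assumes "admissible_rank t n" "lam \<in> dominant_integral t n"
  shows "lam \<in> weight_space t n"
proof -
  obtain k :: "nat \<Rightarrow> nat" where lam: "lam = (\<lambda>j. \<Sum>i=1..n. real (k i) * fundamental_weight t n i j)"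
    using assms(2) by (auto simp: dominant_integral_def)
  have w: "fundamental_weight t n i \<in> weight_space t n" if "i \<in> {1..n}" for i
    by (rule fundamental_weight_in_weight_space[OF assms(1) that])
  show ?thesis
    unfolding weight_space_def lam
  proof (intro CollectI conjI allI impI)
    show "(\<Sum>i=1..n. real (k i) * fundamental_weight t n i j) = 0" if "j \<notin> {1..eucl_dim t n}" for j
      using w that by (intro sum.neutral) (auto simp: weight_space_def)
    assume A: "t = Type_A"
    have "(\<Sum>j=1..n+1. \<Sum>i=1..n. real (k i) * fundamental_weight t n i j)
        = (\<Sum>i=1..n. real (k i) * (\<Sum>j=1..n+1. fundamental_weight t n i j))"
      unfolding sum_distrib_left by (rule sum.swap)
    also have "\<dots> = 0"
      using w A by (intro sum.neutral) (auto simp: weight_space_def)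
    finally show "(\<Sum>j=1..n+1. \<Sum>i=1..n. real (k i) * fundamental_weight t n i j) = 0" .
  qed
qed

text \<open>
  The signed Euclidean index belonging to a matrix index: \<open>1, \<dots>, n\<close>, possibly \<open>0\<close>, then
  \<open>-n, \<dots>, -1\<close>.
\<close>

definition signed_index :: "nat \<Rightarrow> nat \<Rightarrow> nat \<Rightarrow> int" where
  "signed_index N n a = (if a < n then int a + 1 else if N - 1 - a < n then - int (N - a) else 0)"

lemma signed_index_bij:
  assumes "N = 2 * n \<or> N = 2 * n + 1"
  shows "bij_betw (signed_index N n) {..<N} ({-int n..int n} - (if N = 2 * n then {0} else {}))"
proof (rule bij_betw_byWitness[where
      f' = "\<lambda>i. if 0 < i then nat i - 1 else if i < 0 then N - nat (- i) else n"])
  show "\<forall>a\<in>{..<N}. (if 0 < signed_index N n a then nat (signed_index N n a) - 1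
      else if signed_index N n a < 0 then N - nat (- signed_index N n a) else n) = a"
    using assms by (auto simp: signed_index_def)
  show "\<forall>i\<in>{-int n..int n} - (if N = 2 * n then {0} else {}).
      signed_index N n (if 0 < i then nat i - 1 else if i < 0 then N - nat (- i) else n) = i"
    using assms by (auto simp: signed_index_def split: if_splits)
  show "signed_index N n ` {..<N} \<subseteq> {-int n..int n} - (if N = 2 * n then {0} else {})"
    using assms by (auto simp: signed_index_def)
  show "(\<lambda>i. if 0 < i then nat i - 1 else if i < 0 then N - nat (- i) else n)
      ` ({-int n..int n} - (if N = 2 * n then {0} else {})) \<subseteq> {..<N}"
    using assms by (auto split: if_splits)
qed

text \<open>
  In every type this is the first coordinate of \<open>\<rho>\<close>.
\<close>

definition spectral_shift :: "classical_type \<Rightarrow> nat \<Rightarrow> real" where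
  "spectral_shift t n = (case t of Type_A \<Rightarrow> n / 2 | Type_B \<Rightarrow> n - 1 / 2 | Type_C \<Rightarrow> n | Type_D \<Rightarrow> n - 1)"

lemma ell_linear:
  assumes "admissible_rank Type_A n" "a < n + 1"
  shows "ell Type_A n lam (int a + 1) - real n / 2 = weight_coordinate Type_A n lam a - real a"
proof -
  have "nat (int a + 1) = a + 1" by simp
  then show ?thesis
    using assms by (simp add: ell_def weyl_rho_eq weight_coordinate_def eucl_dim_def)
qed

text \<open>
  The number on the right is the one in the linear system for the generating functions. On the first
  half the coordinates of \<open>\<rho>\<close>, which descend in steps of \<open>1\<close> from \<open>spectral_shift t n\<close>, supply \<open>-a\<close>. On
  the second half their negatives in reverse order descend in the same way after a jump of \<open>\<epsilon>\<close>, and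
  in type B the value \<open>\<ell>\<^sub>0 = 0\<close> of the middle index lies halfway, at \<open>\<epsilon> / 2\<close>.
\<close>

lemma ell_reflected:
  assumes rank: "admissible_rank t n" and "t \<noteq> Type_A" and a: "a < matrix_size t n"
  shows "complex_of_real (ell t n lam (signed_index (matrix_size t n) n a) - spectral_shift t n)
    = complex_of_real (weight_coordinate t n lam a) - of_nat a
      + (if matrix_size t n - 1 - a < a then form_symmetry t
         else if matrix_size t n - 1 - a = a then form_symmetry t / 2 else 0)"
proof -
  let ?N = "matrix_size t n"
  have N: "2 * n \<le> ?N" "?N \<le> 2 * n + 1" "eucl_dim t n = n"
    using assms(2) by (cases t; simp add: matrix_size_def eucl_dim_def)+
  consider "a < n" | "?N - 1 - a < n" "n \<le> a" | "a = n" "?N = 2 * n + 1"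
    using N a by linarith
  then show ?thesis
  proof cases
    case 1
    then have *: "\<not> ?N - 1 - a < n" "\<not> ?N - 1 - a < a" "?N - 1 - a \<noteq> a" "nat (int a + 1) = a + 1"
      using N by auto
    have "ell t n lam (signed_index ?N n a) - spectral_shift t n = lam (a + 1) - real a"
      using 1 * assms(2) N(3) unfolding ell_def signed_index_def weyl_rho_eq[OF rank]
      by (cases t) (simp_all add: spectral_shift_def)
    moreover have "weight_coordinate t n lam a = lam (a + 1)"
      using 1 * N by (simp add: weight_coordinate_def)
    ultimately show ?thesis using * by simp
  next
    case 2
    define k where "k = ?N - a"
    have k: "1 \<le> k" "k \<le> n" "?N - a = k" "\<not> a < n" "?N - 1 - a < a" "real a = real ?N - real k"
      using 2 a N by (auto simp: k_def of_nat_diff)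
    have "signed_index ?N n a = - int k" using 2 k by (simp add: signed_index_def)
    then have "ell t n lam (signed_index ?N n a) - spectral_shift t n
        = - lam k + (- weyl_rho t n k - spectral_shift t n)"
      using k by (simp add: ell_def)
    then have "complex_of_real (ell t n lam (signed_index ?N n a) - spectral_shift t n)
        = complex_of_real (- lam k) + complex_of_real (- weyl_rho t n k - spectral_shift t n)"
      by (simp only: of_real_add)
    moreover have "weight_coordinate t n lam a = - lam k"
      using 2 k N assms(2) by (simp add: weight_coordinate_def)
    moreover have "complex_of_real (- weyl_rho t n k - spectral_shift t n) = - of_real (real a) + form_symmetry t"
      unfolding k(6) weyl_rho_eq[OF rank] using assms(2) k(1,2) N(3)
      by (cases t) (simp_all add: spectral_shift_def form_symmetry_def matrix_size_def)
    ultimately show ?thesis using k(5) by simp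
  next
    case 3
    then have B: "t = Type_B" using assms(2) by (cases t) (auto simp: matrix_size_def)
    show ?thesis
      unfolding B using 3(1)
      by (simp add: signed_index_def ell_def spectral_shift_def form_symmetry_def matrix_size_def
          weight_coordinate_def eucl_dim_def)
  qed
qed

context classical_algebra
begin

lemma casimir_gf_linear_type:
  fixes \<sigma> :: "'g \<Rightarrow> 'v::complex_vector \<Rightarrow> 'v" and \<kappa> :: "'g \<Rightarrow> 'w::complex_vector \<Rightarrow> 'w"
  assumes A: "t = Type_A"
    and gf: "lam \<in> weight_space t n" "irreducible_rep_of_weight t n \<phi> lam \<sigma>"
      "irreducible_rep_of_weight t n \<phi> (fundamental_weight t n 1) \<kappa>"
      "lie_basis X d" "dual_basis \<kappa> X X' d"
  shows "casimir_gf \<kappa> X X' d \<sigma> = 1 / fls_X * ((\<Prod>i=1..int n + 1.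
     1 + fls_X / (1 - fls_const (complex_of_real (ell t n lam i - real n / 2)) * fls_X)) - 1)"
proof -
  let ?f = "\<lambda>c. 1 + fls_X / (1 - fls_const c * fls_X) :: complex fls"
  let ?\<nu> = "\<lambda>a. complex_of_real (weight_coordinate t n lam a)"
  have "projection_degree t = 1" "form_symmetry t = 0"
    using A by (simp_all add: projection_degree_def form_symmetry_def)
  then have "casimir_gf \<kappa> X X' d \<sigma> = 1 / fls_X * ((\<Prod>a<mat_dim. ?f (?\<nu> a - of_nat a)) - 1)"
    unfolding casimir_gf_sum[OF gf] by (rule generating_function_linear)
  also have "(\<Prod>a<mat_dim. ?f (?\<nu> a - of_nat a))
      = (\<Prod>i=1..int n + 1. ?f (complex_of_real (ell t n lam i - real n / 2)))"
  proof (rule prod.reindex_bij_witness[of _ "\<lambda>i. nat i - 1" "\<lambda>a. int a + 1"])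
    fix a assume "a \<in> {..<mat_dim}"
    then have "a < n + 1" using A by (simp add: matrix_size_def)
    then have "ell t n lam (int a + 1) - real n / 2 = weight_coordinate t n lam a - real a"
      using ell_linear[of n a lam] rank A by simp
    then show "?f (complex_of_real (ell t n lam (int a + 1) - real n / 2)) = ?f (?\<nu> a - of_nat a)"
      by (simp only: of_real_diff of_real_of_nat_eq)
  qed (use A in \<open>auto simp: matrix_size_def\<close>)
  finally show ?thesis .
qed

lemma casimir_gf_reflected_type:
  fixes \<sigma> :: "'g \<Rightarrow> 'v::complex_vector \<Rightarrow> 'v" and \<kappa> :: "'g \<Rightarrow> 'w::complex_vector \<Rightarrow> 'w"
  assumes BCD: "t \<noteq> Type_A"
    and gf: "lam \<in> weight_space t n" "irreducible_rep_of_weight t n \<phi> lam \<sigma>"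
      "irreducible_rep_of_weight t n \<phi> (fundamental_weight t n 1) \<kappa>"
      "lie_basis X d" "dual_basis \<kappa> X X' d"
  shows "casimir_gf \<kappa> X X' d \<sigma> = 2 / fls_X
     * (1 - fls_const (form_symmetry t) * fls_X
          / (4 + (of_nat (matrix_size t n) - fls_const (form_symmetry t)) * fls_X))
     * ((\<Prod>i\<in>{-int n..int n} - (if t = Type_B then {} else {0}).
          1 + fls_X / (2 - fls_const (complex_of_real (ell t n lam i - spectral_shift t n)) * fls_X)) - 1)"
proof -
  let ?f = "\<lambda>c. 1 + fls_X / (2 - fls_const c * fls_X) :: complex fls"
  let ?\<nu> = "\<lambda>a. complex_of_real (weight_coordinate t n lam a)"
  let ?c = "\<lambda>a. ?\<nu> a - of_nat a + (if mat_dim - 1 - a < a then form_symmetry t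
         else if mat_dim - 1 - a = a then form_symmetry t / 2 else 0)"
  have N: "mat_dim = 2 * n \<or> mat_dim = 2 * n + 1" "eucl_dim t n = n"
    "{-int n..int n} - (if mat_dim = 2 * n then {0} else {})
      = {-int n..int n} - (if t = Type_B then {} else {0})"
    using BCD by (cases t; simp add: matrix_size_def eucl_dim_def)+
  have q: "projection_degree t = 2" using BCD by (simp add: projection_degree_def)
  have odd: "form_symmetry t = 1" if "odd mat_dim"
    using that BCD by (cases t) (auto simp: matrix_size_def form_symmetry_def)
  have opposite: "?\<nu> a + ?\<nu> (mat_dim - 1 - a) = 0" if "a < mat_dim" for a
  proof -
    have "mat_dim - (mat_dim - 1 - a) = a + 1" "mat_dim - 1 - (mat_dim - 1 - a) = a"
      "mat_dim - 1 - a + 1 = mat_dim - a"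
      using that by auto
    then have "weight_coordinate t n lam a + weight_coordinate t n lam (mat_dim - 1 - a) = 0"
      using BCD N(2) by (simp add: weight_coordinate_def)
    then show ?thesis by (metis of_real_0 of_real_add)
  qed
  have "casimir_gf \<kappa> X X' d \<sigma> = 2 / fls_X
     * (1 - fls_const (form_symmetry t) * fls_X
          / (4 + (of_nat (matrix_size t n) - fls_const (form_symmetry t)) * fls_X))
     * ((\<Prod>a<mat_dim. ?f (?c a)) - 1)"
    unfolding casimir_gf_sum[OF gf] by (rule generating_function_reflected[where \<nu> = ?\<nu>, OF q opposite odd])
  also have "(\<Prod>a<mat_dim. ?f (?c a))
      = (\<Prod>a<mat_dim. ?f (complex_of_real (ell t n lam (signed_index mat_dim n a) - spectral_shift t n)))"
    by (rule prod.cong) (simp_all only: ell_reflected[OF rank BCD] lessThan_iff)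
  also have "\<dots> = (\<Prod>i\<in>{-int n..int n} - (if t = Type_B then {} else {0}).
      ?f (complex_of_real (ell t n lam i - spectral_shift t n)))"
    by (rule prod.reindex_bij_betw[OF signed_index_bij[OF N(1), unfolded N(3)]])
  finally show ?thesis .
qed

end

theorem corollary4p9:
  fixes t :: classical_type and n :: nat
    and \<phi> :: "'g::complex_lie_algebra \<Rightarrow> complex mat"
    and lam :: "nat \<Rightarrow> real"
    and \<sigma> :: "'g \<Rightarrow> 'v::complex_vector \<Rightarrow> 'v"
    and \<sigma>\<^sub>\<kappa> :: "'g \<Rightarrow> 'w::complex_vector \<Rightarrow> 'w"
    and X X' :: "nat \<Rightarrow> 'g" and d :: nat
  assumes "admissible_rank t n"
    and "classical_iso t n \<phi>"
    and "lam \<in> dominant_integral t n"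
    and "irreducible_rep_of_weight t n \<phi> lam \<sigma>"
    and "irreducible_rep_of_weight t n \<phi> (fundamental_weight t n 1) \<sigma>\<^sub>\<kappa>"
    and "lie_basis X d"
    and "dual_basis \<sigma>\<^sub>\<kappa> X X' d"
  shows "let G = casimir_gf \<sigma>\<^sub>\<kappa> X X' d \<sigma>;
             z = fls_X :: complex fls;
             c = (\<lambda>x::real. fls_const (complex_of_real x));
             l = ell t n lam
         in (t = Type_A \<longrightarrow>
               G = 1 / z * ((\<Prod>i=1..int n + 1. 1 + z / (1 - c (l i - real n / 2) * z)) - 1)) \<and>
            (t = Type_B \<longrightarrow>
               G = 2 / z * (1 - z / (4 + 2 * of_nat n * z)) *
                   ((\<Prod>i=-int n..int n. 1 + z / (2 - c (l i - real n + 1 / 2) * z)) - 1)) \<and>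
            (t = Type_C \<longrightarrow>
               G = 2 / z * (1 + z / (4 + (2 * of_nat n + 1) * z)) *
                   ((\<Prod>i\<in>{-int n..int n} - {0}. 1 + z / (2 - c (l i - real n) * z)) - 1)) \<and>
            (t = Type_D \<longrightarrow>
               G = 2 / z * (1 - z / (4 + (2 * of_nat n - 1) * z)) *
                   ((\<Prod>i\<in>{-int n..int n} - {0}. 1 + z / (2 - c (l i - real n + 1) * z)) - 1))"
proof -
  interpret classical_algebra t n \<phi> by unfold_locales fact+
  note hyps = dominant_integral_weight_space[OF assms(1,3)] assms(4-7)
  show ?thesis
    unfolding Let_def
  proof (intro conjI impI)
    assume t: "t = Type_A"
    show "casimir_gf \<sigma>\<^sub>\<kappa> X X' d \<sigma> = 1 / fls_X * ((\<Prod>i=1..int n + 1.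
        1 + fls_X / (1 - fls_const (complex_of_real (ell t n lam i - real n / 2)) * fls_X)) - 1)"
      by (rule casimir_gf_linear_type[OF t hyps])
  next
    assume t: "t = Type_B"
    then have "t \<noteq> Type_A" by simp
    have "ell t n lam i - spectral_shift t n = ell t n lam i - real n + 1 / 2" for i
      using t by (simp add: spectral_shift_def)
    moreover have "form_symmetry t = 1" "matrix_size t n = 2 * n + 1"
      "{-int n..int n} - (if t = Type_B then {} else {0}) = {-int n..int n}"
      using t by (simp_all add: form_symmetry_def matrix_size_def)
    ultimately show "casimir_gf \<sigma>\<^sub>\<kappa> X X' d \<sigma>
      = 2 / fls_X * (1 - fls_X / (4 + 2 * of_nat n * fls_X)) * ((\<Prod>i=-int n..int n.
        1 + fls_X / (2 - fls_const (complex_of_real (ell t n lam i - real n + 1 / 2)) * fls_X)) - 1)"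
      unfolding casimir_gf_reflected_type[OF \<open>t \<noteq> Type_A\<close> hyps] by (simp only:) simp
  next
    assume t: "t = Type_C"
    then have "t \<noteq> Type_A" by simp
    have "ell t n lam i - spectral_shift t n = ell t n lam i - real n" for i
      using t by (simp add: spectral_shift_def)
    moreover have "form_symmetry t = -1" "matrix_size t n = 2 * n"
      "{-int n..int n} - (if t = Type_B then {} else {0}) = {-int n..int n} - {0}"
      using t by (simp_all add: form_symmetry_def matrix_size_def)
    ultimately show "casimir_gf \<sigma>\<^sub>\<kappa> X X' d \<sigma>
      = 2 / fls_X * (1 + fls_X / (4 + (2 * of_nat n + 1) * fls_X)) * ((\<Prod>i\<in>{-int n..int n} - {0}.
        1 + fls_X / (2 - fls_const (complex_of_real (ell t n lam i - real n)) * fls_X)) - 1)"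
      unfolding casimir_gf_reflected_type[OF \<open>t \<noteq> Type_A\<close> hyps] by (simp only:) simp
  next
    assume t: "t = Type_D"
    then have "t \<noteq> Type_A" by simp
    have "ell t n lam i - spectral_shift t n = ell t n lam i - real n + 1" for i
      using t by (simp add: spectral_shift_def)
    moreover have "form_symmetry t = 1" "matrix_size t n = 2 * n"
      "{-int n..int n} - (if t = Type_B then {} else {0}) = {-int n..int n} - {0}"
      using t by (simp_all add: form_symmetry_def matrix_size_def)
    ultimately show "casimir_gf \<sigma>\<^sub>\<kappa> X X' d \<sigma>
      = 2 / fls_X * (1 - fls_X / (4 + (2 * of_nat n - 1) * fls_X)) * ((\<Prod>i\<in>{-int n..int n} - {0}.
        1 + fls_X / (2 - fls_const (complex_of_real (ell t n lam i - real n + 1)) * fls_X)) - 1)"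
      unfolding casimir_gf_reflected_type[OF \<open>t \<noteq> Type_A\<close> hyps] by (simp only:) simp
  qed
qed

end
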